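(* Let $(R,\mathfrak{m})$ be a local ring with infinite residue field and $\operatorname{depth} R>0$, and let $I$ be a reduction of $\mathfrak{m}$. Then $$n_2(I)\leq n_3(I)=n_1(I)\leq \operatorname{reg}\mathcal{R}(\mathfrak{m}),$$ where $\mathcal{R}(\mathfrak{m})=\bigoplus_{i\geq 0}\mathfrak{m}^i$ is the Rees algebra of $\mathfrak{m}$ and $\operatorname{reg}$ denotes Castelnuovo-Mumford regularity.
   Context: All rings are commutative, Noetherian and unital; a local ring is such a ring with a unique maximal ideal $\mathfrak{m}$. For ideals $A,B$ and an element $x$ of $R$, $A:B=\{r\in R\mid rB\subseteq A\}$ and $A:x=A:(x)$. Convention: $\mathfrak{m}^0=R$. Let $(R,\mathfrak{m})$ be a local ring with infinite residue field and let $J$ be an ideal of $R$. - $J$ is $\mathfrak{m}$-full if $J\mathfrak{m}:x=J$ for some element $x\in\mathfrak{m}\setminus\mathfrak{m}^2$. - $J$ is full if $J:x=J:\mathfrak{m}$ for some element $x\in\mathfrak{m}\setminus\mathfrak{m}^2$. - $J$ is weakly $\mathfrak{m}$-full if $J\mathfrak{m}:\mathfrak{m}=J$. If moreover $\operatorname{depth} R>0$ (i.e. $\mathfrak{m}$ contains a non-zero-divisor of $R$), then for an ideal $I$ of $R$ set - $n_1(I)=\min\{t\geq 0\mid I\mathfrak{m}^n \text{ is } \mathfrak{m}\text{-full for all } n\geq t\}$; - $n_2(I)=\min\{t\geq 0\mid I\mathfrak{m}^n \text{ is full for all } n\geq t\}$; - $n_3(I)=\min\{t\geq 0\mid I\mathfrak{m}^n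 \text{ is weakly } \mathfrak{m}\text{-full for all } n\geq t\}$. It is known (H. Dao) that these minima exist. An ideal $I\subseteq\mathfrak{m}$ is a reduction of $\mathfrak{m}$ if $I\mathfrak{m}^r=\mathfrak{m}^{r+1}$ for some integer $r\geq 0$. Castelnuovo-Mumford regularity: let $S=\bigoplus_{n\geq 0}S_n$ be a finitely generated standard graded algebra over a ring $S_0$ (standard: generated by $S_1$ as an $S_0$-algebra), and let $S_+=\bigoplus_{n\geq 1}S_n$. For a graded $S$-module $A=\bigoplus_{n\in\mathbb{Z}}A_n$ with $A_n=0$ for all $n\gg 0$, put $a(A)=\max\{n\in\mathbb{Z}\mid A_n\neq 0\}$ if $A\neq 0$, and $a(A)=-\infty$ if $A=0$. Let $H^j_{S_+}(S)$ be the $j$-th local cohomology module of $S$ with respect to $S_+$, which is graded and vanishes in all large degrees. Then $\operatorname{reg} S=\max\{a(H^j_{S_+}(S))+j\mid j\geq 0\}$. The Rees algebra $\mathcal{R}(\mathfrak{m})$ is a finitely generated standard graded $R$-algebra, with degree-$i$ component $\mathfrak{m}^i$. *)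

theory Defs
  imports "HOL-Algebra.Ideal_Product" "HOL-Algebra.Ring_Divisibility" "HOL-Algebra.UnivPoly"
    "HOL-Library.Extended_Real"
begin

section \<open>Local rings and full ideals\<close>

locale noetherian_local_ring =
  cring R + noetherian_ring R + maximalideal \<mm> R for R (structure) and \<mm> +
  assumes maximal_unique: "maximalideal M R \<Longrightarrow> M = \<mm>"

definition positive_depth :: "('a, 'b) ring_scheme \<Rightarrow> 'a set \<Rightarrow> bool" where
  "positive_depth R \<mm> \<longleftrightarrow>
     (\<exists>x\<in>\<mm>. \<forall>y\<in>carrier R. x \<otimes>\<^bsub>R\<^esub> y = \<zero>\<^bsub>R\<^esub> \<longrightarrow> y = \<zero>\<^bsub>R\<^esub>)"

text \<open>
  In \<^const>\<open>ideals_set\<close> the unit is the whole ring, so the zeroth power of an ideal is the ring.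
\<close>

abbreviation ideal_pow :: "('a, 'b) ring_scheme \<Rightarrow> 'a set \<Rightarrow> nat \<Rightarrow> 'a set" where
  "ideal_pow R I n \<equiv> I [^]\<^bsub>ideals_set R\<^esub> n"

definition ideal_colon :: "('a, 'b) ring_scheme \<Rightarrow> 'a set \<Rightarrow> 'a set \<Rightarrow> 'a set" where
  "ideal_colon R A B = {r \<in> carrier R. \<forall>b\<in>B. r \<otimes>\<^bsub>R\<^esub> b \<in> A}"

definition m_full :: "('a, 'b) ring_scheme \<Rightarrow> 'a set \<Rightarrow> 'a set \<Rightarrow> bool" where
  "m_full R \<mm> J \<longleftrightarrow>
     (\<exists>x\<in>\<mm> - ideal_pow R \<mm> 2. ideal_colon R (J \<cdot>\<^bsub>R\<^esub> \<mm>) (PIdl\<^bsub>R\<^esub> x) = J)"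

definition full :: "('a, 'b) ring_scheme \<Rightarrow> 'a set \<Rightarrow> 'a set \<Rightarrow> bool" where
  "full R \<mm> J \<longleftrightarrow>
     (\<exists>x\<in>\<mm> - ideal_pow R \<mm> 2. ideal_colon R J (PIdl\<^bsub>R\<^esub> x) = ideal_colon R J \<mm>)"

definition weakly_m_full :: "('a, 'b) ring_scheme \<Rightarrow> 'a set \<Rightarrow> 'a set \<Rightarrow> bool" where
  "weakly_m_full R \<mm> J \<longleftrightarrow> ideal_colon R (J \<cdot>\<^bsub>R\<^esub> \<mm>) \<mm> = J"

definition n\<^sub>1 :: "('a, 'b) ring_scheme \<Rightarrow> 'a set \<Rightarrow> 'a set \<Rightarrow> nat" where
  "n\<^sub>1 R \<mm> I = (LEAST t. \<forall>n\<ge>t. m_full R \<mm> (I \<cdot>\<^bsub>R\<^esub> ideal_pow R \<mm> n))"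

definition n\<^sub>2 :: "('a, 'b) ring_scheme \<Rightarrow> 'a set \<Rightarrow> 'a set \<Rightarrow> nat" where
  "n\<^sub>2 R \<mm> I = (LEAST t. \<forall>n\<ge>t. full R \<mm> (I \<cdot>\<^bsub>R\<^esub> ideal_pow R \<mm> n))"

definition n\<^sub>3 :: "('a, 'b) ring_scheme \<Rightarrow> 'a set \<Rightarrow> 'a set \<Rightarrow> nat" where
  "n\<^sub>3 R \<mm> I = (LEAST t. \<forall>n\<ge>t. weakly_m_full R \<mm> (I \<cdot>\<^bsub>R\<^esub> ideal_pow R \<mm> n))"

definition reduction_of :: "('a, 'b) ring_scheme \<Rightarrow> 'a set \<Rightarrow> 'a set \<Rightarrow> bool" where
  "reduction_of R \<mm> I \<longleftrightarrow>
     ideal I R \<and> I \<subseteq> \<mm> \<and> (\<exists>r. I \<cdot>\<^bsub>R\<^esub> ideal_pow R \<mm> r = ideal_pow R \<mm> (r + 1))"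


section \<open>Localization at a single element\<close>

text \<open>
  A fraction \<open>s / f ^ k\<close> is the set of all pairs equivalent to \<open>(s, k)\<close>.  The exponent is kept
  instead of the power itself so that the degree of a homogeneous fraction can be read off.
\<close>

definition loc_frac :: "('s, 'x) ring_scheme \<Rightarrow> 's \<Rightarrow> 's \<Rightarrow> nat \<Rightarrow> ('s \<times> nat) set" where
  "loc_frac S f s k =
     {(s', k'). s' \<in> carrier S \<and>
        (\<exists>l::nat. f [^]\<^bsub>S\<^esub> l \<otimes>\<^bsub>S\<^esub> (f [^]\<^bsub>S\<^esub> k' \<otimes>\<^bsub>S\<^esub> s) = f [^]\<^bsub>S\<^esub> l \<otimes>\<^bsub>S\<^esub> (f [^]\<^bsub>S\<^esub> k \<otimes>\<^bsub>S\<^esub> s'))}"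

definition loc_carrier :: "('s, 'x) ring_scheme \<Rightarrow> 's \<Rightarrow> ('s \<times> nat) set set" where
  "loc_carrier S f = {loc_frac S f s k | s k. s \<in> carrier S}"

definition loc_mult ::
    "('s, 'x) ring_scheme \<Rightarrow> 's \<Rightarrow> ('s \<times> nat) set \<Rightarrow> ('s \<times> nat) set \<Rightarrow> ('s \<times> nat) set" where
  "loc_mult S f U V = (\<Union>(s, k)\<in>U. \<Union>(t, l)\<in>V. loc_frac S f (s \<otimes>\<^bsub>S\<^esub> t) (k + l))"

definition loc_add ::
    "('s, 'x) ring_scheme \<Rightarrow> 's \<Rightarrow> ('s \<times> nat) set \<Rightarrow> ('s \<times> nat) set \<Rightarrow> ('s \<times> nat) set" where
  "loc_add S f U V =
     (\<Union>(s, k)\<in>U. \<Union>(t, l)\<in>V.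
        loc_frac S f ((f [^]\<^bsub>S\<^esub> l \<otimes>\<^bsub>S\<^esub> s) \<oplus>\<^bsub>S\<^esub> (f [^]\<^bsub>S\<^esub> k \<otimes>\<^bsub>S\<^esub> t)) (k + l))"

definition loc_ring :: "('s, 'x) ring_scheme \<Rightarrow> 's \<Rightarrow> (('s \<times> nat) set) ring" where
  "loc_ring S f =
     \<lparr> carrier = loc_carrier S f,
       monoid.mult = loc_mult S f,
       one = loc_frac S f \<one>\<^bsub>S\<^esub> 0,
       zero = loc_frac S f \<zero>\<^bsub>S\<^esub> 0,
       add = loc_add S f \<rparr>"

text \<open>
  The degree \<open>n\<close> part of the localization when \<open>f\<close> is homogeneous of degree \<open>d\<close>.  Gradings are
  indexed by the integers, so that \<open>n\<close> may be negative.
\<close>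

definition loc_component ::
    "('s, 'x) ring_scheme \<Rightarrow> (int \<Rightarrow> 's set) \<Rightarrow> 's \<Rightarrow> nat \<Rightarrow> int \<Rightarrow> ('s \<times> nat) set set" where
  "loc_component S gr f d n = {loc_frac S f s k | s k. s \<in> gr (n + int (d * k))}"

text \<open>The canonical map from the localization at \<open>f\<close> to the localization at \<open>h = f g\<close>.\<close>

definition loc_map ::
    "('s, 'x) ring_scheme \<Rightarrow> 's \<Rightarrow> 's \<Rightarrow> ('s \<times> nat) set \<Rightarrow> ('s \<times> nat) set" where
  "loc_map S g h U = (\<Union>(s, k)\<in>U. loc_frac S h (g [^]\<^bsub>S\<^esub> k \<otimes>\<^bsub>S\<^esub> s) k)"


section \<open>Graded local cohomology and regularity\<close>

text \<open>
  Here \<open>S\<close> is a commutative ring with homogeneous components \<open>gr n\<close> (zero for negative \<open>n\<close>).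
  The local cohomology of \<open>S\<close> with support in \<open>S\<^sub>+\<close> is the cohomology of the extended Cech complex
  \<open>0 \<rightarrow> S \<rightarrow> \<Oplus>\<^sub>i S\<^bsub>f_i\<^esub> \<rightarrow> \<Oplus>\<^bsub>i<j\<^esub> S\<^bsub>f_i f_j\<^esub> \<rightarrow> \<dots>\<close> on degree one generators \<open>fs\<close> of the ideal \<open>S\<^sub>+\<close>;
  up to graded isomorphism it does not depend on their choice.  The complex is given degree by
  degree, its differential being homogeneous of degree zero.
\<close>

definition irrelevant_ideal :: "('s, 'x) ring_scheme \<Rightarrow> (int \<Rightarrow> 's set) \<Rightarrow> 's set" where
  "irrelevant_ideal S gr =
     {\<Oplus>\<^bsub>S\<^esub>i\<in>{1..N}. s i | s N. \<forall>i\<in>{1..N}. s i \<in> gr i}"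

definition degree_one_generators ::
    "('s, 'x) ring_scheme \<Rightarrow> (int \<Rightarrow> 's set) \<Rightarrow> 's list \<Rightarrow> bool" where
  "degree_one_generators S gr fs \<longleftrightarrow>
     set fs \<subseteq> gr 1 \<and> Idl\<^bsub>S\<^esub> (set fs) = irrelevant_ideal S gr"

definition cech_index :: "'s list \<Rightarrow> nat \<Rightarrow> nat set set" where
  "cech_index fs j = {A. A \<subseteq> {..<length fs} \<and> card A = j}"

definition cech_elem :: "('s, 'x) ring_scheme \<Rightarrow> 's list \<Rightarrow> nat set \<Rightarrow> 's" where
  "cech_elem S fs A = (\<Otimes>\<^bsub>S\<^esub>i\<in>A. fs ! i)"

text \<open>Degree \<open>n\<close> part of the \<open>j\<close>-th cochain module, as an additive group.\<close>

definition cech_group ::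
    "('s, 'x) ring_scheme \<Rightarrow> (int \<Rightarrow> 's set) \<Rightarrow> 's list \<Rightarrow> nat \<Rightarrow> int
       \<Rightarrow> (nat set \<Rightarrow> ('s \<times> nat) set) monoid" where
  "cech_group S gr fs j n =
     \<lparr> carrier = (\<Pi>\<^sub>E A\<in>cech_index fs j. loc_component S gr (cech_elem S fs A) j n),
       monoid.mult = (\<lambda>c c'. \<lambda>A\<in>cech_index fs j. c A \<oplus>\<^bsub>loc_ring S (cech_elem S fs A)\<^esub> c' A),
       one = (\<lambda>A\<in>cech_index fs j. \<zero>\<^bsub>loc_ring S (cech_elem S fs A)\<^esub>) \<rparr>"

definition cech_diff ::
    "('s, 'x) ring_scheme \<Rightarrow> 's list \<Rightarrow> nat
       \<Rightarrow> (nat set \<Rightarrow> ('s \<times> nat) set) \<Rightarrow> nat set \<Rightarrow> ('s \<times> nat) set" where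
  "cech_diff S fs j c =
     (\<lambda>B\<in>cech_index fs (Suc j).
        \<Oplus>\<^bsub>loc_ring S (cech_elem S fs B)\<^esub>i\<in>B.
          (let y = loc_map S (fs ! i) (cech_elem S fs B) (c (B - {i}))
           in if even (card {l\<in>B. l < i}) then y else \<ominus>\<^bsub>loc_ring S (cech_elem S fs B)\<^esub> y))"

definition cech_cocycles ::
    "('s, 'x) ring_scheme \<Rightarrow> (int \<Rightarrow> 's set) \<Rightarrow> 's list \<Rightarrow> nat \<Rightarrow> int
       \<Rightarrow> (nat set \<Rightarrow> ('s \<times> nat) set) set" where
  "cech_cocycles S gr fs j n =
     kernel (cech_group S gr fs j n) (cech_group S gr fs (Suc j) n) (cech_diff S fs j)"

definition cech_coboundaries ::
    "('s, 'x) ring_scheme \<Rightarrow> (int \<Rightarrow> 's set) \<Rightarrow> 's list \<Rightarrow> nat \<Rightarrow> int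
       \<Rightarrow> (nat set \<Rightarrow> ('s \<times> nat) set) set" where
  "cech_coboundaries S gr fs j n =
     (case j of
        0 \<Rightarrow> {\<one>\<^bsub>cech_group S gr fs 0 n\<^esub>}
      | Suc i \<Rightarrow> cech_diff S fs i ` carrier (cech_group S gr fs i n))"

text \<open>Degree \<open>n\<close> part of the \<open>j\<close>-th local cohomology module, as an additive group.\<close>

definition local_cohomology ::
    "('s, 'x) ring_scheme \<Rightarrow> (int \<Rightarrow> 's set) \<Rightarrow> 's list \<Rightarrow> nat \<Rightarrow> int
       \<Rightarrow> (nat set \<Rightarrow> ('s \<times> nat) set) set monoid" where
  "local_cohomology S gr fs j n =
     (cech_group S gr fs j n)\<lparr>carrier := cech_cocycles S gr fs j n\<rparr>
       Mod cech_coboundaries S gr fs j n"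

text \<open>
  The supremum of the empty set is \<open>-\<infinity>\<close>, which is the value required for the zero module.  For
  standard graded Noetherian \<open>S\<close> the local cohomology vanishes in large degrees and for large \<open>j\<close>,
  so that both suprema are maxima.
\<close>

definition top_degree :: "(int \<Rightarrow> ('c, 'z) monoid_scheme) \<Rightarrow> ereal" where
  "top_degree H =
     (SUP n\<in>{n. carrier (H n) \<noteq> {\<one>\<^bsub>H n\<^esub>}}. ereal (real_of_int n))"

definition regularity ::
    "('s, 'x) ring_scheme \<Rightarrow> (int \<Rightarrow> 's set) \<Rightarrow> 's list \<Rightarrow> ereal" where
  "regularity S gr fs = (SUP j. top_degree (local_cohomology S gr fs j) + ereal (real j))"


section \<open>The Rees algebra\<close>

text \<open>The Rees algebra of \<open>I\<close>, realized as the subring \<open>\<Oplus>\<^sub>i I\<^sup>i t\<^sup>i\<close> of the polynomial ring.\<close>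

definition rees :: "('a, 'b) ring_scheme \<Rightarrow> 'a set \<Rightarrow> ('a, nat \<Rightarrow> 'a) up_ring" where
  "rees R I = (UP R)\<lparr>carrier := {p \<in> carrier (UP R). \<forall>i. coeff (UP R) p i \<in> ideal_pow R I i}\<rparr>"

definition rees_component :: "('a, 'b) ring_scheme \<Rightarrow> 'a set \<Rightarrow> int \<Rightarrow> (nat \<Rightarrow> 'a) set" where
  "rees_component R I n =
     (if n < 0 then {\<zero>\<^bsub>UP R\<^esub>} else {monom (UP R) a (nat n) | a. a \<in> ideal_pow R I (nat n)})"

end

theory Submission
  imports Defs "HOL-Algebra.Subrings"
begin

text \<open>
  Write \<open>J n\<close> for \<open>I \<mm>\<^sup>n\<close>.  If \<open>J n\<close> is weakly \<open>\<mm>\<close>-full for all \<open>n \<ge> t\<close>, descending induction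
  from \<open>J r = \<mm>\<^bsup>r+1\<^esup>\<close> yields \<open>J n = \<mm>\<^bsup>n+1\<^esup>\<close> for all \<open>n \<ge> t\<close>.  A superficial element
  \<open>x \<in> \<mm> \<setminus> \<mm>\<^sup>2\<close>, which is a non-zero-divisor and satisfies \<open>\<mm>\<^bsup>n+1\<^esup> : x = \<mm>\<^sup>n\<close> for large \<open>n\<close>, then
  satisfies this equality for all \<open>n > t\<close>, again by descending induction, so that the \<open>J n\<close>
  are \<open>\<mm>\<close>-full.  The existence of \<open>x\<close> rests on the Noetherian property of the Rees algebra and on prime
  avoidance over the infinite residue field.

  For the bound by the regularity, suppose it is less than \<open>n = n\<^sub>1(I)\<close>.  Then \<open>H\<^sup>1\<close> of the Rees
  algebra vanishes in degree \<open>n\<close>, hence \<open>\<mm>\<^bsup>n+1\<^esup> : \<mm> = \<mm>\<^sup>n\<close>, and \<open>H\<^sup>j\<close> vanishes in degree \<open>n - j\<close> for all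
  \<open>j\<close>.  Comparing the Cech complex on generators of the irrelevant ideal with a Koszul complex on
  generators of \<open>I t\<close>, which is exact on all localizations because \<open>I\<close> is a reduction, shows that the
  degree \<open>n\<close> part of the Rees algebra is generated by \<open>I t\<close>: this is impossible for \<open>n = 0\<close>, and
  otherwise \<open>\<mm>\<^sup>n = I \<mm>\<^bsup>n-1\<^esup>\<close>.  So \<open>J (n - 1)\<close> is weakly \<open>\<mm>\<close>-full, which contradicts the minimality of \<open>n\<close>.
\<close>

section \<open>Graded families of ideals\<close>

text \<open>Of the Rees algebra, only homogeneous ideals need a chain condition. They are encoded by
  their components, ideals \<open>N n\<close> of \<open>R\<close> inside the powers, and the basis
  theorem is proved for such families. This one chain condition yields Artin-Rees as well as the
  finite list of proper subideals of \<open>\<mm>\<close> that a superficial element has to avoid.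
  The numbers in the bound have a simple source. Regularity below \<open>n\<close> means that the
  top degree of the \<open>j\<close>-th cohomology is below \<open>n - j\<close>, so bidegree
  \<open>(j, n - j)\<close> vanishes for every \<open>j\<close>; these are exactly the places where
  the double complex chase has to lift a cocycle. The reduction enters through the equation
  \<open>I \<mm>^r = \<mm>^(r+1)\<close>: for a degree one generator \<open>f\<close>, the power
  \<open>f^(r+1)\<close> is a combination of generators of \<open>I t\<close> with coefficients of
  degree \<open>r\<close>. After inverting \<open>f\<close> this writes 1 as a combination with
  coefficients of degree -1. Products of such local expressions with the given element of degree
  \<open>n\<close> are the explicit cochains from which the chase starts, and each factor lowers the
  degree by one.\<close>

lemma (in cring) ideal_of_closed:
  assumes "I \<subseteq> carrier R" "\<zero> \<in> I"
    and add: "\<And>x y. x \<in> I \<Longrightarrow> y \<in> I \<Longrightarrow> x \<oplus> y \<in> I"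
    and mul: "\<And>r x. r \<in> carrier R \<Longrightarrow> x \<in> I \<Longrightarrow> r \<otimes> x \<in> I"
  shows "ideal I R"
proof (rule idealI[OF ring_axioms])
  show "subgroup I (add_monoid R)"
  proof (rule add.subgroupI)
    fix x assume x: "x \<in> I"
    then have "(\<ominus> \<one>) \<otimes> x \<in> I"
      by (intro mul) auto
    moreover have "(\<ominus> \<one>) \<otimes> x = \<ominus> x"
      using x assms(1) by (auto simp: l_minus)
    ultimately show "\<ominus> x \<in> I" by simp
  qed (use assms in auto)
  show "x \<otimes> a \<in> I" if "a \<in> I" "x \<in> carrier R" for a x
    using mul that by blast
  show "a \<otimes> x \<in> I" if "a \<in> I" "x \<in> carrier R" for a x
    using mul[OF that(2,1)] that assms(1) by (metis m_comm subsetD)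
qed

lemma (in ring) ideal_closed:
  assumes "ideal I R"
  shows "\<zero> \<in> I" "\<And>x y. x \<in> I \<Longrightarrow> y \<in> I \<Longrightarrow> x \<oplus> y \<in> I"
    "\<And>r x. r \<in> carrier R \<Longrightarrow> x \<in> I \<Longrightarrow> r \<otimes> x \<in> I"
    "\<And>r x. r \<in> carrier R \<Longrightarrow> x \<in> I \<Longrightarrow> x \<otimes> r \<in> I"
    "\<And>x. x \<in> I \<Longrightarrow> \<ominus> x \<in> I"
    "\<And>x y. x \<in> I \<Longrightarrow> y \<in> I \<Longrightarrow> x \<ominus> y \<in> I"
    "\<And>x. x \<in> I \<Longrightarrow> x \<in> carrier R"
proof -
  interpret ideal I R by fact
  show "\<zero> \<in> I" "\<And>x y. x \<in> I \<Longrightarrow> y \<in> I \<Longrightarrow> x \<oplus> y \<in> I"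
    "\<And>r x. r \<in> carrier R \<Longrightarrow> x \<in> I \<Longrightarrow> r \<otimes> x \<in> I"
    "\<And>r x. r \<in> carrier R \<Longrightarrow> x \<in> I \<Longrightarrow> x \<otimes> r \<in> I"
    "\<And>x. x \<in> I \<Longrightarrow> \<ominus> x \<in> I"
    "\<And>x y. x \<in> I \<Longrightarrow> y \<in> I \<Longrightarrow> x \<ominus> y \<in> I"
    "\<And>x. x \<in> I \<Longrightarrow> x \<in> carrier R"
    by (auto simp: I_l_closed I_r_closed a_minus_def)
qed

lemma (in cring) ideal_scale:
  assumes "ideal J R" "x \<in> carrier R"
  shows "ideal ((\<lambda>c. c \<otimes> x) ` J) R"
proof (rule ideal_of_closed)
  note J = ideal_closed[OF assms(1)]
  show "(\<lambda>c. c \<otimes> x) ` J \<subseteq> carrier R" using J assms by auto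
  show "\<zero> \<in> (\<lambda>c. c \<otimes> x) ` J"
    using J(1) assms(2) by (auto simp: image_iff intro!: bexI[of _ \<zero>])
  show "u \<oplus> v \<in> (\<lambda>c. c \<otimes> x) ` J"
    if uv: "u \<in> (\<lambda>c. c \<otimes> x) ` J" "v \<in> (\<lambda>c. c \<otimes> x) ` J" for u v
  proof -
    from uv obtain c d where "c \<in> J" "d \<in> J" "u = c \<otimes> x" "v = d \<otimes> x" by auto
    then have "u \<oplus> v = (c \<oplus> d) \<otimes> x" "c \<oplus> d \<in> J" using J assms by (auto simp: l_distr)
    then show ?thesis by blast
  qed
  show "r \<otimes> u \<in> (\<lambda>c. c \<otimes> x) ` J"
    if ru: "r \<in> carrier R" "u \<in> (\<lambda>c. c \<otimes> x) ` J" for r u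
  proof -
    from ru obtain c where "c \<in> J" "u = c \<otimes> x" by auto
    then have "r \<otimes> u = (r \<otimes> c) \<otimes> x" "r \<otimes> c \<in> J" using J assms ru by (auto simp: m_assoc)
    then show ?thesis by blast
  qed
qed

lemma (in ring) mem_set_add: "x \<in> A <+> B \<longleftrightarrow> (\<exists>a\<in>A. \<exists>b\<in>B. x = a \<oplus> b)"
  by (auto simp: set_add_def' )

lemma (in ring) ideal_prod_le:
  assumes "ideal K R" "\<And>i j. i \<in> I \<Longrightarrow> j \<in> J \<Longrightarrow> i \<otimes> j \<in> K"
  shows "I \<cdot> J \<subseteq> K"
proof
  fix s assume "s \<in> I \<cdot> J" then show "s \<in> K"
    by (induct s rule: ideal_prod.induct) (auto simp: assms ideal_closed[OF assms(1)])
qed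

lemma ideal_prod_mono:
  assumes "I \<subseteq> I'" "J \<subseteq> J'" shows "ideal_prod R I J \<subseteq> ideal_prod R I' J'"
proof
  fix s assume "s \<in> ideal_prod R I J" then show "s \<in> ideal_prod R I' J'"
    by (induct s rule: ideal_prod.induct) (use assms in \<open>auto intro: ideal_prod.intros\<close>)
qed

section \<open>Powers of an ideal\<close>

context cring
begin

lemma ideal_pow_0: "ideal_pow R I 0 = carrier R"
  by (simp add: ideals_set_def)

lemma ideal_pow_Suc: "ideal_pow R I (Suc n) = ideal_pow R I n \<cdot> I"
  by (simp add: ideals_set_def)

lemma ideal_pow_ideal:
  assumes "ideal I R" shows "ideal (ideal_pow R I n) R"
proof (induction n)
  case 0
  show ?case unfolding ideal_pow_0 by (rule oneideal)
next
  case (Suc n)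
  then show ?case unfolding ideal_pow_Suc by (rule ideal_prod_is_ideal[OF _ assms])
qed

lemma ideal_pow_add:
  assumes "ideal I R" shows "ideal_pow R I m \<cdot> ideal_pow R I n = ideal_pow R I (m + n)"
proof -
  interpret M: comm_monoid "ideals_set R" by (rule ideals_set_is_comm_monoid)
  have "ideal_pow R I m \<otimes>\<^bsub>ideals_set R\<^esub> ideal_pow R I n = ideal_pow R I (m + n)"
    by (rule M.nat_pow_mult) (simp add: ideals_set_def assms)
  then show ?thesis by (simp add: ideals_set_def)
qed

lemma ideal_pow_1:
  assumes "ideal I R" shows "ideal_pow R I (Suc 0) = I"
  using assms by (simp only: ideal_pow_Suc ideal_pow_0)
    (metis ideal_prod_commute ideal_prod_one oneideal)

lemma ideal_pow_mult:
  assumes "ideal I R" "x \<in> ideal_pow R I m" "y \<in> ideal_pow R I n"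
  shows "x \<otimes> y \<in> ideal_pow R I (m + n)"
  using ideal_prod.prod[OF assms(2,3), of R] ideal_pow_add[OF assms(1)] by auto

lemma ideal_pow_Suc_le:
  assumes "ideal I R" shows "ideal_pow R I (Suc n) \<subseteq> ideal_pow R I n"
  using ideal_prod_inter[OF ideal_pow_ideal[OF assms] assms] by (auto simp only: ideal_pow_Suc)

lemma ideal_pow_antimono:
  assumes "ideal I R" "m \<le> n" shows "ideal_pow R I n \<subseteq> ideal_pow R I m"
  using lift_Suc_antimono_le[of "ideal_pow R I", OF ideal_pow_Suc_le[OF assms(1)] assms(2)] .

end

text \<open>
  For an element \<open>a\<close> and a family \<open>P\<close>, \<open>low_sums R a P p n\<close> consists of the sums of \<open>c\<^sub>i a\<^sup>i\<close>
  over \<open>i < p\<close> with \<open>c\<^sub>i \<in> P (n - i)\<close>; it is only used for \<open>p \<le> n + 1\<close>, where the subtraction is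
  not truncated.  Consequently \<open>hom_part R as n\<close> is the \<open>n\<close>-th power of the ideal generated by \<open>as\<close>.
\<close>

primrec low_sums ::
    "('a, 'b) ring_scheme \<Rightarrow> 'a \<Rightarrow> (nat \<Rightarrow> 'a set) \<Rightarrow> nat \<Rightarrow> nat \<Rightarrow> 'a set" where
  "low_sums R a P 0 n = {\<zero>\<^bsub>R\<^esub>}"
| "low_sums R a P (Suc p) n =
     low_sums R a P p n <+>\<^bsub>R\<^esub> (\<lambda>c. c \<otimes>\<^bsub>R\<^esub> a [^]\<^bsub>R\<^esub> p) ` P (n - p)"

primrec hom_part :: "('a, 'b) ring_scheme \<Rightarrow> 'a list \<Rightarrow> nat \<Rightarrow> 'a set" where
  "hom_part R [] n = (if n = 0 then carrier R else {\<zero>\<^bsub>R\<^esub>})"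
| "hom_part R (a # as) n = low_sums R a (hom_part R as) (Suc n) n"

text \<open>These are the components of a homogeneous ideal of the Rees algebra of the ideal
  generated by \<open>as\<close>. Since every \<open>N n\<close> is an ideal of \<open>R\<close>,
  closure under the degree one generators amounts to closure under the whole algebra.\<close>

definition graded_by :: "('a, 'b) ring_scheme \<Rightarrow> 'a list \<Rightarrow> (nat \<Rightarrow> 'a set) \<Rightarrow> bool" where
  "graded_by R as N \<longleftrightarrow>
     (\<forall>n. ideal (N n) R \<and> N n \<subseteq> hom_part R as n \<and> (\<forall>b\<in>set as. \<forall>y\<in>N n. b \<otimes>\<^bsub>R\<^esub> y \<in> N (Suc n)))"

context cring
begin

lemma low_sums_ideal:
  assumes "a \<in> carrier R" "\<And>n. ideal (P n) R" shows "ideal (low_sums R a P p n) R"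
  by (induction p) (auto simp: zeroideal intro!: add_ideals ideal_scale assms)

lemma hom_part_ideal:
  assumes "set as \<subseteq> carrier R" shows "ideal (hom_part R as n) R"
  using assms
proof (induction as arbitrary: n)
  case (Cons a as)
  then show ?case
    using low_sums_ideal[of a "hom_part R as" "Suc n" n]
    by (simp del: low_sums.simps)
qed (auto simp: oneideal zeroideal)

lemma low_sums_shift:
  assumes a: "a \<in> carrier R" and P: "\<And>n. ideal (P n) R"
    and "y \<in> low_sums R a P p n"
  shows "a \<otimes> y \<in> low_sums R a P (Suc p) (Suc n)"
  using assms(3)
proof (induction p arbitrary: y)
  case 0
  then have "a \<otimes> y = \<zero>" using a by simp
  moreover have "ideal (low_sums R a P (Suc 0) (Suc n)) R" by (rule low_sums_ideal) (use a P in auto)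
  ultimately show ?case by (metis ideal_closed(1))
next
  case (Suc p)
  then obtain e c where e: "e \<in> low_sums R a P p n" "c \<in> P (n - p)" "y = e \<oplus> c \<otimes> a [^] p"
    by (auto simp: mem_set_add)
  have ec: "e \<in> carrier R" "c \<in> carrier R"
    using ideal_closed(7)[OF low_sums_ideal[where P = P, OF a P] e(1)] ideal_closed(7)[OF P e(2)] .
  have "a \<otimes> y = a \<otimes> e \<oplus> c \<otimes> a [^] Suc p"
    using ec a by (simp add: e(3) r_distr m_lcomm[of a c] m_comm[of a "a [^] p"])
  moreover have "a \<otimes> e \<in> low_sums R a P (Suc p) (Suc n)" using Suc.IH e(1) .
  moreover have "c \<in> P (Suc n - Suc p)" using e by simp
  ultimately show ?case
    unfolding low_sums.simps(2)[of R a P "Suc p"] mem_set_add by blast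
qed

text \<open>A generator \<open>b\<close> of the remaining list raises the degree of the coefficients
  and leaves the powers of \<open>a\<close> alone. The bound on \<open>p\<close> ensures
  \<open>Suc n - p = Suc (n - p)\<close> for the exponents that occur.\<close>

lemma low_sums_mult:
  assumes a: "a \<in> carrier R" and P: "\<And>n. ideal (P n) R" and b: "b \<in> carrier R"
    and bP: "\<And>n y. y \<in> P n \<Longrightarrow> b \<otimes> y \<in> P (Suc n)"
    and "y \<in> low_sums R a P p n" "p \<le> Suc n"
  shows "b \<otimes> y \<in> low_sums R a P p (Suc n)"
  using assms(5,6)
proof (induction p arbitrary: y)
  case (Suc p)
  then obtain e c where e: "e \<in> low_sums R a P p n" "c \<in> P (n - p)" "y = e \<oplus> c \<otimes> a [^] p"
    by (auto simp: mem_set_add)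
  have ec: "e \<in> carrier R" "c \<in> carrier R"
    using ideal_closed(7)[OF low_sums_ideal[where P = P, OF a P] e(1)] ideal_closed(7)[OF P e(2)] .
  have "b \<otimes> y = b \<otimes> e \<oplus> (b \<otimes> c) \<otimes> a [^] p"
    using ec a b by (simp add: e(3) r_distr m_assoc)
  moreover have "b \<otimes> e \<in> low_sums R a P p (Suc n)" using Suc e(1) by simp
  moreover have "b \<otimes> c \<in> P (Suc n - p)" using bP[OF e(2)] Suc.prems(2) by (simp add: Suc_diff_le)
  ultimately show ?case
    unfolding low_sums.simps(2) mem_set_add by blast
qed (use b in simp)

lemma low_sums_le_Suc:
  assumes a: "a \<in> carrier R" and P: "\<And>n. ideal (P n) R"
  shows "low_sums R a P p n \<subseteq> low_sums R a P (Suc p) n"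
proof
  fix y assume y: "y \<in> low_sums R a P p n"
  then have "y = y \<oplus> \<zero> \<otimes> a [^] p"
    using a ideal_closed(7)[OF low_sums_ideal[where P = P, OF a P] y] by simp
  then show "y \<in> low_sums R a P (Suc p) n"
    using y ideal_closed(1)[OF P] unfolding low_sums.simps(2) mem_set_add by blast
qed

lemma hom_part_mult:
  assumes "set as \<subseteq> carrier R" "b \<in> set as" "y \<in> hom_part R as n"
  shows "b \<otimes> y \<in> hom_part R as (Suc n)"
  using assms
proof (induction as arbitrary: y n)
  case (Cons a as)
  have a: "a \<in> carrier R" and P: "\<And>n. ideal (hom_part R as n) R"
    using Cons.prems hom_part_ideal by auto
  show ?case
  proof (cases "b = a")
    case True
    then show ?thesis using low_sums_shift[where P = "hom_part R as", OF a P] Cons.prems(3) unfolding hom_part.simps by blast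
  next
    case False
    then have b: "b \<in> set as" "b \<in> carrier R" using Cons.prems by auto
    have "b \<otimes> y \<in> low_sums R a (hom_part R as) (Suc n) (Suc n)"
    proof (rule low_sums_mult[where P = "hom_part R as", OF a P b(2)])
      show "b \<otimes> y \<in> hom_part R as (Suc n)" if "y \<in> hom_part R as n" for n y
        using Cons.IH[OF _ b(1) that] Cons.prems(1) by simp
      show "y \<in> low_sums R a (hom_part R as) (Suc n) n"
        using Cons.prems(3) unfolding hom_part.simps .
    qed simp
    then show ?thesis using low_sums_le_Suc[where P = "hom_part R as", OF a P] unfolding hom_part.simps by blast
  qed
qed auto

lemma hom_part_0:
  assumes "set as \<subseteq> carrier R" shows "hom_part R as 0 = carrier R"
  using assms
proof (induction as)
  case (Cons a as)
  then have "x \<in> hom_part R (a # as) 0" if "x \<in> carrier R" for x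
    using that by (force simp: mem_set_add image_iff)
  then show ?case using hom_part_ideal[OF Cons.prems] ideal_closed(7) by blast
qed simp

lemma ideal_pow_le_hom_part:
  assumes as: "set as \<subseteq> carrier R" and Q: "Q = Idl (set as)"
  shows "ideal_pow R Q n \<subseteq> hom_part R as n"
proof (induction n)
  case 0
  show ?case unfolding ideal_pow_0 hom_part_0[OF as] ..
next
  case (Suc n)
  show ?case unfolding ideal_pow_Suc
  proof (rule ideal_prod_le[OF hom_part_ideal[OF as]])
    fix i j assume i: "i \<in> ideal_pow R Q n" and j: "j \<in> Q"
    note H = hom_part_ideal[OF as]
    have ih: "i \<in> hom_part R as n" using i Suc by auto
    have ic: "i \<in> carrier R" using ih ideal_closed(7)[OF H] by blast
    \<comment> \<open>For fixed \<open>i\<close> the admissible second factors form an ideal, so it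
      suffices to test the generators of \<open>Q\<close>.\<close>
    have "ideal {r \<in> carrier R. i \<otimes> r \<in> hom_part R as (Suc n)} R"
      by (rule ideal_of_closed) (auto simp: r_distr m_lcomm ic ideal_closed[OF H])
    moreover have "set as \<subseteq> {r \<in> carrier R. i \<otimes> r \<in> hom_part R as (Suc n)}"
      using as hom_part_mult[OF as _ ih] ic by (auto simp: m_comm)
    ultimately have "Q \<subseteq> {r \<in> carrier R. i \<otimes> r \<in> hom_part R as (Suc n)}"
      unfolding Q by (rule genideal_minimal)
    then show "i \<otimes> j \<in> hom_part R as (Suc n)" using j by auto
  qed
qed

end

section \<open>The basis theorem for homogeneous families\<close>

lemma (in noetherian_ring) ideal_ascending_stable:
  assumes I: "\<And>j::nat. ideal (F j) R" and inc: "\<And>j. F j \<subseteq> F (Suc j)"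
  shows "\<exists>J. \<forall>j\<ge>J. F j = F J"
proof -
  have mono: "i \<le> j \<Longrightarrow> F i \<subseteq> F j" for i j
    using lift_Suc_mono_le[of F] inc by blast
  have "subset.chain {I. ideal I R} (range F)"
    unfolding subset_chain_def
  proof (intro conjI ballI)
    fix x y assume "x \<in> range F" "y \<in> range F"
    then obtain i j where ij: "x = F i" "y = F j" by auto
    then show "x \<subseteq> y \<or> y \<subseteq> x"
      using mono[of i j] mono[of j i] by (cases "i \<le> j") auto
  qed (use I in auto)
  then have "\<Union>(range F) \<in> range F"
    by (intro ideal_chain_is_trivial) auto
  then obtain J where "\<Union>(range F) = F J" by auto
  then have "F j \<subseteq> F J" for j by blast
  then show ?thesis using mono[of J] by blast
qed

locale noetherian_cring = cring R + noetherian_ring R for R (structure)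

text \<open>The powers of \<open>a\<close> may satisfy relations, so an element has no well-defined
  coefficient at \<open>a^p\<close>. All coefficients that occur in some representation are
  collected; lower powers of \<open>a\<close> are ignored.\<close>

definition lead_coeffs ::
    "('a, 'b) ring_scheme \<Rightarrow> 'a \<Rightarrow> 'a list \<Rightarrow> (nat \<Rightarrow> 'a set) \<Rightarrow> nat \<Rightarrow> nat \<Rightarrow> 'a set" where
  "lead_coeffs R a as N p m =
     {c \<in> hom_part R as m. \<exists>y\<in>N (m + p). y \<ominus>\<^bsub>R\<^esub> c \<otimes>\<^bsub>R\<^esub> a [^]\<^bsub>R\<^esub> p \<in> low_sums R a (hom_part R as) p (m + p)}"

lemma lead_coeffsI:
  assumes "c \<in> hom_part R as m" "y \<in> N (m + p)"
    "y \<ominus>\<^bsub>R\<^esub> c \<otimes>\<^bsub>R\<^esub> a [^]\<^bsub>R\<^esub> p \<in> low_sums R a (hom_part R as) p (m + p)"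
  shows "c \<in> lead_coeffs R a as N p m"
  using assms unfolding lead_coeffs_def by blast

lemma lead_coeffs_mono: "(\<And>n. N n \<subseteq> N' n) \<Longrightarrow> lead_coeffs R a as N p m \<subseteq> lead_coeffs R a as N' p m"
  unfolding lead_coeffs_def by blast

context cring
begin

lemma lead_coeffs_Suc:
  assumes as: "set (a # as) \<subseteq> carrier R" and N: "graded_by R (a # as) N"
  shows "lead_coeffs R a as N p m \<subseteq> lead_coeffs R a as N (Suc p) m"
proof
  fix c assume "c \<in> lead_coeffs R a as N p m"
  then obtain y where c: "c \<in> hom_part R as m" and y: "y \<in> N (m + p)"
    and l: "y \<ominus> c \<otimes> a [^] p \<in> low_sums R a (hom_part R as) p (m + p)"
    unfolding lead_coeffs_def by blast
  have a: "a \<in> carrier R" and P: "\<And>n. ideal (hom_part R as n) R" using as hom_part_ideal by auto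
  have cc: "c \<in> carrier R" using ideal_closed(7)[OF P c] .
  have yc: "y \<in> carrier R" using N y ideal_closed(7) unfolding graded_by_def by blast
  have "a \<otimes> y \<in> N (m + Suc p)" using N y unfolding graded_by_def by auto
  moreover have "a \<otimes> y \<ominus> c \<otimes> a [^] Suc p = a \<otimes> (y \<ominus> c \<otimes> a [^] p)"
    using a cc yc by (simp add: minus_eq r_distr r_minus m_ac)
  then have "a \<otimes> y \<ominus> c \<otimes> a [^] Suc p \<in> low_sums R a (hom_part R as) (Suc p) (m + Suc p)"
    using low_sums_shift[where P = "hom_part R as", OF a P l] by simp
  ultimately show "c \<in> lead_coeffs R a as N (Suc p) m"
    using c unfolding lead_coeffs_def by blast
qed

text \<open>This is what makes induction on the list of generators possible: for fixed
  \<open>p\<close> the leading coefficients form a homogeneous family in which \<open>a\<close> no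
  longer occurs.\<close>

lemma lead_coeffs_graded:
  assumes as: "set (a # as) \<subseteq> carrier R" and N: "graded_by R (a # as) N"
  shows "graded_by R as (lead_coeffs R a as N p)"
proof -
  have a: "a \<in> carrier R" and P: "\<And>n. ideal (hom_part R as n) R" and as': "set as \<subseteq> carrier R"
    using as hom_part_ideal by auto
  have NI: "\<And>n. ideal (N n) R" using N unfolding graded_by_def by blast
  let ?low = "low_sums R a (hom_part R as)"
  have L: "ideal (?low p n) R" for p n by (rule low_sums_ideal[OF a P])
  have ap: "a [^] p \<in> carrier R" using a by simp
  show ?thesis
    unfolding graded_by_def
  proof (intro allI conjI ballI)
    fix n
    show "ideal (lead_coeffs R a as N p n) R"
    proof (rule ideal_of_closed)
      show "lead_coeffs R a as N p n \<subseteq> carrier R"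
        unfolding lead_coeffs_def using ideal_closed(7)[OF P] by blast
      show "\<zero> \<in> lead_coeffs R a as N p n"
        unfolding lead_coeffs_def using ideal_closed(1)[OF P] ideal_closed(1)[OF NI]
          ideal_closed(1)[OF L] ap by (force simp: minus_eq)
    next
      fix c d assume "c \<in> lead_coeffs R a as N p n" "d \<in> lead_coeffs R a as N p n"
      then obtain y z where c: "c \<in> hom_part R as n" and y: "y \<in> N (n + p)"
        and ly: "y \<ominus> c \<otimes> a [^] p \<in> ?low p (n + p)"
        and d: "d \<in> hom_part R as n" and z: "z \<in> N (n + p)"
        and lz: "z \<ominus> d \<otimes> a [^] p \<in> ?low p (n + p)"
        unfolding lead_coeffs_def by blast
      have "c \<in> carrier R" "d \<in> carrier R" "y \<in> carrier R" "z \<in> carrier R"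
        using ideal_closed(7)[OF P c] ideal_closed(7)[OF P d] ideal_closed(7)[OF NI y]
          ideal_closed(7)[OF NI z] .
      then have "(y \<oplus> z) \<ominus> (c \<oplus> d) \<otimes> a [^] p = (y \<ominus> c \<otimes> a [^] p) \<oplus> (z \<ominus> d \<otimes> a [^] p)"
        using ap by (simp add: minus_eq l_distr minus_add a_ac)
      with ideal_closed(2)[OF L ly lz]
      show "c \<oplus> d \<in> lead_coeffs R a as N p n"
        by (intro lead_coeffsI[of _ _ _ _ "y \<oplus> z"] ideal_closed(2)[OF P c d]
            ideal_closed(2)[OF NI y z]) simp
    next
      fix r c assume r: "r \<in> carrier R" and "c \<in> lead_coeffs R a as N p n"
      then obtain y where c: "c \<in> hom_part R as n" and y: "y \<in> N (n + p)"
        and ly: "y \<ominus> c \<otimes> a [^] p \<in> ?low p (n + p)"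
        unfolding lead_coeffs_def by blast
      have "c \<in> carrier R" "y \<in> carrier R"
        using ideal_closed(7)[OF P c] ideal_closed(7)[OF NI y] .
      then have "r \<otimes> y \<ominus> (r \<otimes> c) \<otimes> a [^] p = r \<otimes> (y \<ominus> c \<otimes> a [^] p)"
        using ap r by (simp add: minus_eq r_distr r_minus m_assoc)
      with ideal_closed(3)[OF L r ly]
      show "r \<otimes> c \<in> lead_coeffs R a as N p n"
        by (intro lead_coeffsI[of _ _ _ _ "r \<otimes> y"] ideal_closed(3)[OF P r c]
            ideal_closed(3)[OF NI r y]) simp
    qed
    show "lead_coeffs R a as N p n \<subseteq> hom_part R as n"
      unfolding lead_coeffs_def by blast
  next
    fix n b c assume b: "b \<in> set as" and "c \<in> lead_coeffs R a as N p n"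
    then obtain y where c: "c \<in> hom_part R as n" and y: "y \<in> N (n + p)"
      and ly: "y \<ominus> c \<otimes> a [^] p \<in> ?low p (n + p)"
      unfolding lead_coeffs_def by blast
    have bc: "b \<in> carrier R" using b as by auto
    have "c \<in> carrier R" "y \<in> carrier R"
      using ideal_closed(7)[OF P c] ideal_closed(7)[OF NI y] .
    then have "b \<otimes> y \<ominus> (b \<otimes> c) \<otimes> a [^] p = b \<otimes> (y \<ominus> c \<otimes> a [^] p)"
      using ap bc by (simp add: minus_eq r_distr r_minus m_assoc)
    moreover have "b \<otimes> (y \<ominus> c \<otimes> a [^] p) \<in> ?low p (Suc (n + p))"
      by (rule low_sums_mult[where P = "hom_part R as", OF a P bc _ ly])
        (use hom_part_mult[OF as' b] in auto)
    moreover have "b \<otimes> y \<in> N (Suc n + p)" using N y b unfolding graded_by_def by auto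
    ultimately show "b \<otimes> c \<in> lead_coeffs R a as N p (Suc n)"
      by (intro lead_coeffsI[of _ _ _ _ "b \<otimes> y"] hom_part_mult[OF as' b c]) simp_all
  qed
qed

text \<open>Descent on the number of powers of \<open>a\<close>: an element of \<open>N'\<close>
  shares its leading coefficient with some \<open>z\<close> in \<open>N\<close>, and subtracting
  \<open>z\<close> leaves an element of \<open>N'\<close> that involves fewer powers.\<close>

lemma graded_eq_if_lead_coeffs_eq:
  assumes as: "set (a # as) \<subseteq> carrier R"
    and N: "graded_by R (a # as) N" and N': "graded_by R (a # as) N'"
    and le: "\<And>n. N n \<subseteq> N' n"
    and eq: "\<And>p. lead_coeffs R a as N' p = lead_coeffs R a as N p"
  shows "N' n = N n"
proof -
  have a: "a \<in> carrier R" and P: "\<And>n. ideal (hom_part R as n) R" and as': "set as \<subseteq> carrier R"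
    using as hom_part_ideal by auto
  have NI: "\<And>n. ideal (N n) R" and NI': "\<And>n. ideal (N' n) R"
    using N N' unfolding graded_by_def by blast+
  let ?low = "low_sums R a (hom_part R as)"
  have L: "ideal (?low p n) R" for p by (rule low_sums_ideal[OF a P])
  have "y \<in> N n" if "y \<in> N' n" "y \<in> ?low p n" "p \<le> Suc n" for y p
    using that
  proof (induction p arbitrary: y)
    case 0
    then show ?case using ideal_closed(1)[OF NI] by simp
  next
    case (Suc p)
    then obtain e c where e: "e \<in> ?low p n" "c \<in> hom_part R as (n - p)" "y = e \<oplus> c \<otimes> a [^] p"
      by (auto simp: mem_set_add)
    have car: "e \<in> carrier R" "c \<in> carrier R" "a [^] p \<in> carrier R"
      using ideal_closed(7)[OF L e(1)] ideal_closed(7)[OF P e(2)] a by auto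
    have np: "n - p + p = n" using Suc.prems(3) by simp
    have ye: "y \<ominus> c \<otimes> a [^] p = e" using car unfolding e(3) by (simp add: minus_eq a_assoc r_neg)
    then have "c \<in> lead_coeffs R a as N' p (n - p)"
      by (intro lead_coeffsI[of _ _ _ _ y] e(2)) (simp_all add: np Suc.prems(1) e(1))
    then have "c \<in> lead_coeffs R a as N p (n - p)" by (simp add: eq)
    then obtain z where z: "z \<in> N n" "z \<ominus> c \<otimes> a [^] p \<in> ?low p n"
      unfolding lead_coeffs_def np by auto
    have zc: "z \<in> carrier R" using ideal_closed(7)[OF NI z(1)] .
    have yc: "y \<in> carrier R" using ideal_closed(7)[OF NI' Suc.prems(1)] .
    have "y \<ominus> z = e \<ominus> (z \<ominus> c \<otimes> a [^] p)"
      using zc car unfolding e(3) by (simp add: minus_eq minus_add a_ac)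
    then have "y \<ominus> z \<in> ?low p n" using ideal_closed(6)[OF L e(1) z(2)] by simp
    moreover have "y \<ominus> z \<in> N' n" using ideal_closed(6)[OF NI' Suc.prems(1)] z(1) le by blast
    ultimately have "y \<ominus> z \<in> N n" using Suc by simp
    then have "z \<oplus> (y \<ominus> z) \<in> N n" using ideal_closed(2)[OF NI z(1)] by blast
    moreover have "z \<oplus> (y \<ominus> z) = y" using zc yc by (simp add: minus_eq a_lcomm[of z y] r_neg)
    ultimately show ?case by simp
  qed
  moreover have "N' n \<subseteq> ?low (Suc n) n"
    using N' unfolding graded_by_def hom_part.simps by blast
  ultimately show ?thesis using le by blast
qed

end

text \<open>
  Hilbert's basis theorem for homogeneous ideals, by leading coefficients with respect to the
  first generator; the chain is stationary on the diagonal, and below that point on each of the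
  finitely many rows.
\<close>

lemma (in noetherian_cring) graded_chain_stable:
  assumes "set as \<subseteq> carrier R"
    and "\<And>j::nat. graded_by R as (F j)" and "\<And>j n. F j n \<subseteq> F (Suc j) n"
  shows "\<exists>J. \<forall>j\<ge>J. F j = F J"
  using assms
proof (induction as arbitrary: F)
  case Nil
  then have I: "\<And>j n. ideal (F j n) R" and sub: "\<And>j n. F j n \<subseteq> hom_part R [] n"
    unfolding graded_by_def by blast+
  obtain J where J: "\<And>j. j \<ge> J \<Longrightarrow> F j 0 = F J 0"
    using ideal_ascending_stable[of "\<lambda>j. F j 0", OF I] Nil(3) by blast
  have "F j n = F J n" if "j \<ge> J" for j n
  proof (cases n)
    case (Suc n')
    then have "F j n = {\<zero>}" for j using sub[of j n] ideal_closed(1)[OF I, of j n] by auto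
    then show ?thesis by simp
  next
    case 0
    then show ?thesis using J[OF that] by simp
  qed
  then show ?case by blast
next
  case (Cons a as)
  let ?L = "\<lambda>j. lead_coeffs R a as (F j)"
  have as: "set as \<subseteq> carrier R" using Cons.prems by auto
  have gr: "graded_by R as (?L j p)" for j p
    by (rule lead_coeffs_graded[OF Cons.prems(1,2)])
  have j_step: "?L j p m \<subseteq> ?L (Suc j) p m" for j p m
    by (rule lead_coeffs_mono) (rule Cons.prems(3))
  have p_step: "?L j p m \<subseteq> ?L j (Suc p) m" for j p m
    by (rule lead_coeffs_Suc[OF Cons.prems(1,2)])
  have mono: "?L i p m \<subseteq> ?L j q m" if "i \<le> j" "p \<le> q" for i j p q m
    using lift_Suc_mono_le[of "\<lambda>j. ?L j p m", OF j_step that(1)]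
      lift_Suc_mono_le[of "\<lambda>p. ?L j p m", OF p_step that(2)] by blast
  have "\<exists>J. \<forall>j\<ge>J. ?L j j = ?L J J"
    using Cons.IH[where F = "\<lambda>j. ?L j j", OF as gr mono] by simp
  then obtain D where D: "\<And>j. j \<ge> D \<Longrightarrow> ?L j j = ?L D D" by blast
  have "\<forall>p. \<exists>J. \<forall>j\<ge>J. ?L j p = ?L J p"
    using Cons.IH[where F = "\<lambda>j. ?L j _", OF as gr j_step] by blast
  then obtain K where K: "\<And>p j. j \<ge> K p \<Longrightarrow> ?L j p = ?L (K p) p" by metis
  define J where "J = Max (insert D (K ` {..<D}))"
  have JD: "D \<le> J" unfolding J_def by (intro Max_ge) auto
  have JK: "K p \<le> J" if "p < D" for p unfolding J_def using that by (intro Max_ge) auto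
  \<comment> \<open>\<open>?L j p\<close> is squeezed between the diagonal members at
    \<open>D\<close> and at \<open>max j p\<close>, which coincide.\<close>
  have diag: "?L j p = ?L D D" if "j \<ge> D" "p \<ge> D" for j p
  proof
    fix m
    show "?L j p m = ?L D D m"
      using mono[of D j D p m] mono[of j "max j p" p "max j p" m] D[of "max j p"] that by auto
  qed
  have eq: "?L j p = ?L J p" if "j \<ge> J" for j p
  proof (cases "p < D")
    case True
    then show ?thesis using K[of p j] K[of p J] JK[of p] that by simp
  next
    case False
    then show ?thesis using diag[of j p] diag[of J p] JD that by simp
  qed
  have "F j = F J" if "j \<ge> J" for j
  proof
    fix n
    show "F j n = F J n"
      by (rule graded_eq_if_lead_coeffs_eq[OF Cons.prems(1,2,2)])
        (rule lift_Suc_mono_le[of "\<lambda>j. F j _", OF Cons.prems(3) that], rule eq[OF that])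
  qed
  then show ?case by blast
qed

section \<open>Superficial elements\<close>

text \<open>The homogeneous ideals of the Rees algebra of \<open>Q\<close>, as in
  \<open>graded_by\<close> but without a choice of generators.\<close>

definition rees_ideal :: "('a, 'b) ring_scheme \<Rightarrow> 'a set \<Rightarrow> (nat \<Rightarrow> 'a set) \<Rightarrow> bool" where
  "rees_ideal R Q N \<longleftrightarrow>
     (\<forall>n. ideal (N n) R \<and> N n \<subseteq> ideal_pow R Q n \<and> Q \<cdot>\<^bsub>R\<^esub> N n \<subseteq> N (Suc n))"

lemma rees_idealD:
  assumes "rees_ideal R Q N"
  shows "ideal (N n) R" "N n \<subseteq> ideal_pow R Q n" "Q \<cdot>\<^bsub>R\<^esub> N n \<subseteq> N (Suc n)"
    "x \<in> Q \<Longrightarrow> y \<in> N n \<Longrightarrow> x \<otimes>\<^bsub>R\<^esub> y \<in> N (Suc n)"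
proof -
  show "ideal (N n) R" "N n \<subseteq> ideal_pow R Q n" and QN: "Q \<cdot>\<^bsub>R\<^esub> N n \<subseteq> N (Suc n)"
    using assms unfolding rees_ideal_def by auto
  show "x \<in> Q \<Longrightarrow> y \<in> N n \<Longrightarrow> x \<otimes>\<^bsub>R\<^esub> y \<in> N (Suc n)"
    using QN ideal_prod.prod[of x Q y "N n" R] by auto
qed

lemma (in ring) rees_idealI:
  assumes "\<And>n. ideal (N n) R" "\<And>n. N n \<subseteq> ideal_pow R Q n"
    "\<And>n x y. x \<in> Q \<Longrightarrow> y \<in> N n \<Longrightarrow> x \<otimes> y \<in> N (Suc n)"
  shows "rees_ideal R Q N"
  unfolding rees_ideal_def by (intro allI conjI ideal_prod_le assms)

context cring
begin

lemma rees_ideal_mult: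
  assumes Q: "ideal Q R" and N: "rees_ideal R Q N"
    and "x \<in> ideal_pow R Q m" "y \<in> N n"
  shows "x \<otimes> y \<in> N (m + n)"
  using assms(3)
proof (induction m arbitrary: x)
  case 0
  then show ?case using ideal_closed(3)[OF rees_idealD(1)[OF N] _ assms(4)] by (simp add: ideals_set_def)
next
  case (Suc m)
  note y = ideal_closed(7)[OF rees_idealD(1)[OF N] assms(4)]
  note I = ideal_closed[OF rees_idealD(1)[OF N]]
  note Qm = ideal_closed[OF ideal_pow_ideal[OF Q]] and Qc = ideal_closed[OF Q]
  have "ideal {r \<in> carrier R. r \<otimes> y \<in> N (Suc m + n)} R"
    by (rule ideal_of_closed) (use y I in \<open>auto simp: l_distr m_assoc\<close>)
  then have "ideal_pow R Q m \<cdot> Q \<subseteq> {r \<in> carrier R. r \<otimes> y \<in> N (Suc m + n)}"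
  proof (rule ideal_prod_le)
    fix i j assume i: "i \<in> ideal_pow R Q m" and j: "j \<in> Q"
    have c: "i \<in> carrier R" "j \<in> carrier R" using Qm(7)[OF i] Qc(7)[OF j] .
    have "j \<otimes> (i \<otimes> y) \<in> N (Suc (m + n))" using rees_idealD(4)[OF N j Suc.IH[OF i]] .
    moreover have "j \<otimes> (i \<otimes> y) = i \<otimes> j \<otimes> y" using c y by (simp add: m_ac)
    ultimately show "i \<otimes> j \<in> {r \<in> carrier R. r \<otimes> y \<in> N (Suc m + n)}" using c by simp
  qed
  then show ?case using Suc.prems ideal_pow_Suc by auto
qed

text \<open>The quotient of the Rees algebra by this ideal is the associated graded ring; regularity
  modulo this family is therefore a condition on initial forms.\<close>

lemma rees_ideal_pow_Suc:
  assumes "ideal Q R" shows "rees_ideal R Q (\<lambda>n. ideal_pow R Q (Suc n))"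
proof (rule rees_idealI)
  show "x \<otimes> y \<in> ideal_pow R Q (Suc (Suc n))" if "x \<in> Q" "y \<in> ideal_pow R Q (Suc n)" for n x y
    using ideal_pow_mult[OF assms _ that(2), of x 1] that(1) ideal_pow_1[OF assms] by simp
qed (rule ideal_pow_ideal[OF assms] ideal_pow_Suc_le[OF assms])+

lemma rees_ideal_zero:
  assumes "ideal Q R" shows "rees_ideal R Q (\<lambda>n. {\<zero>})"
  by (rule rees_idealI)
    (use ideal_closed[OF assms] ideal_closed(1)[OF ideal_pow_ideal[OF assms]] in \<open>auto simp: zeroideal\<close>)

text \<open>This is the family of the Artin-Rees lemma; it is used for principal ideals
  \<open>J\<close>.\<close>

lemma rees_ideal_inter:
  assumes Q: "ideal Q R" and J: "ideal J R" shows "rees_ideal R Q (\<lambda>n. ideal_pow R Q n \<inter> J)"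
proof (rule rees_idealI)
  show "x \<otimes> y \<in> ideal_pow R Q (Suc n) \<inter> J" if "x \<in> Q" "y \<in> ideal_pow R Q n \<inter> J" for n x y
    using ideal_pow_mult[OF Q _ , of x 1 y n] ideal_pow_1[OF Q] ideal_closed(3)[OF J]
      ideal_closed(7)[OF Q] that by simp
qed (auto intro: i_intersect ideal_pow_ideal assms)

end

section \<open>Consequences of the chain condition: Artin-Rees and regular elements in large
  degree\<close>

context noetherian_cring
begin

lemma rees_ideal_chain_stable:
  assumes Q: "ideal Q R" and F: "\<And>j::nat. rees_ideal R Q (F j)" and inc: "\<And>j n. F j n \<subseteq> F (Suc j) n"
  shows "\<exists>J. \<forall>j\<ge>J. F j = F J"
proof -
  obtain A where A: "A \<subseteq> carrier R" "finite A" "Q = Idl A"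
    using finetely_gen[OF Q] by blast
  obtain as where as: "set as = A" using finite_list[OF A(2)] by blast
  have as_sub: "set as \<subseteq> carrier R" "Q = Idl (set as)" using A as by auto
  have "set as \<subseteq> Q" using genideal_self[OF A(1)] as A(3) by simp
  then have "\<And>j. graded_by R as (F j)"
    unfolding graded_by_def
    using rees_idealD[OF F] ideal_pow_le_hom_part[OF as_sub] by blast
  then show ?thesis using graded_chain_stable[OF as_sub(1), of F] inc by blast
qed

text \<open>\<open>F j\<close> is the part of \<open>N\<close> generated in degrees up to
  \<open>j\<close>: it agrees with \<open>N\<close> there and is multiplied up by \<open>Q\<close>
  afterwards. The \<open>F j\<close> ascend, and stationarity at \<open>J\<close> says that
  \<open>N\<close> needs no generators beyond degree \<open>J\<close>.\<close>

lemma rees_ideal_eventually_mult: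
  assumes Q: "ideal Q R" and N: "rees_ideal R Q N"
  shows "\<exists>D. \<forall>n\<ge>D. N (Suc n) = Q \<cdot> N n"
proof -
  define up where "up M = Q \<cdot> M" for M
  define F where "F j n = (if n \<le> j then N n else (up ^^ (n - j)) (N j))" for j n
  note NI = rees_idealD(1)[OF N]
  have up_mono: "(up ^^ k) A \<subseteq> (up ^^ k) B" if "A \<subseteq> B" for k A B
    using that by (induction k) (auto simp: up_def ideal_prod_mono[THEN subsetD, OF subset_refl])
  have up_N: "(up ^^ k) (N j) \<subseteq> N (j + k) \<and> ideal ((up ^^ k) (N j)) R" for k j
  proof (induction k)
    case (Suc k)
    then have "up ((up ^^ k) (N j)) \<subseteq> N (Suc (j + k))"
      using ideal_prod_mono[OF subset_refl, of "(up ^^ k) (N j)" "N (j + k)" R Q]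
        rees_idealD(3)[OF N, of "j + k"] unfolding up_def by blast
    then show ?case
      using Suc ideal_prod_is_ideal[OF Q, folded up_def] by simp
  qed (simp add: NI)
  have F_N: "F j n \<subseteq> N n" "ideal (F j n) R" for j n
    using up_N[of "n - j" j] NI by (auto simp: F_def)
  have "\<exists>J. \<forall>j\<ge>J. F j = F J"
  proof (rule rees_ideal_chain_stable[OF Q])
    fix j
    show "rees_ideal R Q (F j)"
    proof (rule rees_idealI)
      fix n x y assume x: "x \<in> Q" and y: "y \<in> F j n"
      show "x \<otimes> y \<in> F j (Suc n)"
      proof (cases "Suc n \<le> j")
        case True
        then show ?thesis using y rees_idealD(4)[OF N x, of y n] by (simp add: F_def)
      next
        case False
        then have "F j (Suc n) = up (F j n)" by (cases "n = j") (auto simp: F_def Suc_diff_le)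
        then show ?thesis using x y by (simp add: up_def ideal_prod.prod)
      qed
    next
      fix n
      show "ideal (F j n) R" by (rule F_N)
      show "F j n \<subseteq> ideal_pow R Q n" using F_N(1) rees_idealD(2)[OF N] by (rule subset_trans)
    qed
    fix n
    show "F j n \<subseteq> F (Suc j) n"
    proof (cases "n \<le> j")
      case True
      then show ?thesis by (simp add: F_def)
    next
      case False
      then have "(up ^^ (n - j)) (N j) = (up ^^ (n - Suc j)) (up (N j))"
        using Suc_diff_Suc[of j n] funpow_Suc_right[of "n - Suc j" up] by (simp add: fun_eq_iff)
      also have "\<dots> \<subseteq> (up ^^ (n - Suc j)) (N (Suc j))"
        by (rule up_mono) (use rees_idealD(3)[OF N] in \<open>simp add: up_def\<close>)
      also have "\<dots> \<subseteq> F (Suc j) n" using False by (cases "n = Suc j") (auto simp: F_def)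
      finally show ?thesis using False by (simp add: F_def)
    qed
  qed
  then obtain J where J: "\<And>j. j \<ge> J \<Longrightarrow> F j = F J" by blast
  have "N (Suc n) = Q \<cdot> N n" if "n \<ge> J" for n
  proof -
    \<comment> \<open>In degree \<open>m\<close> the family \<open>F m\<close> is still
      \<open>N m\<close>, while it already equals \<open>F J\<close>.\<close>
    have eq: "N m = (up ^^ (m - J)) (N J)" if "m \<ge> J" for m
    proof -
      have "F m m = F J m" using J[OF that] by simp
      then show ?thesis using that by (cases "m = J") (simp_all add: F_def)
    qed
    show ?thesis using eq[of n] eq[of "Suc n"] that by (simp add: Suc_diff_le up_def)
  qed
  then show ?thesis by blast
qed

text \<open>The order is reversed: passing to a strictly larger homogeneous ideal is a descent,
  which gives Noetherian induction.\<close>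

lemma wf_rees_ideal:
  assumes Q: "ideal Q R"
  shows "wf {(N', N). rees_ideal R Q N' \<and> rees_ideal R Q N \<and> N < N'}"
  unfolding wf_iff_no_infinite_down_chain
proof (rule notI, elim exE)
  fix F assume F: "\<forall>i. (F (Suc i), F i) \<in> {(N', N). rees_ideal R Q N' \<and> rees_ideal R Q N \<and> N < N'}"
  then have "F i < F (Suc i)" "rees_ideal R Q (F i)" for i by auto
  moreover from this have "F i n \<subseteq> F (Suc i) n" for i n by (simp add: less_fun_def le_fun_def)
  ultimately obtain J where J: "\<And>j. j \<ge> J \<Longrightarrow> F j = F J"
    using rees_ideal_chain_stable[OF Q, of F] by blast
  have "F (Suc J) = F J" by (rule J) simp
  then show False using \<open>F J < F (Suc J)\<close> by simp
qed

text \<open>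
  Noetherian induction on \<open>N\<close>: if \<open>z w\<close> lies in \<open>N\<close> for homogeneous \<open>z, w\<close> outside \<open>N\<close>, the claim
  follows from those for \<open>N + (z)\<close> and \<open>N : z\<close>; otherwise \<open>N\<close> is prime and it suffices to avoid \<open>N 1\<close>.
\<close>

lemma rees_ideal_regular_in_large_degree:
  assumes Q: "ideal Q R" and "rees_ideal R Q N"
  shows "\<exists>H. finite H \<and> (\<forall>h\<in>H. ideal h R \<and> h \<subset> Q) \<and>
    (\<forall>x\<in>Q - \<Union>H. \<exists>D. \<forall>n\<ge>D. \<forall>z\<in>ideal_pow R Q n. x \<otimes> z \<in> N (Suc n) \<longrightarrow> z \<in> N n)"
  using assms(2)
proof (induction N rule: wf_induct_rule[OF wf_rees_ideal[OF Q]])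
  case (1 N)
  note N = 1(2) and NI = ideal_closed[OF rees_idealD(1)[OF 1(2)]]
  note Qn = ideal_closed[OF ideal_pow_ideal[OF Q]] and Qc = ideal_closed[OF Q]
  let ?Q = "ideal_pow R Q"
  show ?case
  proof (cases "\<exists>p q. \<exists>z\<in>?Q p - N p. \<exists>w\<in>?Q q - N q. z \<otimes> w \<in> N (p + q)")
    case True
    then obtain p q z w where z: "z \<in> ?Q p" "z \<notin> N p" and w: "w \<in> ?Q q" "w \<notin> N q"
      and zw: "z \<otimes> w \<in> N (p + q)" by blast
    have zc: "z \<in> carrier R" and wc: "w \<in> carrier R" using Qn(7)[OF z(1)] Qn(7)[OF w(1)] .
    define N1 where "N1 n = (if n < p then N n else N n <+> (\<lambda>v. v \<otimes> z) ` ?Q (n - p))" for n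
    define N2 where "N2 n = {y \<in> ?Q n. y \<otimes> z \<in> N (n + p)}" for n
    have N1: "rees_ideal R Q N1"
    proof (rule rees_idealI)
      fix n
      show "ideal (N1 n) R"
        using rees_idealD(1)[OF N] add_ideals ideal_scale[OF ideal_pow_ideal[OF Q] zc]
        by (auto simp: N1_def)
      show "N1 n \<subseteq> ?Q n"
        using rees_idealD(2)[OF N, of n] ideal_pow_mult[OF Q _ z(1), of _ "n - p"]
        by (auto simp: N1_def mem_set_add intro!: Qn(2))
    next
      fix n x y assume x: "x \<in> Q" and y: "y \<in> N1 n"
      have xc: "x \<in> carrier R" using Qc(7)[OF x] .
      show "x \<otimes> y \<in> N1 (Suc n)"
      proof (cases "n < p")
        case True
        then have m: "x \<otimes> y \<in> N (Suc n)" using rees_idealD(4)[OF N x] y by (simp add: N1_def)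
        then have "x \<otimes> y = x \<otimes> y \<oplus> \<zero> \<otimes> z" using NI(7) zc by simp
        then show ?thesis using m Qn(1) by (auto simp: N1_def mem_set_add)
      next
        case False
        then obtain u v where u: "u \<in> N n" and v: "v \<in> ?Q (n - p)" and yuv: "y = u \<oplus> v \<otimes> z"
          using y by (auto simp: N1_def mem_set_add)
        have "x \<otimes> y = x \<otimes> u \<oplus> (x \<otimes> v) \<otimes> z"
          using NI(7)[OF u] Qn(7)[OF v] xc zc by (simp add: yuv r_distr m_assoc)
        moreover have "x \<otimes> v \<in> ?Q (Suc n - p)"
          using ideal_pow_mult[OF Q _ v, of x 1] x ideal_pow_1[OF Q] False by (simp add: Suc_diff_le)
        ultimately show ?thesis
          using rees_idealD(4)[OF N x u] False by (auto simp: N1_def mem_set_add)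
      qed
    qed
    have N2: "rees_ideal R Q N2"
    proof (rule rees_idealI)
      fix n
      show "ideal (N2 n) R"
      proof (rule ideal_of_closed)
        show "N2 n \<subseteq> carrier R" using Qn(7) by (auto simp: N2_def)
        show "\<zero> \<in> N2 n" using Qn(1) NI(1) zc by (auto simp: N2_def)
        show "x \<oplus> y \<in> N2 n" if "x \<in> N2 n" "y \<in> N2 n" for x y
          using that Qn(2,7) NI(2) zc by (auto simp: N2_def l_distr)
        show "r \<otimes> x \<in> N2 n" if "r \<in> carrier R" "x \<in> N2 n" for r x
          using that Qn(3,7) NI(3) zc by (auto simp: N2_def m_assoc)
      qed
      show "N2 n \<subseteq> ?Q n" by (auto simp: N2_def)
    next
      fix n x y assume x: "x \<in> Q" and "y \<in> N2 n"
      then have y: "y \<in> ?Q n" "y \<otimes> z \<in> N (n + p)" by (auto simp: N2_def)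
      have "x \<otimes> y \<otimes> z = x \<otimes> (y \<otimes> z)" using Qc(7)[OF x] Qn(7)[OF y(1)] zc by (simp add: m_assoc)
      then show "x \<otimes> y \<in> N2 (Suc n)"
        using ideal_pow_mult[OF Q _ y(1), of x 1] x ideal_pow_1[OF Q] rees_idealD(4)[OF N x y(2)]
        by (simp add: N2_def)
    qed
    have sub1: "N n \<subseteq> N1 n" for n
    proof
      fix y assume y: "y \<in> N n"
      then have "y = y \<oplus> \<zero> \<otimes> z" using NI(7) zc by simp
      then show "y \<in> N1 n" using y Qn(1) by (auto simp: N1_def mem_set_add)
    qed
    have "z = \<zero> \<oplus> \<one> \<otimes> z" using zc by simp
    then have "z \<in> N1 p" using NI(1) ideal_pow_0 one_closed
      by (auto simp: N1_def mem_set_add ideals_set_def)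
    then have lt1: "N < N1" using sub1 z(2) by (auto simp: less_le le_fun_def)
    have sub2: "N n \<subseteq> N2 n" for n
    proof
      fix y assume y: "y \<in> N n"
      have "y \<otimes> z \<in> N (n + p)"
        using rees_ideal_mult[OF Q N z(1) y] m_comm[OF NI(7)[OF y] zc] by (simp add: add.commute)
      then show "y \<in> N2 n" using y rees_idealD(2)[OF N] by (auto simp: N2_def)
    qed
    have "w \<in> N2 q" using w zw m_comm[OF wc zc] by (simp add: N2_def add.commute)
    then have lt2: "N < N2" using sub2 w(2) by (auto simp: less_le le_fun_def)
    obtain H1 where H1: "finite H1" "\<forall>h\<in>H1. ideal h R \<and> h \<subset> Q"
      "\<forall>x\<in>Q - \<Union>H1. \<exists>D. \<forall>n\<ge>D. \<forall>z\<in>?Q n. x \<otimes> z \<in> N1 (Suc n) \<longrightarrow> z \<in> N1 n"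
      using 1(1)[OF _ N1] N1 N lt1 by blast
    obtain H2 where H2: "finite H2" "\<forall>h\<in>H2. ideal h R \<and> h \<subset> Q"
      "\<forall>x\<in>Q - \<Union>H2. \<exists>D. \<forall>n\<ge>D. \<forall>z\<in>?Q n. x \<otimes> z \<in> N2 (Suc n) \<longrightarrow> z \<in> N2 n"
      using 1(1)[OF _ N2] N2 N lt2 by blast
    have "\<exists>D. \<forall>n\<ge>D. \<forall>y\<in>?Q n. x \<otimes> y \<in> N (Suc n) \<longrightarrow> y \<in> N n" if x: "x \<in> Q - \<Union>(H1 \<union> H2)" for x
    proof -
      obtain D1 where D1: "\<And>n y. n \<ge> D1 \<Longrightarrow> y \<in> ?Q n \<Longrightarrow> x \<otimes> y \<in> N1 (Suc n) \<Longrightarrow> y \<in> N1 n"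
        using H1(3) x by blast
      obtain D2 where D2: "\<And>n y. n \<ge> D2 \<Longrightarrow> y \<in> ?Q n \<Longrightarrow> x \<otimes> y \<in> N2 (Suc n) \<Longrightarrow> y \<in> N2 n"
        using H2(3) x by blast
      have xQ: "x \<in> Q" using x by auto
      have xc: "x \<in> carrier R" using Qc(7)[OF xQ] .
      \<comment> \<open>The bound \<open>D2 + p\<close> makes the second case of \<open>N1\<close>
        apply and puts \<open>n - p\<close> above \<open>D2\<close>. Modulo \<open>N\<close> the
        element \<open>y\<close> is \<open>v z\<close>, and \<open>x v z\<close> lies in
        \<open>N\<close>; hence \<open>x v\<close> lies in \<open>N2\<close>, so does
        \<open>v\<close>, and \<open>v z\<close> is in \<open>N\<close>.\<close>
      have "y \<in> N n" if n: "n \<ge> max D1 (D2 + p)" and y: "y \<in> ?Q n" "x \<otimes> y \<in> N (Suc n)" for n y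
      proof -
        have "y \<in> N1 n" using D1[of n y] n y sub1[of "Suc n"] by auto
        then obtain u v where u: "u \<in> N n" and v: "v \<in> ?Q (n - p)" and yuv: "y = u \<oplus> v \<otimes> z"
          using n by (auto simp: N1_def mem_set_add)
        have c: "u \<in> carrier R" "v \<in> carrier R" using NI(7)[OF u] Qn(7)[OF v] .
        have "x \<otimes> y \<ominus> x \<otimes> u \<in> N (Suc n)" using NI(6)[OF y(2) rees_idealD(4)[OF N xQ u]] .
        moreover have "x \<otimes> y \<ominus> x \<otimes> u = x \<otimes> v \<otimes> z"
        proof -
          have "x \<otimes> y = x \<otimes> u \<oplus> x \<otimes> v \<otimes> z" using c xc zc by (simp add: yuv r_distr m_assoc)
          then show ?thesis using c xc zc by (simp add: minus_eq a_comm[of "x \<otimes> u"] a_assoc r_neg)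
        qed
        moreover have "x \<otimes> v \<in> ?Q (Suc (n - p))"
          using ideal_pow_mult[OF Q _ v, of x 1] xQ ideal_pow_1[OF Q] by simp
        ultimately have xv: "x \<otimes> v \<in> N2 (Suc (n - p))" using n by (simp add: N2_def)
        have "D2 \<le> n - p" using n by linarith
        then have "v \<in> N2 (n - p)" using v xv by (rule D2)
        then have "v \<otimes> z \<in> N n" using n by (simp add: N2_def)
        then show ?thesis using NI(2)[OF u] yuv by simp
      qed
      then show ?thesis by blast
    qed
    then have "\<forall>x\<in>Q - \<Union>(H1 \<union> H2).
        \<exists>D. \<forall>n\<ge>D. \<forall>y\<in>?Q n. x \<otimes> y \<in> N (Suc n) \<longrightarrow> y \<in> N n"
      by (rule ballI)
    moreover have "finite (H1 \<union> H2)" using H1(1) H2(1) by (rule finite_UnI)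
    moreover have "\<forall>h\<in>H1 \<union> H2. ideal h R \<and> h \<subset> Q" using H1(2) H2(2) by (rule ball_Un[THEN iffD2, OF conjI])
    ultimately show ?thesis by (intro exI[of _ "H1 \<union> H2"] conjI)
  next
    case False
    show ?thesis
    proof (cases "N 1 = Q")
      case True
      \<comment> \<open>If \<open>N\<close> contains all of degree one, it contains every positive
        degree, so the set of ideals to avoid can be empty.\<close>
      have "z \<in> N n" if n: "n \<ge> 1" and z: "z \<in> ?Q n" for n z
      proof -
        obtain k where k: "n = Suc k" using n by (cases n) auto
        have "?Q k \<cdot> Q \<subseteq> N n"
          using rees_ideal_mult[OF Q N, of _ k _ 1] True k
          by (intro ideal_prod_le[OF rees_idealD(1)[OF N]]) simp
        then show ?thesis using z k ideal_pow_Suc by auto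
      qed
      then show ?thesis by (intro exI[of _ "{}"]) blast
    next
      case N1: False
      then have "N 1 \<subset> Q" using rees_idealD(2)[OF N, of 1] ideal_pow_1[OF Q] by auto
      \<comment> \<open>Here \<open>N\<close> is prime for homogeneous elements, so an
        \<open>x\<close> of degree one outside \<open>N 1\<close> is regular modulo \<open>N\<close>
        in all degrees.\<close>
      moreover have "z \<in> N n" if x: "x \<in> Q - N 1" and z: "z \<in> ?Q n" "x \<otimes> z \<in> N (Suc n)" for x n z
      proof (rule ccontr)
        assume "z \<notin> N n"
        moreover have "x \<in> ?Q 1 - N 1" using x ideal_pow_1[OF Q] by simp
        moreover have "x \<otimes> z \<in> N (1 + n)" using z(2) by simp
        ultimately show False using False z(1) by blast
      qed
      ultimately show ?thesis
        using rees_idealD(1)[OF N] by (intro exI[of _ "{N 1}"]) auto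
    qed
  qed
qed

end

section \<open>Avoidance and superficial elements in the local ring\<close>

lemma ideals_set_simps [simp]:
  "monoid.mult (ideals_set R) = ideal_prod R" "one (ideals_set R) = carrier R"
  by (simp_all add: ideals_set_def)

sublocale noetherian_local_ring \<subseteq> noetherian_cring
  by unfold_locales

context noetherian_local_ring
begin

lemma maxideal: "ideal \<mm> R"
  by (rule is_ideal)

lemmas maxideal_closed = ideal_closed[OF maxideal]

lemma one_notin_maxideal: "\<one> \<notin> \<mm>"
  using one_imp_carrier I_notcarr by auto

lemma Units_if_notin_maxideal:
  assumes a: "a \<in> carrier R" "a \<notin> \<mm>"
  shows "a \<in> Units R"
proof (rule ccontr)
  assume nu: "a \<notin> Units R"
  \<comment> \<open>A maximal member of \<open>C\<close> is a maximal ideal containing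
    \<open>a\<close>, hence equals \<open>\<mm>\<close>. Unions of chains stay in \<open>C\<close>
    because in a Noetherian ring a nonempty chain of ideals contains its union.\<close>
  define C where "C = {I. ideal I R \<and> a \<in> I \<and> \<one> \<notin> I}"
  have "\<one> \<notin> PIdl a"
    using nu a(1) m_comm unfolding cgenideal_def Units_def by fastforce
  then have "PIdl a \<in> C"
    using cgenideal_ideal[OF a(1)] cgenideal_self[OF a(1)] by (simp add: C_def)
  then have "C \<noteq> {}" by blast
  then have "\<exists>M\<in>C. \<forall>X\<in>C. M \<subseteq> X \<longrightarrow> X = M"
  proof (rule subset_Zorn_nonempty)
    fix D assume D: "D \<noteq> {}" "subset.chain C D"
    then have "subset.chain {I. ideal I R} D"
      unfolding subset_chain_def C_def by blast
    then show "\<Union>D \<in> C"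
      using ideal_chain_is_trivial[OF D(1)] D(2) unfolding subset_chain_def by blast
  qed
  then obtain M where M: "ideal M R" "a \<in> M" "\<one> \<notin> M"
    and max: "\<And>X. X \<in> C \<Longrightarrow> M \<subseteq> X \<Longrightarrow> X = M" unfolding C_def by blast
  have "maximalideal M R"
  proof (rule maximalidealI[OF M(1)])
    show "carrier R \<noteq> M" using M(3) by auto
    show "X = M \<or> X = carrier R" if X: "ideal X R" "M \<subseteq> X" "X \<subseteq> carrier R" for X
      using max[of X] X M(2) ideal.one_imp_carrier[OF X(1)] unfolding C_def by blast
  qed
  then show False using maximal_unique M(2) a(2) by blast
qed

text \<open>The infinite residue field takes the place of primality. If \<open>y\<close> avoids
  \<open>H\<close> but lies in \<open>h\<close>, all \<open>z + u y\<close> avoid \<open>h\<close>;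
  were none of them good, two with \<open>u\<close>, \<open>v\<close> in different residue classes
  would lie in one member of \<open>H\<close>, which would then contain \<open>(u - v) y\<close> and
  hence \<open>y\<close>.\<close>

lemma ideal_avoidance:
  assumes inf: "infinite (carrier (R Quot \<mm>))"
    and Q: "ideal Q R" and "finite H" and "\<And>h. h \<in> H \<Longrightarrow> ideal h R \<and> h \<subset> Q"
  shows "\<exists>x\<in>Q. x \<notin> \<Union>H"
  using assms(3,4)
proof (induction H)
  case empty
  then show ?case using ideal_closed(1)[OF Q] by auto
next
  case (insert h H)
  then obtain y where y: "y \<in> Q" "y \<notin> \<Union>H" by blast
  show ?case
  proof (cases "y \<in> h")
    case False
    then show ?thesis using y by blast
  next
    case yh: True
    have h: "ideal h R" and HI: "\<And>h. h \<in> H \<Longrightarrow> ideal h R" using insert.prems by auto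
    obtain z where z: "z \<in> Q" "z \<notin> h" using insert.prems by blast
    have c: "y \<in> carrier R" "z \<in> carrier R" using ideal_closed(7)[OF Q] y(1) z(1) by blast+
    \<comment> \<open>\<open>U\<close> picks one representative from each residue class, so
      differences of distinct elements of \<open>U\<close> are units.\<close>
    have "carrier (R Quot \<mm>) \<subseteq> (\<lambda>u. \<mm> +> u) ` carrier R"
      by (auto simp: FactRing_def A_RCOSETS_def')
    then obtain U where U: "U \<subseteq> carrier R" "inj_on (\<lambda>u. \<mm> +> u) U"
      "carrier (R Quot \<mm>) = (\<lambda>u. \<mm> +> u) ` U"
      by (meson subset_image_inj)
    have infU: "infinite U" using inf U(3) by auto
    show ?thesis
    proof (rule ccontr)
      assume no: "\<not> ?thesis"
      have "\<exists>k\<in>H. z \<oplus> u \<otimes> y \<in> k" if u: "u \<in> U" for u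
      proof -
        have uc: "u \<in> carrier R" using u U by auto
        have "z \<oplus> u \<otimes> y \<in> Q"
          using ideal_closed(2,3)[OF Q] y z uc by blast
        then have "z \<oplus> u \<otimes> y \<in> \<Union>(insert h H)" using no by blast
        moreover have "z \<oplus> u \<otimes> y \<notin> h"
        proof
          assume "z \<oplus> u \<otimes> y \<in> h"
          then have "(z \<oplus> u \<otimes> y) \<ominus> u \<otimes> y \<in> h"
            using ideal_closed(3,6)[OF h] yh uc by blast
          moreover have "(z \<oplus> u \<otimes> y) \<ominus> u \<otimes> y = z"
            using c uc by (simp add: minus_eq a_assoc r_neg)
          ultimately show False using z(2) by simp
        qed
        ultimately show ?thesis by blast
      qed
      then obtain k where k: "\<And>u. u \<in> U \<Longrightarrow> k u \<in> H \<and> z \<oplus> u \<otimes> y \<in> k u" by metis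
      have "finite (k ` U)" using k insert.hyps(1) by (meson finite_subset image_subsetI)
      then obtain u where u: "u \<in> U" "infinite {v \<in> U. k v = k u}"
        using pigeonhole_infinite[OF infU] by blast
      have "infinite ({v \<in> U. k v = k u} - {u})" using u(2) by simp
      then have "{v \<in> U. k v = k u} - {u} \<noteq> {}" by (metis finite.emptyI)
      then obtain v where v: "v \<in> U" "k v = k u" "v \<noteq> u" by blast
      have uv: "u \<in> carrier R" "v \<in> carrier R" using u v U by auto
      have "\<mm> +> u \<noteq> \<mm> +> v" using inj_onD[OF U(2)] u v by blast
      then have "u \<ominus> v \<notin> \<mm>"
        using quotient_eq_iff_same_a_r_cos[OF maxideal uv] by simp
      then have unit: "u \<ominus> v \<in> Units R" using Units_if_notin_maxideal uv by simp
      have K: "ideal (k u) R" using k u HI by blast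
      have "(z \<oplus> u \<otimes> y) \<ominus> (z \<oplus> v \<otimes> y) \<in> k u"
        using ideal_closed(6)[OF K] k u v by metis
      moreover have "(z \<oplus> u \<otimes> y) \<ominus> (z \<oplus> v \<otimes> y) = (u \<ominus> v) \<otimes> y"
        using c uv by algebra
      ultimately have "inv (u \<ominus> v) \<otimes> ((u \<ominus> v) \<otimes> y) \<in> k u"
        using ideal_closed(3)[OF K] unit by simp
      moreover have "inv (u \<ominus> v) \<otimes> ((u \<ominus> v) \<otimes> y) = y"
        using unit c uv by (simp add: m_assoc[symmetric])
      ultimately show False using y(2) k u by auto
    qed
  qed
qed

lemma positive_depthE:
  assumes "positive_depth R \<mm>"
  obtains y where "y \<in> \<mm>" "\<And>z. z \<in> carrier R \<Longrightarrow> y \<otimes> z = \<zero> \<Longrightarrow> z = \<zero>"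
  using assms unfolding positive_depth_def by blast

text \<open>If all positive powers of \<open>\<mm>\<close> coincide, the Artin-Rees family of a
  regular \<open>y\<close> in \<open>\<mm>\<close> is constant in positive degrees and yields
  \<open>(y) = \<mm> (y)\<close>. Then \<open>y = c y\<close> with \<open>c\<close> in
  \<open>\<mm>\<close>, and cancelling \<open>y\<close> gives \<open>c = 1\<close>.\<close>

lemma maxideal_square_neq:
  assumes "positive_depth R \<mm>"
  shows "ideal_pow R \<mm> 2 \<subset> \<mm>"
proof -
  have "ideal_pow R \<mm> 2 = \<mm> \<cdot> \<mm>"
    by (simp only: numeral_2_eq_2 ideal_pow_Suc[of _ "Suc 0"] ideal_pow_1[OF maxideal])
  moreover have "\<mm> \<cdot> \<mm> \<noteq> \<mm>"
  proof
    assume eq: "\<mm> \<cdot> \<mm> = \<mm>"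
    have pow: "ideal_pow R \<mm> (Suc n) = \<mm>" for n
    proof (induction n)
      case 0
      show ?case by (rule ideal_pow_1[OF maxideal])
    next
      case (Suc n)
      show ?case unfolding ideal_pow_Suc[of _ "Suc n"] Suc eq ..
    qed
    obtain y where y: "y \<in> \<mm>" "\<And>z. z \<in> carrier R \<Longrightarrow> y \<otimes> z = \<zero> \<Longrightarrow> z = \<zero>"
      using positive_depthE[OF assms] by blast
    have yc: "y \<in> carrier R" using maxideal_closed(7)[OF y(1)] .
    let ?N = "\<lambda>n. ideal_pow R \<mm> n \<inter> PIdl y"
    obtain D where D: "\<And>n. n \<ge> D \<Longrightarrow> ?N (Suc n) = \<mm> \<cdot> ?N n"
      using rees_ideal_eventually_mult[OF maxideal rees_ideal_inter[OF maxideal cgenideal_ideal[OF yc]]]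
      by blast
    have "PIdl y \<subseteq> \<mm>" using cgenideal_minimal[OF maxideal y(1)] .
    then have "PIdl y = \<mm> \<cdot> (PIdl y)"
      using D[of "Suc D"] pow[of D] pow[of "Suc D"] by (simp add: Int_absorb1)
    also have "\<dots> \<subseteq> (\<lambda>c. c \<otimes> y) ` \<mm>"
    proof (rule ideal_prod_le[OF ideal_scale[OF maxideal yc]])
      fix i j assume i: "i \<in> \<mm>" and "j \<in> PIdl y"
      then obtain r where r: "r \<in> carrier R" "j = r \<otimes> y" unfolding cgenideal_def by blast
      then have "i \<otimes> j = (i \<otimes> r) \<otimes> y" using maxideal_closed(7)[OF i] yc by (simp add: m_assoc)
      then show "i \<otimes> j \<in> (\<lambda>c. c \<otimes> y) ` \<mm>" using maxideal_closed(4)[OF r(1) i] by blast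
    qed
    finally obtain c where c: "c \<in> \<mm>" "y = c \<otimes> y" using cgenideal_self[OF yc] by auto
    have cc: "c \<in> carrier R" using maxideal_closed(7)[OF c(1)] .
    have "y \<otimes> (\<one> \<ominus> c) = y \<ominus> c \<otimes> y" using yc cc by algebra
    also have "\<dots> = \<zero>" using c(2) yc by (simp add: minus_eq r_neg)
    finally have "\<one> \<ominus> c = \<zero>" using y(2) cc by simp
    then have "c = \<one>" using cc by simp
    then show False using c(1) one_notin_maxideal by simp
  qed
  ultimately show ?thesis
    using ideal_prod_inter[OF maxideal maxideal] by auto
qed

text \<open>Two regularity conditions in large degree are imposed: in the Rees algebra, which makes
  \<open>x\<close> a non-zero-divisor, and in the associated graded ring, which controls
  \<open>\<mm>^(n+2) : x\<close> inside \<open>\<mm>^n\<close>. Artin-Rees for \<open>(x)\<close>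
  then removes the restriction to \<open>\<mm>^n\<close>.\<close>

lemma superficial_element_exists:
  assumes inf: "infinite (carrier (R Quot \<mm>))" and depth: "positive_depth R \<mm>"
  shows "\<exists>x\<in>\<mm> - ideal_pow R \<mm> 2. \<exists>D. \<forall>n\<ge>D. \<forall>z\<in>carrier R.
    x \<otimes> z \<in> ideal_pow R \<mm> (Suc n) \<longrightarrow> z \<in> ideal_pow R \<mm> n"
proof -
  let ?m = "ideal_pow R \<mm>"
  note mI = ideal_pow_ideal[OF maxideal]
  obtain H where H: "finite H" "\<forall>h\<in>H. ideal h R \<and> h \<subset> \<mm>"
    and reg0: "\<forall>x\<in>\<mm> - \<Union>H. \<exists>D. \<forall>n\<ge>D. \<forall>z\<in>?m n. x \<otimes> z \<in> {\<zero>} \<longrightarrow> z \<in> {\<zero>}"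
    using rees_ideal_regular_in_large_degree[OF maxideal rees_ideal_zero[OF maxideal]] by blast
  obtain H' where H': "finite H'" "\<forall>h\<in>H'. ideal h R \<and> h \<subset> \<mm>"
    and reg1: "\<forall>x\<in>\<mm> - \<Union>H'. \<exists>D. \<forall>n\<ge>D. \<forall>z\<in>?m n. x \<otimes> z \<in> ?m (Suc (Suc n)) \<longrightarrow> z \<in> ?m (Suc n)"
    using rees_ideal_regular_in_large_degree[OF maxideal rees_ideal_pow_Suc[OF maxideal]] by blast
  \<comment> \<open>Adding the square of \<open>\<mm>\<close> to the ideals to avoid ensures that
    \<open>x\<close> has order exactly one; the square is proper in \<open>\<mm>\<close> by positive
    depth.\<close>
  have "\<exists>x\<in>\<mm>. x \<notin> \<Union>(insert (?m 2) (H \<union> H'))"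
    by (rule ideal_avoidance[OF inf maxideal])
      (use H H' maxideal_square_neq[OF depth] mI in auto)
  then obtain x where x: "x \<in> \<mm>" "x \<notin> ?m 2" "x \<notin> \<Union>H" "x \<notin> \<Union>H'" by blast
  have xc: "x \<in> carrier R" using maxideal_closed(7)[OF x(1)] .
  obtain D0 where D0: "\<And>n z. n \<ge> D0 \<Longrightarrow> z \<in> ?m n \<Longrightarrow> x \<otimes> z = \<zero> \<Longrightarrow> z = \<zero>"
    using reg0 x by blast
  obtain D1 where D1: "\<And>n z. n \<ge> D1 \<Longrightarrow> z \<in> ?m n \<Longrightarrow> x \<otimes> z \<in> ?m (Suc (Suc n)) \<Longrightarrow> z \<in> ?m (Suc n)"
    using reg1 x by blast
  obtain y where y: "y \<in> \<mm>" "\<And>z. z \<in> carrier R \<Longrightarrow> y \<otimes> z = \<zero> \<Longrightarrow> z = \<zero>"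
    using positive_depthE[OF depth] by blast
  have yc: "y \<in> carrier R" using maxideal_closed(7)[OF y(1)] .
  have y_pow: "y [^] n \<in> ?m n" for n :: nat
  proof (induction n)
    case 0
    show ?case unfolding ideal_pow_0 by simp
  next
    case (Suc n)
    show ?case unfolding ideal_pow_Suc nat_pow_Suc by (rule ideal_prod.prod[OF Suc y(1)])
  qed
  have y_pow_reg: "z = \<zero>" if "z \<in> carrier R" "y [^] n \<otimes> z = \<zero>" for z and n :: nat
    using that
  proof (induction n arbitrary: z)
    case (Suc n)
    then have "y [^] n \<otimes> (y \<otimes> z) = \<zero>" using yc by (simp add: m_assoc)
    then have "y \<otimes> z = \<zero>" using Suc yc by simp
    then show ?case using y(2) Suc.prems(1) by blast
  qed simp
  \<comment> \<open>Regularity of \<open>x\<close> is known only on \<open>\<mm>^D0\<close>;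
    multiplying by the regular element \<open>y^D0\<close> moves any \<open>z\<close> there.\<close>
  have x_reg: "z = \<zero>" if z: "z \<in> carrier R" "x \<otimes> z = \<zero>" for z
  proof -
    have "y [^] D0 \<otimes> z \<in> ?m D0" using ideal_closed(4)[OF mI z(1) y_pow] .
    moreover have "x \<otimes> (y [^] D0 \<otimes> z) = \<zero>" using z xc yc by (simp add: m_lcomm[of x "y [^] D0"])
    ultimately show ?thesis using D0[of D0] y_pow_reg[OF z(1)] by blast
  qed
  let ?N = "\<lambda>n. ?m n \<inter> PIdl x"
  obtain D2 where D2: "\<And>n. n \<ge> D2 \<Longrightarrow> ?N (Suc n) = \<mm> \<cdot> ?N n"
    using rees_ideal_eventually_mult[OF maxideal rees_ideal_inter[OF maxideal cgenideal_ideal[OF xc]]]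
    by blast
  have N_sub: "?N (D2 + l) \<subseteq> (\<lambda>c. c \<otimes> x) ` ?m l" for l
  proof (induction l)
    case 0
    show ?case unfolding ideal_pow_0 cgenideal_def by blast
  next
    case (Suc l)
    have "?N (Suc (D2 + l)) = \<mm> \<cdot> ?N (D2 + l)" by (rule D2) simp
    also have "\<dots> \<subseteq> (\<lambda>c. c \<otimes> x) ` ?m (Suc l)"
    proof (rule ideal_prod_le[OF ideal_scale[OF mI xc]])
      fix i j assume i: "i \<in> \<mm>" and "j \<in> ?N (D2 + l)"
      then obtain c where c: "c \<in> ?m l" "j = c \<otimes> x" using Suc by blast
      have "i \<otimes> j = (i \<otimes> c) \<otimes> x"
        using maxideal_closed(7)[OF i] ideal_closed(7)[OF mI c(1)] xc c(2) by (simp add: m_assoc)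
      moreover have "i \<otimes> c \<in> ?m (Suc l)"
        using ideal_pow_mult[OF maxideal _ c(1), of i 1] i ideal_pow_1[OF maxideal] by simp
      ultimately show "i \<otimes> j \<in> (\<lambda>c. c \<otimes> x) ` ?m (Suc l)" by blast
    qed
    finally show ?case by simp
  qed
  \<comment> \<open>With \<open>l = n + 1 - D2\<close>, Artin-Rees and cancellation of
    \<open>x\<close> place \<open>z\<close> in \<open>\<mm>^l\<close>, and the bound on
    \<open>n\<close> gives \<open>l \<ge> D1\<close>, the starting point of the climb below.\<close>
  have "z \<in> ?m n" if n: "n \<ge> D2 + D1" and z: "z \<in> carrier R" "x \<otimes> z \<in> ?m (Suc n)" for n z
  proof -
    define l where "l = Suc n - D2"
    have "x \<otimes> z \<in> ?N (D2 + l)"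
      using z n m_comm[OF xc z(1)] unfolding l_def cgenideal_def by auto
    then obtain c where c: "c \<in> ?m l" "x \<otimes> z = c \<otimes> x" using N_sub by blast
    have cc: "c \<in> carrier R" using ideal_closed(7)[OF mI c(1)] .
    have "x \<otimes> (z \<ominus> c) = x \<otimes> z \<ominus> c \<otimes> x" using xc cc z by algebra
    also have "\<dots> = \<zero>" using c(2) xc cc by (simp add: minus_eq r_neg)
    finally have "z \<ominus> c = \<zero>" using x_reg z cc by simp
    then have "z = c" using z cc by simp
    moreover have "D1 \<le> l" using n unfolding l_def by linarith
    ultimately have zD: "z \<in> ?m D1" using c(1) ideal_pow_antimono[OF maxideal, of D1 l] by blast
    \<comment> \<open>Each use of the associated graded condition raises the order of
      \<open>z\<close> by one, until the known order \<open>n + 1\<close> of \<open>x z\<close> is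
      exhausted.\<close>
    have "z \<in> ?m (D1 + k)" if "D1 + k \<le> n" for k
      using that
    proof (induction k)
      case (Suc k)
      have "x \<otimes> z \<in> ?m (Suc (Suc (D1 + k)))"
        using ideal_pow_antimono[OF maxideal, of "Suc (Suc (D1 + k))" "Suc n"] z Suc.prems by auto
      then show ?case using D1[of "D1 + k" z] Suc by simp
    qed (use zD in simp)
    from this[of "n - D1"] show ?thesis using n by simp
  qed
  then show ?thesis using x by blast
qed

end

section \<open>Full ideals and reductions of the maximal ideal\<close>

context noetherian_local_ring
begin

lemma ideal_colon_cgenideal:
  assumes A: "ideal A R" and x: "x \<in> carrier R"
  shows "ideal_colon R A (PIdl x) = {r \<in> carrier R. r \<otimes> x \<in> A}"
proof -
  have "r \<otimes> (s \<otimes> x) \<in> A" if "r \<in> carrier R" "r \<otimes> x \<in> A" "s \<in> carrier R" for r s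
    using ideal_closed(3)[OF A that(3,2)] that x by (simp add: m_lcomm)
  then show ?thesis
    using cgenideal_self[OF x] unfolding ideal_colon_def cgenideal_def by blast
qed

lemma ideal_le_colon:
  assumes "ideal J R" "B \<subseteq> \<mm>"
  shows "J \<subseteq> ideal_colon R (J \<cdot> \<mm>) B"
  using ideal_closed(7)[OF assms(1)] ideal_prod.prod[of _ J _ \<mm> R] assms(2)
  unfolding ideal_colon_def by blast

lemma weakly_m_fullI:
  assumes "ideal J R" "\<And>r. r \<in> carrier R \<Longrightarrow> (\<And>b. b \<in> \<mm> \<Longrightarrow> r \<otimes> b \<in> J \<cdot> \<mm>) \<Longrightarrow> r \<in> J"
  shows "weakly_m_full R \<mm> J"
  unfolding weakly_m_full_def
  using ideal_le_colon[OF assms(1) subset_refl] assms(2) by (auto simp: ideal_colon_def)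

lemma weakly_m_fullD:
  assumes "weakly_m_full R \<mm> J" "r \<in> carrier R" "\<And>b. b \<in> \<mm> \<Longrightarrow> r \<otimes> b \<in> J \<cdot> \<mm>"
  shows "r \<in> J"
  using assms unfolding weakly_m_full_def ideal_colon_def by blast

lemma m_fullI:
  assumes J: "ideal J R" and x: "x \<in> \<mm> - ideal_pow R \<mm> 2"
    and full: "\<And>r. r \<in> carrier R \<Longrightarrow> r \<otimes> x \<in> J \<cdot> \<mm> \<Longrightarrow> r \<in> J"
  shows "m_full R \<mm> J"
proof -
  have xc: "x \<in> carrier R" using x maxideal_closed(7) by blast
  have "J \<subseteq> ideal_colon R (J \<cdot> \<mm>) (PIdl x)"
    using ideal_le_colon[OF J cgenideal_minimal[OF maxideal]] x by blast
  then show ?thesis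
    using x full ideal_colon_cgenideal[OF ideal_prod_is_ideal[OF J maxideal] xc]
    unfolding m_full_def by blast
qed

lemma m_fullE:
  assumes J: "ideal J R" and "m_full R \<mm> J"
  obtains x where "x \<in> \<mm> - ideal_pow R \<mm> 2"
    "\<And>r. r \<in> carrier R \<Longrightarrow> r \<otimes> x \<in> J \<cdot> \<mm> \<Longrightarrow> r \<in> J"
proof -
  obtain x where x: "x \<in> \<mm> - ideal_pow R \<mm> 2" "ideal_colon R (J \<cdot> \<mm>) (PIdl x) = J"
    using assms(2) unfolding m_full_def by blast
  have xc: "x \<in> carrier R" using x(1) maxideal_closed(7) by blast
  show ?thesis
    using x that ideal_colon_cgenideal[OF ideal_prod_is_ideal[OF J maxideal] xc] by blast
qed

lemma m_full_imp_weakly_m_full: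
  assumes J: "ideal J R" and "m_full R \<mm> J" shows "weakly_m_full R \<mm> J"
  by (rule m_fullE[OF assms]) (blast intro: weakly_m_fullI[OF J])

text \<open>The same \<open>x\<close> serves: if \<open>r x\<close> lies in \<open>J\<close>, then
  \<open>(r b) x\<close> lies in \<open>J \<mm>\<close> for all \<open>b\<close> in
  \<open>\<mm>\<close>, and \<open>x\<close> can be cancelled by
  \<open>\<mm>\<close>-fullness.\<close>

lemma m_full_imp_full:
  assumes J: "ideal J R" and mf: "m_full R \<mm> J" shows "full R \<mm> J"
proof -
  obtain x where x: "x \<in> \<mm> - ideal_pow R \<mm> 2"
    and mf: "\<And>r. r \<in> carrier R \<Longrightarrow> r \<otimes> x \<in> J \<cdot> \<mm> \<Longrightarrow> r \<in> J"
    using m_fullE[OF J mf] by metis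
  have xc: "x \<in> carrier R" using x maxideal_closed(7) by blast
  have "r \<otimes> b \<in> J" if r: "r \<in> carrier R" "r \<otimes> x \<in> J" and b: "b \<in> \<mm>" for r b
  proof -
    have bc: "b \<in> carrier R" using maxideal_closed(7)[OF b] .
    have "(r \<otimes> x) \<otimes> b \<in> J \<cdot> \<mm>" using r(2) b by (rule ideal_prod.prod)
    moreover have "(r \<otimes> x) \<otimes> b = (r \<otimes> b) \<otimes> x" using r(1) xc bc by (simp add: m_ac)
    ultimately show ?thesis using mf[of "r \<otimes> b"] r(1) bc by simp
  qed
  then have "ideal_colon R J (PIdl x) = ideal_colon R J \<mm>"
    using x unfolding ideal_colon_cgenideal[OF J xc] by (auto simp: ideal_colon_def)
  then show ?thesis using x unfolding full_def by blast
qed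

end

section \<open>Products of a reduction with powers of the maximal ideal\<close>

locale maxideal_reduction = noetherian_local_ring R \<mm> for R (structure) and \<mm> +
  fixes I
  assumes residue_infinite: "infinite (carrier (R Quot \<mm>))"
    and depth: "positive_depth R \<mm>"
    and reduction: "reduction_of R \<mm> I"
begin

abbreviation J :: "nat \<Rightarrow> 'a set" where
  "J n \<equiv> I \<cdot> ideal_pow R \<mm> n"

lemma I_ideal: "ideal I R" and I_le: "I \<subseteq> \<mm>"
  using reduction unfolding reduction_of_def by auto

lemma J_ideal: "ideal (J n) R"
  by (rule ideal_prod_is_ideal[OF I_ideal ideal_pow_ideal[OF maxideal]])

lemma J_mult: "J n \<cdot> \<mm> = J (Suc n)"
  using ideal_prod_assoc[OF I_ideal ideal_pow_ideal[OF maxideal] maxideal]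
  by simp

lemma J_le: "J n \<subseteq> ideal_pow R \<mm> (Suc n)"
proof -
  have "J n \<subseteq> \<mm> \<cdot> ideal_pow R \<mm> n" using I_le by (rule ideal_prod_mono) simp
  also have "\<dots> = ideal_pow R \<mm> (Suc n)"
    using ideal_pow_add[OF maxideal, of 1 n] ideal_pow_1[OF maxideal] by simp
  finally show ?thesis .
qed

lemma J_eventually: "\<exists>r. \<forall>n\<ge>r. J n = ideal_pow R \<mm> (Suc n)"
proof -
  obtain r where r: "J r = ideal_pow R \<mm> (Suc r)"
    using reduction unfolding reduction_of_def by auto
  have "J (r + k) = ideal_pow R \<mm> (Suc (r + k))" for k
  proof (induction k)
    case (Suc k)
    have "J (r + Suc k) = J (r + k) \<cdot> \<mm>" using J_mult[of "r + k"] by simp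
    also have "\<dots> = ideal_pow R \<mm> (Suc (r + Suc k))"
      unfolding Suc using ideal_pow_Suc[of \<mm> "Suc (r + k)"] by simp
    finally show ?case .
  qed (use r in simp)
  then show ?thesis by (metis le_Suc_ex)
qed

lemma J_eq_if_weakly_m_full:
  assumes "\<And>n. n \<ge> t \<Longrightarrow> weakly_m_full R \<mm> (J n)" "n \<ge> t"
  shows "J n = ideal_pow R \<mm> (Suc n)"
proof -
  obtain r where r: "\<And>n. n \<ge> r \<Longrightarrow> J n = ideal_pow R \<mm> (Suc n)" using J_eventually by blast
  \<comment> \<open>The descent starts at \<open>max n r\<close>, where the reduction equation
    already holds, and ends at the given \<open>n\<close>.\<close>
  have "max n r \<ge> n" by simp
  then show ?thesis
  proof (induction n rule: inc_induct)
    case base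
    show ?case by (rule r) simp
  next
    case (step k)
    have "z \<in> J k" if z: "z \<in> ideal_pow R \<mm> (Suc k)" for z
    proof (rule weakly_m_fullD)
      show "weakly_m_full R \<mm> (J k)" using assms step.hyps(1) by auto
      show "z \<in> carrier R" using ideal_closed(7)[OF ideal_pow_ideal[OF maxideal] z] .
      show "z \<otimes> b \<in> J k \<cdot> \<mm>" if "b \<in> \<mm>" for b
        unfolding J_mult step.IH ideal_pow_Suc[of _ "Suc k"] using z that by (rule ideal_prod.prod)
    qed
    then show ?case using J_le by blast
  qed
qed

text \<open>A single superficial element is a witness for all \<open>n \<ge> t\<close>: its
  cancellation property, known in large degrees, is carried down by weak fullness.\<close>

lemma m_full_if_weakly_m_full:
  assumes weak: "\<And>n. n \<ge> t \<Longrightarrow> weakly_m_full R \<mm> (J n)" and "n \<ge> t"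
  shows "m_full R \<mm> (J n)"
proof -
  have eq: "J n = ideal_pow R \<mm> (Suc n)" if "n \<ge> t" for n
    using weak that by (rule J_eq_if_weakly_m_full)
  obtain x D where x: "x \<in> \<mm> - ideal_pow R \<mm> 2"
    and D: "\<And>n z. n \<ge> D \<Longrightarrow> z \<in> carrier R \<Longrightarrow> x \<otimes> z \<in> ideal_pow R \<mm> (Suc n) \<Longrightarrow> z \<in> ideal_pow R \<mm> n"
    using superficial_element_exists[OF residue_infinite depth] by blast
  have xm: "x \<in> \<mm>" and xc: "x \<in> carrier R" using x maxideal_closed(7) by auto
  have "max n D \<ge> n" by simp
  then have "\<forall>z\<in>carrier R. x \<otimes> z \<in> ideal_pow R \<mm> (Suc (Suc n)) \<longrightarrow> z \<in> ideal_pow R \<mm> (Suc n)"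
  proof (induction n rule: inc_induct)
    case base
    show ?case using D[of "Suc (max n D)"] by auto
  next
    case (step k)
    have kt: "t \<le> k" using assms(2) step.hyps(1) by simp
    show ?case
    proof (intro ballI impI)
      fix z assume z: "z \<in> carrier R" "x \<otimes> z \<in> ideal_pow R \<mm> (Suc (Suc k))"
      \<comment> \<open>Multiplying by \<open>b\<close> raises the order of \<open>x z\<close> by
        one, so the cancellation already proved one degree higher applies to \<open>z b\<close>.
        Since \<open>\<mm>^(k+2) = J (k+1) = J k \<mm>\<close>, weak fullness of \<open>J k\<close>
        can be used.\<close>
      have "z \<otimes> b \<in> J k \<cdot> \<mm>" if b: "b \<in> \<mm>" for b
      proof -
        have bc: "b \<in> carrier R" using maxideal_closed(7)[OF b] .
        have "(x \<otimes> z) \<otimes> b \<in> ideal_pow R \<mm> (Suc (Suc (Suc k)))"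
          unfolding ideal_pow_Suc[of _ "Suc (Suc k)"] using z(2) b by (rule ideal_prod.prod)
        then have "x \<otimes> (z \<otimes> b) \<in> ideal_pow R \<mm> (Suc (Suc (Suc k)))"
          using z(1) bc xc by (simp add: m_assoc)
        then have "z \<otimes> b \<in> ideal_pow R \<mm> (Suc (Suc k))" using step.IH z(1) bc by blast
        moreover have "J (Suc k) = ideal_pow R \<mm> (Suc (Suc k))" by (rule eq[OF le_SucI[OF kt]])
        ultimately show ?thesis using J_mult[of k] by simp
      qed
      then have "z \<in> J k" using weakly_m_fullD[OF weak[OF kt] z(1)] by blast
      then show "z \<in> ideal_pow R \<mm> (Suc k)" using eq[OF kt] by simp
    qed
  qed
  then show ?thesis
    using assms(2) m_comm[OF xc] unfolding J_mult[symmetric]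
    by (intro m_fullI[OF J_ideal x]) (simp add: J_mult eq)
qed

text \<open>This gives content to the minimum in \<open>n\<^sub>1\<close>: for large
  \<open>n\<close> the ideal \<open>J n\<close> is a power of \<open>\<mm>\<close>, and a
  superficial element cancels.\<close>

lemma eventually_m_full: "\<exists>t. \<forall>n\<ge>t. m_full R \<mm> (J n)"
proof -
  obtain x D where x: "x \<in> \<mm> - ideal_pow R \<mm> 2"
    and D: "\<And>n z. n \<ge> D \<Longrightarrow> z \<in> carrier R \<Longrightarrow> x \<otimes> z \<in> ideal_pow R \<mm> (Suc n) \<Longrightarrow> z \<in> ideal_pow R \<mm> n"
    using superficial_element_exists[OF residue_infinite depth] by blast
  have xc: "x \<in> carrier R" using x maxideal_closed(7) by auto
  obtain r where r: "\<And>n. n \<ge> r \<Longrightarrow> J n = ideal_pow R \<mm> (Suc n)" using J_eventually by blast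
  have "m_full R \<mm> (J n)" if "n \<ge> max r D" for n
    using that r[of n] r[of "Suc n"] D[of "Suc n"] m_comm[OF xc]
    by (intro m_fullI[OF J_ideal x]) (simp add: J_mult)
  then show ?thesis by blast
qed

text \<open>The equivalence concerns whole tails: \<open>\<mm>\<close>-fullness at one index is
  obtained from weak fullness at that index and all larger ones.\<close>

lemma m_full_iff_weakly_m_full_from:
  "(\<forall>n\<ge>t. m_full R \<mm> (J n)) \<longleftrightarrow> (\<forall>n\<ge>t. weakly_m_full R \<mm> (J n))"
  using m_full_if_weakly_m_full[of t] m_full_imp_weakly_m_full[OF J_ideal] by blast

lemma n3_eq_n1: "n\<^sub>3 R \<mm> I = n\<^sub>1 R \<mm> I"
  unfolding n\<^sub>1_def n\<^sub>3_def m_full_iff_weakly_m_full_from ..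

lemma n1_property: "n \<ge> n\<^sub>1 R \<mm> I \<Longrightarrow> m_full R \<mm> (J n)"
  unfolding n\<^sub>1_def using LeastI_ex[OF eventually_m_full] by blast

lemma n2_le_n1: "n\<^sub>2 R \<mm> I \<le> n\<^sub>1 R \<mm> I"
  unfolding n\<^sub>2_def by (rule Least_le) (use n1_property m_full_imp_full[OF J_ideal] in blast)

text \<open>Weak fullness at \<open>k\<close> would extend the tail of weakly full ideals down to
  \<open>k\<close>; as tails of weakly full and of full ideals agree, this would beat the
  minimum.\<close>

lemma n1_pred:
  assumes "n\<^sub>1 R \<mm> I = Suc k" shows "\<not> weakly_m_full R \<mm> (J k)"
proof
  assume "weakly_m_full R \<mm> (J k)"
  moreover have "weakly_m_full R \<mm> (J n)" if "n \<ge> Suc k" for n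
    using m_full_imp_weakly_m_full[OF J_ideal n1_property] that assms by simp
  ultimately have "\<forall>n\<ge>k. weakly_m_full R \<mm> (J n)" by (metis le_antisym not_less_eq_eq)
  then have "n\<^sub>1 R \<mm> I \<le> k"
    unfolding n\<^sub>1_def m_full_iff_weakly_m_full_from by (rule Least_le)
  then show False using assms by simp
qed

end

section \<open>A Koszul-type differential on tensor powers\<close>

text \<open>
  A function \<open>c\<close> on lists of length \<open>p\<close> over \<open>K\<close> stands for an element of \<open>G \<otimes> E\<^sup>p\<close>, the \<open>p\<close>-th
  tensor power of a free module \<open>E\<close> with basis \<open>K\<close>, on which the alternating sum of the contractions with \<open>\<gamma>\<close> is
  a differential.  Using tensor powers instead of exterior powers avoids all alternation conditions.
\<close>

primrec koszul_diff ::
    "('g, 'z) ring_scheme \<Rightarrow> 'k set \<Rightarrow> ('k \<Rightarrow> 'g \<Rightarrow> 'g) \<Rightarrow> 'k list \<Rightarrow> ('k list \<Rightarrow> 'g) \<Rightarrow> 'g" where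
  "koszul_diff G K \<gamma> [] c = (\<Oplus>\<^bsub>G\<^esub>k\<in>K. \<gamma> k (c [k]))"
| "koszul_diff G K \<gamma> (j # ks) c =
     (\<Oplus>\<^bsub>G\<^esub>k\<in>K. \<gamma> k (c (k # j # ks))) \<ominus>\<^bsub>G\<^esub> koszul_diff G K \<gamma> ks (\<lambda>ls. c (j # ls))"

lemma (in abelian_group) eq_if_minus_eq_zero:
  assumes "x \<in> carrier G" "y \<in> carrier G" "x \<ominus> y = \<zero>" shows "x = y"
proof -
  have "x = (x \<ominus> y) \<oplus> y" using assms(1,2) by (simp add: minus_eq a_assoc l_neg)
  then show ?thesis using assms by simp
qed

lemma (in abelian_group) finsum_swap:
  assumes "finite A" "finite B" "\<And>i j. f i j \<in> carrier G"
  shows "(\<Oplus>i\<in>A. \<Oplus>j\<in>B. f i j) = (\<Oplus>j\<in>B. \<Oplus>i\<in>A. f i j)"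
  using assms(1)
proof (induction A)
  case (insert a A)
  have "(\<Oplus>i\<in>insert a A. \<Oplus>j\<in>B. f i j) = (\<Oplus>j\<in>B. f a j) \<oplus> (\<Oplus>j\<in>B. \<Oplus>i\<in>A. f i j)"
    using insert assms(3) by (simp add: Pi_def)
  also have "\<dots> = (\<Oplus>j\<in>B. f a j \<oplus> (\<Oplus>i\<in>A. f i j))"
    using assms(3) by (intro finsum_addf[symmetric]) (auto simp: Pi_def)
  also have "\<dots> = (\<Oplus>j\<in>B. \<Oplus>i\<in>insert a A. f i j)"
    using insert assms(3) by (intro finsum_cong') (auto simp: Pi_def)
  finally show ?case .
qed (simp add: finsum_zero)

lemma (in abelian_group) finsum_minus:
  assumes "finite A" "\<And>i. f i \<in> carrier G" "\<And>i. g i \<in> carrier G"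
  shows "(\<Oplus>i\<in>A. f i \<ominus> g i) = (\<Oplus>i\<in>A. f i) \<ominus> (\<Oplus>i\<in>A. g i)"
  using assms(1)
proof (induction A)
  case (insert a A)
  then show ?case using assms(2,3) by (simp add: Pi_def minus_eq minus_add a_ac)
qed (simp add: minus_eq minus_equality[of \<zero> \<zero>])

lemma (in abelian_group_hom) hom_finsum:
  assumes "finite A" "\<And>i. i \<in> A \<Longrightarrow> f i \<in> carrier G"
  shows "h (\<Oplus>i\<in>A. f i) = (\<Oplus>\<^bsub>H\<^esub>i\<in>A. h (f i))"
  using assms by (induction A) (auto simp: Pi_def)

lemma (in abelian_group_hom) hom_minus:
  "x \<in> carrier G \<Longrightarrow> y \<in> carrier G \<Longrightarrow> h (x \<ominus> y) = h x \<ominus>\<^bsub>H\<^esub> h y"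
  by (simp add: a_minus_def)

lemma abelian_group_hom_intro:
  assumes "abelian_group G" "abelian_group H"
    "\<And>x. x \<in> carrier G \<Longrightarrow> h x \<in> carrier H"
    "\<And>x y. x \<in> carrier G \<Longrightarrow> y \<in> carrier G \<Longrightarrow> h (x \<oplus>\<^bsub>G\<^esub> y) = h x \<oplus>\<^bsub>H\<^esub> h y"
  shows "abelian_group_hom G H h"
  using assms
  by (intro abelian_group_homI group_hom.intro group_hom_axioms.intro)
    (auto simp: abelian_group.a_group hom_def)

text \<open>The operators stand for multiplication by the elements \<open>g k\<close>. The setting
  is instantiated with the ring itself, with its localizations and with the Cech modules, and
  \<open>koszul_hom\<close> moves between them.\<close>

locale group_with_operators = abelian_group G for G (structure) +
  fixes K :: "'k set" and \<gamma> :: "'k \<Rightarrow> 'a \<Rightarrow> 'a"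
  assumes finite_K: "finite K"
    and operator_hom: "abelian_group_hom G G (\<gamma> k)"
    and operator_commute: "x \<in> carrier G \<Longrightarrow> \<gamma> j (\<gamma> k x) = \<gamma> k (\<gamma> j x)"
begin

abbreviation "kd \<equiv> koszul_diff G K \<gamma>"

lemma operator_closed [simp]: "x \<in> carrier G \<Longrightarrow> \<gamma> k x \<in> carrier G"
  using abelian_group_hom.hom_closed[OF operator_hom] .

lemma operator_add [simp]:
  "x \<in> carrier G \<Longrightarrow> y \<in> carrier G \<Longrightarrow> \<gamma> k (x \<oplus> y) = \<gamma> k x \<oplus> \<gamma> k y"
  using abelian_group_hom.hom_add[OF operator_hom] .

lemma operator_neg [simp]: "x \<in> carrier G \<Longrightarrow> \<gamma> k (\<ominus> x) = \<ominus> \<gamma> k x"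
  using abelian_group_hom.hom_a_inv[OF operator_hom] .

lemma operator_zero [simp]: "\<gamma> k \<zero> = \<zero>"
  using abelian_group_hom.hom_zero[OF operator_hom] .

lemma koszul_closed [simp]:
  "(\<And>ls. c ls \<in> carrier G) \<Longrightarrow> kd ks c \<in> carrier G"
  by (induction ks arbitrary: c) (auto simp: Pi_def)

text \<open>Meant for a homogeneous component \<open>H\<close>: the operators raise the degree by
  one, so the assumption concerns \<open>\<gamma> k (c ls)\<close> and not
  \<open>c ls\<close>.\<close>

lemma koszul_closed_in:
  assumes "H \<subseteq> carrier G" "\<zero> \<in> H" and add: "\<And>x y. x \<in> H \<Longrightarrow> y \<in> H \<Longrightarrow> x \<oplus> y \<in> H"
    and neg: "\<And>x. x \<in> H \<Longrightarrow> \<ominus> x \<in> H"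
    and c: "\<And>ls k. length ls = Suc (length ks) \<Longrightarrow> \<gamma> k (c ls) \<in> H"
  shows "kd ks c \<in> H"
proof -
  have sum: "(\<Oplus>k\<in>A. f k) \<in> H" if "finite A" "\<And>k. f k \<in> H" for f :: "'k \<Rightarrow> 'a" and A
    using that assms(1) by (induction A) (auto simp: Pi_def subset_iff assms(2) intro!: add)
  show ?thesis
    using c by (induction ks arbitrary: c) (auto simp: a_minus_def intro!: sum add neg finite_K)
qed

lemma koszul_cong:
  assumes "\<And>ls. length ls = Suc (length ks) \<Longrightarrow> c ls = d ls"
  shows "kd ks c = kd ks d"
  using assms
proof (induction ks arbitrary: c d)
  case (Cons j ks)
  have "kd ks (\<lambda>ls. c (j # ls)) = kd ks (\<lambda>ls. d (j # ls))"
    by (rule Cons.IH) (simp add: Cons.prems)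
  then show ?case using Cons.prems by simp
qed simp

lemma koszul_hom:
  assumes H: "group_with_operators H K \<delta>" and \<phi>: "abelian_group_hom G H \<phi>"
    and eq: "\<And>k x. x \<in> carrier G \<Longrightarrow> \<phi> (\<gamma> k x) = \<delta> k (\<phi> x)"
    and c: "\<And>ls. c ls \<in> carrier G"
  shows "\<phi> (kd ks c) = koszul_diff H K \<delta> ks (\<lambda>ls. \<phi> (c ls))"
proof -
  interpret \<phi>: abelian_group_hom G H \<phi> by fact
  show ?thesis
    using c
    by (induction ks arbitrary: c)
      (simp_all add: \<phi>.hom_finsum[OF finite_K] \<phi>.hom_minus eq Pi_def)
qed

lemma koszul_operator:
  assumes "\<And>ls. c ls \<in> carrier G"
  shows "\<gamma> j (kd ks c) = kd ks (\<lambda>ls. \<gamma> j (c ls))"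
  by (rule koszul_hom[OF group_with_operators_axioms operator_hom operator_commute assms])

lemma koszul_add:
  assumes "\<And>ls. c ls \<in> carrier G" "\<And>ls. d ls \<in> carrier G"
  shows "kd ks (\<lambda>ls. c ls \<oplus> d ls) = kd ks c \<oplus> kd ks d"
  using assms
proof (induction ks arbitrary: c d)
  case Nil
  then show ?case by (simp add: finsum_addf Pi_def)
next
  case (Cons j ks)
  then show ?case by (simp add: finsum_addf Pi_def minus_eq minus_add a_ac)
qed

lemma koszul_zero: "kd ks (\<lambda>ls. \<zero>) = \<zero>"
  using koszul_closed_in[where H = "{\<zero>}" and c = "\<lambda>_. \<zero>" and ks = ks] by simp

lemma koszul_neg:
  assumes "\<And>ls. c ls \<in> carrier G"
  shows "kd ks (\<lambda>ls. \<ominus> c ls) = \<ominus> kd ks c"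
proof -
  have "kd ks (\<lambda>ls. \<ominus> c ls) \<oplus> kd ks c = kd ks (\<lambda>ls. \<ominus> c ls \<oplus> c ls)"
    using assms by (simp add: koszul_add)
  also have "\<dots> = kd ks (\<lambda>ls. \<zero>)" using assms by (simp add: l_neg)
  also have "\<dots> = \<zero>"
    by (rule koszul_zero)
  finally show ?thesis using assms minus_equality by simp
qed

lemma koszul_minus:
  assumes "\<And>ls. c ls \<in> carrier G" "\<And>ls. d ls \<in> carrier G"
  shows "kd ks (\<lambda>ls. c ls \<ominus> d ls) = kd ks c \<ominus> kd ks d"
  using assms by (simp add: minus_eq koszul_add koszul_neg)

lemma koszul_sum:
  assumes "finite A" "\<And>k ls. c k ls \<in> carrier G"
  shows "kd ks (\<lambda>ls. \<Oplus>k\<in>A. c k ls) = (\<Oplus>k\<in>A. kd ks (c k))"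
  using assms(1)
proof (induction A)
  case empty
  show ?case using koszul_zero by simp
next
  case (insert a A)
  then show ?case using assms(2) by (simp add: koszul_add Pi_def)
qed

text \<open>Contracting two adjacent slots gives the same result with the slots exchanged, as the
  operators commute; this is the cancellation that makes the differential square to zero.\<close>

lemma operator_sum_swap:
  assumes "\<And>j k. c j k \<in> carrier G"
  shows "(\<Oplus>k\<in>K. \<gamma> k (\<Oplus>j\<in>K. \<gamma> j (c j k))) = (\<Oplus>k\<in>K. \<gamma> k (\<Oplus>j\<in>K. \<gamma> j (c k j)))"
proof -
  have sum: "\<gamma> k (\<Oplus>j\<in>K. \<gamma> j (d j)) = (\<Oplus>j\<in>K. \<gamma> k (\<gamma> j (d j)))" if "\<And>j. d j \<in> carrier G" for k d
    by (rule abelian_group_hom.hom_finsum[OF operator_hom finite_K]) (simp add: that)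
  have "(\<Oplus>k\<in>K. \<gamma> k (\<Oplus>j\<in>K. \<gamma> j (c j k))) = (\<Oplus>k\<in>K. \<Oplus>j\<in>K. \<gamma> k (\<gamma> j (c j k)))"
    using assms by (simp add: sum)
  also have "\<dots> = (\<Oplus>j\<in>K. \<Oplus>k\<in>K. \<gamma> k (\<gamma> j (c j k)))"
    using assms by (intro finsum_swap[OF finite_K finite_K]) simp
  also have "\<dots> = (\<Oplus>j\<in>K. \<Oplus>k\<in>K. \<gamma> j (\<gamma> k (c j k)))"
    using assms by (intro finsum_cong') (auto simp: Pi_def intro!: finsum_cong' operator_commute)
  also have "\<dots> = (\<Oplus>j\<in>K. \<gamma> j (\<Oplus>k\<in>K. \<gamma> k (c j k)))"
    using assms by (simp add: sum)
  finally show ?thesis .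
qed

lemma koszul_koszul:
  assumes "\<And>ls. c ls \<in> carrier G"
  shows "kd ks (\<lambda>ls. kd ls c) = \<zero>"
  using assms
proof (induction ks arbitrary: c)
  case Nil
  have swap: "(\<Oplus>k\<in>K. \<gamma> k (\<Oplus>j\<in>K. \<gamma> j (c [j, k]))) = (\<Oplus>k\<in>K. \<gamma> k (\<Oplus>j\<in>K. \<gamma> j (c [k, j])))"
    using operator_sum_swap[of "\<lambda>j k. c [j, k]"] Nil by simp
  have "kd [] (\<lambda>ls. kd ls c) =
      (\<Oplus>k\<in>K. \<gamma> k (\<Oplus>j\<in>K. \<gamma> j (c [j, k])) \<ominus> \<gamma> k (\<Oplus>j\<in>K. \<gamma> j (c [k, j])))"
    using Nil by (simp add: minus_eq Pi_def)
  also have "\<dots> = \<zero>"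
    using Nil by (simp add: finsum_minus[OF finite_K] swap Pi_def) (simp add: minus_eq r_neg Pi_def)
  finally show ?case .
next
  case (Cons i ks)
  note c = Cons.prems
  \<comment> \<open>\<open>Y\<close> contracts the two leading slots, \<open>Z\<close> contracts the
    leading slot and one slot beyond \<open>i\<close>. The total is
    \<open>(Y - (Y - Z)) - Z\<close>, where contractions that both lie beyond \<open>i\<close>
    vanish by induction.\<close>
  define Y where "Y = (\<Oplus>k\<in>K. \<gamma> k (\<Oplus>j\<in>K. \<gamma> j (c (k # j # i # ks))))"
  define Z where "Z = (\<Oplus>k\<in>K. \<gamma> k (kd ks (\<lambda>ls. c (k # i # ls))))"
  have YZ: "Y \<in> carrier G" "Z \<in> carrier G" using c by (simp_all add: Y_def Z_def Pi_def)
  have "(\<Oplus>k\<in>K. \<gamma> k (kd (k # i # ks) c)) = (\<Oplus>k\<in>K. \<gamma> k (\<Oplus>j\<in>K. \<gamma> j (c (j # k # i # ks))) \<ominus>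
      (\<gamma> k (\<Oplus>j\<in>K. \<gamma> j (c (k # j # i # ks))) \<ominus> \<gamma> k (kd ks (\<lambda>ls. c (k # i # ls)))))"
    using c by (simp add: minus_eq Pi_def)
  also have "\<dots> = (\<Oplus>k\<in>K. \<gamma> k (\<Oplus>j\<in>K. \<gamma> j (c (j # k # i # ks)))) \<ominus> (Y \<ominus> Z)"
    using c by (simp add: finsum_minus[OF finite_K] Y_def Z_def Pi_def)
  also have "(\<Oplus>k\<in>K. \<gamma> k (\<Oplus>j\<in>K. \<gamma> j (c (j # k # i # ks)))) = Y"
    using operator_sum_swap[of "\<lambda>j k. c (j # k # i # ks)"] c by (simp add: Y_def)
  finally have first: "(\<Oplus>k\<in>K. \<gamma> k (kd (k # i # ks) c)) = Y \<ominus> (Y \<ominus> Z)" .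
  have "kd ks (\<lambda>ls. kd (i # ls) c) =
      kd ks (\<lambda>ls. \<Oplus>k\<in>K. \<gamma> k (c (k # i # ls))) \<ominus> kd ks (\<lambda>ls. kd ls (\<lambda>ls. c (i # ls)))"
    using c by (simp add: koszul_minus Pi_def)
  also have "\<dots> = Z"
    using c YZ by (simp add: Cons.IH koszul_sum[OF finite_K] koszul_operator Z_def minus_eq Pi_def)
  finally show ?case
    using first YZ by (simp add: minus_eq minus_add a_assoc[symmetric] r_neg)
qed

end

text \<open>
  The descending half of the double complex argument: \<open>b\<close> is a chain of elements \<open>b q\<close> of bidegree
  \<open>(q, q)\<close> linked by \<open>\<partial> b (q + 1) = D (b q)\<close>, and \<open>C q d\<close> is the degree \<open>d\<close> part of \<open>L q\<close>.
\<close>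

lemma double_complex_chase:
  fixes L :: "nat \<Rightarrow> ('g, 'z) ring_scheme" and K :: "'k set" and n :: int
    and b :: "nat \<Rightarrow> 'k list \<Rightarrow> 'g"
  assumes L: "\<And>q. group_with_operators (L q) K (\<gamma> q)"
    and D: "\<And>q. abelian_group_hom (L q) (L (Suc q)) (D q)"
    and D_op: "\<And>q k x. x \<in> carrier (L q) \<Longrightarrow> D q (\<gamma> q k x) = \<gamma> (Suc q) k (D q x)"
    and C: "\<And>q d. additive_subgroup (C q d) (L q)"
    and C_op: "\<And>q d k x. x \<in> C q d \<Longrightarrow> \<gamma> q k x \<in> C q (d + 1)"
    and exact_0: "\<And>z. z \<in> C 0 n \<Longrightarrow> D 0 z = \<zero>\<^bsub>L 1\<^esub> \<Longrightarrow> z = \<zero>\<^bsub>L 0\<^esub>"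
    and exact: "\<And>p z. z \<in> C (Suc p) (n - int (Suc p)) \<Longrightarrow> D (Suc p) z = \<zero>\<^bsub>L (Suc (Suc p))\<^esub> \<Longrightarrow>
      \<exists>y\<in>C p (n - int (Suc p)). D p y = z"
    and b: "\<And>q ks. b q ks \<in> carrier (L q)" "\<And>q ks. length ks = q \<Longrightarrow> b q ks \<in> C q (n - int q)"
    and Db: "\<And>q ks. length ks = q \<Longrightarrow> D q (b q ks) = koszul_diff (L (Suc q)) K (\<gamma> (Suc q)) ks (b (Suc q))"
    and bound: "carrier (L (Suc N)) \<subseteq> {\<zero>\<^bsub>L (Suc N)\<^esub>}"
  shows "\<exists>e. (\<forall>k. e k \<in> C 0 (n - 1)) \<and> b 0 [] = (\<Oplus>\<^bsub>L 0\<^esub>k\<in>K. \<gamma> 0 k (e k))"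
proof -
  have L_group: "abelian_group (L q)" for q
    using L[of q] by (simp add: group_with_operators_def)
  \<comment> \<open>\<open>P q\<close> says that \<open>b q\<close> becomes a Cech cocycle after
    subtracting a Koszul boundary of the right degree.\<close>
  define P where "P q \<longleftrightarrow> (\<exists>e. (\<forall>ls. e ls \<in> carrier (L q)) \<and>
    (\<forall>ls. length ls = Suc q \<longrightarrow> e ls \<in> C q (n - int (Suc q))) \<and>
    (\<forall>ks. length ks = q \<longrightarrow>
      D q (b q ks \<ominus>\<^bsub>L q\<^esub> koszul_diff (L q) K (\<gamma> q) ks e) = \<zero>\<^bsub>L (Suc q)\<^esub>))" for q
  have diff_in: "b q ks \<ominus>\<^bsub>L q\<^esub> koszul_diff (L q) K (\<gamma> q) ks e \<in> C q (n - int q)"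
    if ks: "length ks = q" and e: "\<And>ls. length ls = Suc q \<Longrightarrow> e ls \<in> C q (n - int (Suc q))" for q ks e
  proof -
    interpret L: group_with_operators "L q" K "\<gamma> q" by (rule L)
    interpret C: additive_subgroup "C q (n - int q)" "L q" by (rule C)
    have "\<gamma> q k (e ls) \<in> C q (n - int q)" if "length ls = Suc (length ks)" for ls k
      using C_op[OF e[of ls], of k] that ks by simp
    then have "koszul_diff (L q) K (\<gamma> q) ks e \<in> C q (n - int q)"
      by (intro L.koszul_closed_in) (auto simp: C.a_subset C.zero_closed C.a_closed C.a_inv_closed)
    then show ?thesis using b(2)[OF ks] by (simp add: a_minus_def)
  qed
  \<comment> \<open>At the top the zero chain suffices, because \<open>L (Suc N)\<close> is
    trivial.\<close>
  have "P N"
  proof -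
    interpret L: group_with_operators "L N" K "\<gamma> N" by (rule L)
    interpret D: abelian_group_hom "L N" "L (Suc N)" "D N" by (rule D)
    have "D N (b N ks \<ominus>\<^bsub>L N\<^esub> koszul_diff (L N) K (\<gamma> N) ks (\<lambda>_. \<zero>\<^bsub>L N\<^esub>)) = \<zero>\<^bsub>L (Suc N)\<^esub>" for ks
    proof -
      have "koszul_diff (L N) K (\<gamma> N) ks (\<lambda>_. \<zero>\<^bsub>L N\<^esub>) \<in> carrier (L N)"
        by (rule L.koszul_closed) simp
      then show ?thesis using bound D.hom_closed L.minus_closed[OF b(1)] by blast
    qed
    then show ?thesis
      unfolding P_def
      by (intro exI[of _ "\<lambda>_. \<zero>\<^bsub>L N\<^esub>"]) (auto simp: additive_subgroup.zero_closed[OF C])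
  qed
  \<comment> \<open>The corrected \<open>b (q + 1)\<close> is a cocycle and lifts along
    \<open>D\<close> to \<open>f\<close>. Then \<open>D\<close> maps the Koszul boundary of
    \<open>f\<close> to that of \<open>b (q + 1)\<close>, since the boundary of a boundary vanishes,
    and this equals \<open>D (b q)\<close>.\<close>
  moreover have "P q" if PS: "P (Suc q)" for q
  proof -
    interpret L: group_with_operators "L q" K "\<gamma> q" by (rule L)
    interpret L': group_with_operators "L (Suc q)" K "\<gamma> (Suc q)" by (rule L)
    interpret D: abelian_group_hom "L q" "L (Suc q)" "D q" by (rule D)
    obtain e' where e'_props: "(\<forall>ls. e' ls \<in> carrier (L (Suc q))) \<and>
        (\<forall>ls. length ls = Suc (Suc q) \<longrightarrow> e' ls \<in> C (Suc q) (n - int (Suc (Suc q)))) \<and>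
        (\<forall>ks. length ks = Suc q \<longrightarrow>
          D (Suc q) (b (Suc q) ks \<ominus>\<^bsub>L (Suc q)\<^esub> L'.kd ks e') = \<zero>\<^bsub>L (Suc (Suc q))\<^esub>)"
      using PS unfolding P_def by blast
    then have e': "\<And>ls. e' ls \<in> carrier (L (Suc q))"
      "\<And>ls. length ls = Suc (Suc q) \<Longrightarrow> e' ls \<in> C (Suc q) (n - int (Suc (Suc q)))"
      and De': "\<And>ks. length ks = Suc q \<Longrightarrow>
        D (Suc q) (b (Suc q) ks \<ominus>\<^bsub>L (Suc q)\<^esub> L'.kd ks e') = \<zero>\<^bsub>L (Suc (Suc q))\<^esub>"
      by iprover+
    have "\<forall>ls. \<exists>y. length ls = Suc q \<longrightarrow>
        y \<in> C q (n - int (Suc q)) \<and> D q y = b (Suc q) ls \<ominus>\<^bsub>L (Suc q)\<^esub> L'.kd ls e'"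
    proof
      fix ls :: "'k list"
      show "\<exists>y. length ls = Suc q \<longrightarrow>
        y \<in> C q (n - int (Suc q)) \<and> D q y = b (Suc q) ls \<ominus>\<^bsub>L (Suc q)\<^esub> L'.kd ls e'"
      proof (cases "length ls = Suc q")
        case True
        show ?thesis
          using exact[OF diff_in[OF True e'(2)] De'[OF True]] by auto
      qed simp
    qed
    from choice[OF this] obtain f
      where f: "\<And>ls. length ls = Suc q \<Longrightarrow> f ls \<in> C q (n - int (Suc q))"
        and Df: "\<And>ls. length ls = Suc q \<Longrightarrow> D q (f ls) = b (Suc q) ls \<ominus>\<^bsub>L (Suc q)\<^esub> L'.kd ls e'"
      by blast
    \<comment> \<open>Lifts exist only for words of the right length; zero elsewhere keeps all
      values in the carrier.\<close>
    define e where "e ls = (if length ls = Suc q then f ls else \<zero>\<^bsub>L q\<^esub>)" for ls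
    have e: "e ls \<in> carrier (L q)" for ls
      using f additive_subgroup.a_Hcarr[OF C] by (auto simp: e_def)
    have "D q (b q ks \<ominus>\<^bsub>L q\<^esub> L.kd ks e) = \<zero>\<^bsub>L (Suc q)\<^esub>" if ks: "length ks = q" for ks
    proof -
      have "D q (L.kd ks e) = L'.kd ks (\<lambda>ls. D q (e ls))"
        by (rule L.koszul_hom[OF L D D_op e])
      also have "\<dots> = L'.kd ks (\<lambda>ls. b (Suc q) ls \<ominus>\<^bsub>L (Suc q)\<^esub> L'.kd ls e')"
        by (rule L'.koszul_cong) (simp add: e_def ks Df)
      also have "\<dots> = L'.kd ks (b (Suc q)) \<ominus>\<^bsub>L (Suc q)\<^esub> L'.kd ks (\<lambda>ls. L'.kd ls e')"
        using b(1) e'(1) by (simp add: L'.koszul_minus)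
      also have "\<dots> = D q (b q ks)"
        using b(1) e'(1) ks by (simp add: L'.koszul_koszul Db a_minus_def)
      finally show ?thesis
        using b(1) e by (simp add: D.hom_minus L'.minus_eq L'.r_neg)
    qed
    then show ?thesis
      unfolding P_def using e f by (intro exI[of _ e]) (auto simp: e_def)
  qed
  ultimately have "P 0"
    by (rule inc_induct[of 0 N P, OF le0])
  then obtain e where e: "\<And>ls. e ls \<in> carrier (L 0)"
    "\<And>ls. length ls = Suc 0 \<Longrightarrow> e ls \<in> C 0 (n - int (Suc 0))"
    "D 0 (b 0 [] \<ominus>\<^bsub>L 0\<^esub> koszul_diff (L 0) K (\<gamma> 0) [] e) = \<zero>\<^bsub>L (Suc 0)\<^esub>"
    unfolding P_def by auto
  interpret L: group_with_operators "L 0" K "\<gamma> 0" by (rule L)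
  have "b 0 [] \<ominus>\<^bsub>L 0\<^esub> L.kd [] e = \<zero>\<^bsub>L 0\<^esub>"
  proof (rule exact_0)
    show "b 0 [] \<ominus>\<^bsub>L 0\<^esub> L.kd [] e \<in> C 0 n"
      using diff_in[of "[]" 0 e, OF list.size(3) e(2)] by simp
    show "D 0 (b 0 [] \<ominus>\<^bsub>L 0\<^esub> L.kd [] e) = \<zero>\<^bsub>L 1\<^esub>"
      unfolding One_nat_def by (rule e(3))
  qed
  then have "b 0 [] = L.kd [] e"
    using L.eq_if_minus_eq_zero[of "b 0 []" "L.kd [] e", OF b(1) L.koszul_closed[of e "[]", OF e(1)]] by blast
  then show ?thesis using e(2) by (intro exI[of _ "\<lambda>k. e [k]"]) simp
qed

section \<open>Localization at one element\<close>

definition loc_act :: "('s, 'x) ring_scheme \<Rightarrow> 's \<Rightarrow> 's \<Rightarrow> ('s \<times> nat) set \<Rightarrow> ('s \<times> nat) set" where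
  "loc_act S f c U = (\<Union>(s, k)\<in>U. loc_frac S f (c \<otimes>\<^bsub>S\<^esub> s) k)"

lemma (in cring) pow_pow_mult:
  "f \<in> carrier R \<Longrightarrow> s \<in> carrier R \<Longrightarrow> f [^] (a::nat) \<otimes> (f [^] (b::nat) \<otimes> s) = f [^] (a + b) \<otimes> s"
  by (simp add: m_assoc[symmetric] nat_pow_mult)

lemma (in cring) pow_shift:
  assumes "f \<in> carrier R" "s \<in> carrier R" "t \<in> carrier R"
    "f [^] (a::nat) \<otimes> s = f [^] (b::nat) \<otimes> t"
  shows "f [^] (c + a :: nat) \<otimes> s = f [^] (c + b) \<otimes> t"
  using assms by (metis pow_pow_mult)

locale localization = cring S for S (structure) +
  fixes f assumes f [simp]: "f \<in> carrier S"
begin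

abbreviation "fr \<equiv> loc_frac S f"
abbreviation "Loc \<equiv> loc_ring S f"

lemma mem_frac:
  assumes "s \<in> carrier S"
  shows "(t, l) \<in> fr s k \<longleftrightarrow> t \<in> carrier S \<and> (\<exists>m::nat. f [^] (m + l) \<otimes> s = f [^] (m + k) \<otimes> t)"
  using assms by (auto simp: loc_frac_def pow_pow_mult)

lemma frac_self: "s \<in> carrier S \<Longrightarrow> (s, k) \<in> fr s k"
  by (auto simp: mem_frac)

lemma frac_cong:
  assumes s: "s \<in> carrier S" and t: "t \<in> carrier S"
    and eq: "f [^] (m + l :: nat) \<otimes> s = f [^] (m + k) \<otimes> t"
  shows "fr s k = fr t l"
proof -
  have "fr s k \<subseteq> fr t l" if s: "s \<in> carrier S" and t: "t \<in> carrier S"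
    and eq: "f [^] (m + l :: nat) \<otimes> s = f [^] (m + k) \<otimes> t" for s t k l
  proof (clarify)
    fix u j assume "(u, j) \<in> fr s k"
    then obtain a :: nat where u: "u \<in> carrier S" and a: "f [^] (a + j) \<otimes> s = f [^] (a + k) \<otimes> u"
      using s by (auto simp: mem_frac)
    \<comment> \<open>The exponent \<open>m + a + k\<close> is the common surplus after eliminating
      \<open>s\<close> from the two equations.\<close>
    have "f [^] ((m + a + k) + j) \<otimes> t = f [^] ((a + j) + (m + k)) \<otimes> t" by (simp add: add_ac)
    also have "\<dots> = f [^] ((a + j) + (m + l)) \<otimes> s"
      using pow_shift[OF f s t eq, of "a + j"] by simp
    also have "\<dots> = f [^] ((m + l) + (a + j)) \<otimes> s" by (simp add: add_ac)
    also have "\<dots> = f [^] ((m + l) + (a + k)) \<otimes> u"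
      using pow_shift[OF f s u a] .
    also have "\<dots> = f [^] ((m + a + k) + l) \<otimes> u" by (simp add: add_ac)
    finally show "(u, j) \<in> fr t l" using u t by (auto simp: mem_frac)
  qed
  from this[OF s t eq] this[OF t s eq[symmetric]] show ?thesis by blast
qed

lemma frac_eq_iff:
  assumes "s \<in> carrier S" "t \<in> carrier S"
  shows "fr s k = fr t l \<longleftrightarrow> (\<exists>m::nat. f [^] (m + l) \<otimes> s = f [^] (m + k) \<otimes> t)"
proof
  assume "fr s k = fr t l"
  then have "(t, l) \<in> fr s k" using frac_self[OF assms(2)] by simp
  then show "\<exists>m::nat. f [^] (m + l) \<otimes> s = f [^] (m + k) \<otimes> t" using assms by (simp add: mem_frac)
qed (use frac_cong assms in blast)

lemma frac_eq_iff_same: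
  assumes "s \<in> carrier S" "t \<in> carrier S"
  shows "fr s k = fr t k \<longleftrightarrow> (\<exists>m::nat. f [^] m \<otimes> s = f [^] m \<otimes> t)"
proof -
  have "\<exists>l::nat. f [^] (l + k) \<otimes> s = f [^] (l + k) \<otimes> t" if "f [^] m \<otimes> s = f [^] m \<otimes> t" for m :: nat
    using pow_shift[OF f assms that, of k] by (metis add.commute)
  then show ?thesis using assms by (auto simp: frac_eq_iff)
qed

lemma frac_expand: "s \<in> carrier S \<Longrightarrow> fr (f [^] j \<otimes> s) (j + k) = fr s k"
  by (rule frac_cong[where m = 0]) (auto simp: pow_pow_mult add_ac)

text \<open>Operations on fractions are unions over representatives; if the value is constant on a
  class, the union collapses to that value.\<close>

lemma frac_UN:
  assumes "s \<in> carrier S" "\<And>t l. (t, l) \<in> fr s k \<Longrightarrow> G t l = G s k"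
  shows "(\<Union>(t, l)\<in>fr s k. G t l) = G s k"
proof -
  have "(\<Union>(t, l)\<in>fr s k. G t l) = (\<Union>z\<in>fr s k. G s k)" using assms(2) by fastforce
  also have "\<dots> = G s k" using frac_self[OF assms(1)] by blast
  finally show ?thesis .
qed

lemma loc_add_frac:
  assumes s: "s \<in> carrier S" and t: "t \<in> carrier S"
  shows "loc_add S f (fr s k) (fr t l) = fr (f [^] l \<otimes> s \<oplus> f [^] k \<otimes> t) (k + l)"
proof -
  let ?F = "\<lambda>s k t l. fr (f [^] (l::nat) \<otimes> s \<oplus> f [^] (k::nat) \<otimes> t) (k + l)"
  have F: "?F s' k' t' l' = ?F s k t l" if st: "(s', k') \<in> fr s k" "(t', l') \<in> fr t l" for s' k' t' l'
  proof -
    obtain a b :: nat where s': "s' \<in> carrier S" and a: "f [^] (a + k') \<otimes> s = f [^] (a + k) \<otimes> s'"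
      and t': "t' \<in> carrier S" and b: "f [^] (b + l') \<otimes> t = f [^] (b + l) \<otimes> t'"
      using st s t by (auto simp: mem_frac)
    have 1: "f [^] ((a + b) + (k' + l') + l) \<otimes> s = f [^] ((a + b) + (k + l) + l') \<otimes> s'"
      using pow_shift[OF f s s' a, of "b + l' + l"] by (simp add: add_ac)
    have 2: "f [^] ((a + b) + (k' + l') + k) \<otimes> t = f [^] ((a + b) + (k + l) + k') \<otimes> t'"
      using pow_shift[OF f t t' b, of "a + k' + k"] by (simp add: add_ac)
    show ?thesis
      by (rule frac_cong[where m = "a + b", symmetric])
        (use s t s' t' 1 2 in \<open>simp_all add: r_distr pow_pow_mult\<close>)
  qed
  have "loc_add S f (fr s k) (fr t l) = (\<Union>(s', k')\<in>fr s k. ?F s' k' t l)"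
    unfolding loc_add_def
  proof (rule SUP_cong[OF refl], clarify)
    fix s' k' assume s': "(s', k') \<in> fr s k"
    show "(\<Union>(t', l')\<in>fr t l. ?F s' k' t' l') = ?F s' k' t l"
      by (rule frac_UN[OF t]) (metis F s' frac_self[OF t])
  qed
  also have "\<dots> = ?F s k t l"
    by (rule frac_UN[OF s]) (rule F[OF _ frac_self[OF t]])
  finally show ?thesis .
qed

lemma loc_add_frac_same:
  assumes s: "s \<in> carrier S" and t: "t \<in> carrier S"
  shows "fr s k \<oplus>\<^bsub>Loc\<^esub> fr t k = fr (s \<oplus> t) k"
proof -
  have "fr s k \<oplus>\<^bsub>Loc\<^esub> fr t k = fr (f [^] k \<otimes> (s \<oplus> t)) (k + k)"
    using s t by (simp add: loc_ring_def loc_add_frac r_distr)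
  then show ?thesis using frac_expand[of "s \<oplus> t" k k] s t by simp
qed

lemma carrier_Loc: "carrier Loc = {fr s k | s k. s \<in> carrier S}"
  by (simp add: loc_ring_def loc_carrier_def)

lemma frac_closed [simp]: "s \<in> carrier S \<Longrightarrow> fr s k \<in> carrier Loc"
  by (auto simp: carrier_Loc)

lemma zero_Loc: "\<zero>\<^bsub>Loc\<^esub> = fr \<zero> k"
proof -
  have "fr \<zero> 0 = fr \<zero> k" by (rule frac_cong[where m = 0]) auto
  then show ?thesis by (simp add: loc_ring_def)
qed

lemma LocE:
  assumes "x \<in> carrier Loc"
  obtains s k where "s \<in> carrier S" "x = fr s k"
  using assms by (auto simp: carrier_Loc)

lemma common_denominator:
  assumes "x \<in> carrier Loc" "y \<in> carrier Loc"
  obtains s t k where "s \<in> carrier S" "t \<in> carrier S" "x = fr s k" "y = fr t k"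
proof -
  obtain s k where x: "s \<in> carrier S" "x = fr s k" using assms(1) by (rule LocE)
  obtain t l where y: "t \<in> carrier S" "y = fr t l" using assms(2) by (rule LocE)
  show ?thesis
    by (rule that[of "f [^] l \<otimes> s" "f [^] k \<otimes> t" "l + k"])
      (use x y frac_expand[of s l k] frac_expand[of t k l] in \<open>simp_all add: add.commute\<close>)
qed

lemma Loc_group: "abelian_group Loc"
proof (rule abelian_groupI)
  fix x y assume "x \<in> carrier Loc" "y \<in> carrier Loc"
  then obtain s t k where "s \<in> carrier S" "t \<in> carrier S" "x = fr s k" "y = fr t k"
    by (rule common_denominator)
  then show "x \<oplus>\<^bsub>Loc\<^esub> y \<in> carrier Loc" "x \<oplus>\<^bsub>Loc\<^esub> y = y \<oplus>\<^bsub>Loc\<^esub> x"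
    by (simp_all add: loc_add_frac_same a_comm)
next
  fix x y z assume x: "x \<in> carrier Loc" and "y \<in> carrier Loc" "z \<in> carrier Loc"
  from this(2,3) obtain t u k where y: "t \<in> carrier S" "y = fr t k" and z: "u \<in> carrier S" "z = fr u k"
    by (rule common_denominator)
  obtain s j where s: "s \<in> carrier S" "x = fr s j" using x by (rule LocE)
  have "x = fr (f [^] k \<otimes> s) (j + k)" "y = fr (f [^] j \<otimes> t) (j + k)" "z = fr (f [^] j \<otimes> u) (j + k)"
    using s y z frac_expand[of s k j] frac_expand[of t j k] frac_expand[of u j k] by (simp_all add: add.commute)
  then show "x \<oplus>\<^bsub>Loc\<^esub> y \<oplus>\<^bsub>Loc\<^esub> z = x \<oplus>\<^bsub>Loc\<^esub> (y \<oplus>\<^bsub>Loc\<^esub> z)"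
    using s y z by (simp add: loc_add_frac_same a_assoc)
next
  show "\<zero>\<^bsub>Loc\<^esub> \<in> carrier Loc" by (simp add: zero_Loc[of 0])
  fix x assume "x \<in> carrier Loc"
  then obtain s k where x: "s \<in> carrier S" "x = fr s k" by (rule LocE)
  show "\<zero>\<^bsub>Loc\<^esub> \<oplus>\<^bsub>Loc\<^esub> x = x" using x by (simp add: zero_Loc[of k] loc_add_frac_same)
  show "\<exists>y\<in>carrier Loc. y \<oplus>\<^bsub>Loc\<^esub> x = \<zero>\<^bsub>Loc\<^esub>"
    by (rule bexI[of _ "fr (\<ominus> s) k"]) (use x in \<open>simp_all add: loc_add_frac_same zero_Loc[of k] l_neg\<close>)
qed

lemma minus_frac: "s \<in> carrier S \<Longrightarrow> \<ominus>\<^bsub>Loc\<^esub> fr s k = fr (\<ominus> s) k"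
  by (rule abelian_group.minus_equality[OF Loc_group]) (simp_all add: loc_add_frac_same zero_Loc[of k] l_neg)

lemma finsum_frac:
  assumes "finite A" "\<And>i. i \<in> A \<Longrightarrow> g i \<in> carrier S"
  shows "(\<Oplus>\<^bsub>Loc\<^esub>i\<in>A. fr (g i) k) = fr (\<Oplus>i\<in>A. g i) k"
proof -
  interpret Loc: abelian_group Loc by (rule Loc_group)
  show ?thesis
    using assms
    by (induction A) (simp_all add: zero_Loc[of k] loc_add_frac_same Pi_def)
qed

lemma loc_act_frac:
  assumes "c \<in> carrier S" "s \<in> carrier S"
  shows "loc_act S f c (fr s k) = fr (c \<otimes> s) k"
  unfolding loc_act_def
proof (rule frac_UN[OF assms(2)])
  fix t l assume "(t, l) \<in> fr s k"
  then obtain m :: nat where t: "t \<in> carrier S" and m: "f [^] (m + l) \<otimes> s = f [^] (m + k) \<otimes> t"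
    using assms by (auto simp: mem_frac)
  have "f [^] (m + l) \<otimes> (c \<otimes> s) = f [^] (m + k) \<otimes> (c \<otimes> t)"
    using m assms t by (simp add: m_lcomm)
  then show "fr (c \<otimes> t) l = fr (c \<otimes> s) k"
    using assms t by (metis frac_cong m_closed)
qed

lemma loc_act_hom:
  assumes c: "c \<in> carrier S" shows "abelian_group_hom Loc Loc (loc_act S f c)"
proof (rule abelian_group_hom_intro[OF Loc_group Loc_group])
  show "loc_act S f c x \<in> carrier Loc" if x: "x \<in> carrier Loc" for x
    by (rule LocE[OF x]) (use c in \<open>simp add: loc_act_frac\<close>)
  show "loc_act S f c (x \<oplus>\<^bsub>Loc\<^esub> y) = loc_act S f c x \<oplus>\<^bsub>Loc\<^esub> loc_act S f c y"
    if x: "x \<in> carrier Loc" and y: "y \<in> carrier Loc" for x y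
    by (rule common_denominator[OF x y]) (use c in \<open>simp add: loc_act_frac loc_add_frac_same r_distr\<close>)
qed

lemma loc_act_commute:
  assumes "c \<in> carrier S" "d \<in> carrier S" and x: "x \<in> carrier Loc"
  shows "loc_act S f c (loc_act S f d x) = loc_act S f d (loc_act S f c x)"
  by (rule LocE[OF x]) (use assms in \<open>simp add: loc_act_frac m_lcomm\<close>)

text \<open>With \<open>h = g f\<close> the fraction \<open>s / f^k\<close> becomes
  \<open>g^k s / h^k\<close>; the exponent is kept.\<close>

lemma loc_map_frac:
  assumes g: "g \<in> carrier S" and s: "s \<in> carrier S" and h: "h = g \<otimes> f"
  shows "loc_map S g h (fr s k) = loc_frac S h (g [^] k \<otimes> s) k"
  unfolding loc_map_def
proof (rule frac_UN[OF s])
  interpret H: localization S h by unfold_locales (use g h in simp)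
  fix t l assume "(t, l) \<in> fr s k"
  then obtain m :: nat where t: "t \<in> carrier S" and m: "f [^] (m + l) \<otimes> s = f [^] (m + k) \<otimes> t"
    using s by (auto simp: mem_frac)
  have hp: "h [^] (a::nat) \<otimes> (g [^] (b::nat) \<otimes> u) = g [^] (a + b) \<otimes> (f [^] a \<otimes> u)" if "u \<in> carrier S" for a b u
    using g that by (simp add: h nat_pow_distrib m_ac nat_pow_mult[symmetric])
  have "h [^] (m + l) \<otimes> (g [^] k \<otimes> s) = h [^] (m + k) \<otimes> (g [^] l \<otimes> t)"
    using m g s t by (simp add: hp add_ac)
  then show "loc_frac S h (g [^] l \<otimes> t) l = loc_frac S h (g [^] k \<otimes> s) k"
    using g s t by (intro H.frac_cong[symmetric]) auto
qed

lemma loc_map_hom: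
  assumes g: "g \<in> carrier S" and h: "h = g \<otimes> f"
  shows "abelian_group_hom Loc (loc_ring S h) (loc_map S g h)"
proof -
  interpret H: localization S h by unfold_locales (use g h in simp)
  show ?thesis
  proof (rule abelian_group_hom_intro[OF Loc_group H.Loc_group])
    show "loc_map S g h x \<in> carrier H.Loc" if x: "x \<in> carrier Loc" for x
      by (rule LocE[OF x]) (use g in \<open>simp add: loc_map_frac[OF g _ h]\<close>)
    show "loc_map S g h (x \<oplus>\<^bsub>Loc\<^esub> y) = loc_map S g h x \<oplus>\<^bsub>H.Loc\<^esub> loc_map S g h y"
      if x: "x \<in> carrier Loc" and y: "y \<in> carrier Loc" for x y
      by (rule common_denominator[OF x y])
        (use g in \<open>simp add: loc_map_frac[OF g _ h] loc_add_frac_same H.loc_add_frac_same r_distr\<close>)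
  qed
qed

lemma loc_map_act:
  assumes g: "g \<in> carrier S" and h: "h = g \<otimes> f" and c: "c \<in> carrier S" and x: "x \<in> carrier Loc"
  shows "loc_map S g h (loc_act S f c x) = loc_act S h c (loc_map S g h x)"
proof -
  interpret H: localization S h by unfold_locales (use g h in simp)
  show ?thesis
    by (rule LocE[OF x]) (use g c in \<open>simp add: loc_map_frac[OF g _ h] loc_act_frac H.loc_act_frac m_lcomm\<close>)
qed

end

section \<open>The Cech complex\<close>

locale graded_ring = cring S for S (structure) +
  fixes gr :: "int \<Rightarrow> 'a set"
  assumes gr_subgroup: "additive_subgroup (gr n) S"
    and gr_mult: "x \<in> gr m \<Longrightarrow> y \<in> gr n \<Longrightarrow> x \<otimes> y \<in> gr (m + n)"
    and gr_one: "\<one> \<in> gr 0"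

locale cech_complex = graded_ring S gr for S (structure) and gr +
  fixes fs :: "'a list"
  assumes fs: "set fs \<subseteq> gr 1"

text \<open>The operators \<open>cech_act\<close> raise the degree, so the chase needs one ambient
  group containing the carriers of all \<open>cech_group S gr fs q d\<close>. A ring record gives
  access to additive notation and \<open>finsum\<close>.\<close>

definition cech_total ::
    "('s, 'x) ring_scheme \<Rightarrow> 's list \<Rightarrow> nat \<Rightarrow> (nat set \<Rightarrow> ('s \<times> nat) set) ring" where
  "cech_total S fs q =
     \<lparr> carrier = (\<Pi>\<^sub>E A\<in>cech_index fs q. carrier (loc_ring S (cech_elem S fs A))),
       monoid.mult = undefined,
       one = undefined,
       zero = (\<lambda>A\<in>cech_index fs q. \<zero>\<^bsub>loc_ring S (cech_elem S fs A)\<^esub>),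
       add = (\<lambda>c c'. \<lambda>A\<in>cech_index fs q. c A \<oplus>\<^bsub>loc_ring S (cech_elem S fs A)\<^esub> c' A) \<rparr>"

definition cech_act ::
    "('s, 'x) ring_scheme \<Rightarrow> 's list \<Rightarrow> nat \<Rightarrow> 's \<Rightarrow> (nat set \<Rightarrow> ('s \<times> nat) set) \<Rightarrow> nat set \<Rightarrow> ('s \<times> nat) set" where
  "cech_act S fs q g c = (\<lambda>A\<in>cech_index fs q. loc_act S (cech_elem S fs A) g (c A))"

definition cech_term ::
    "('s, 'x) ring_scheme \<Rightarrow> 's list \<Rightarrow> (nat set \<Rightarrow> ('s \<times> nat) set) \<Rightarrow> nat set \<Rightarrow> nat \<Rightarrow> ('s \<times> nat) set" where
  "cech_term S fs c B i =
     (let y = loc_map S (fs ! i) (cech_elem S fs B) (c (B - {i}))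
      in if even (card {l\<in>B. l < i}) then y else \<ominus>\<^bsub>loc_ring S (cech_elem S fs B)\<^esub> y)"

lemma cech_diff_eq:
  "cech_diff S fs q c =
     (\<lambda>B\<in>cech_index fs (Suc q). \<Oplus>\<^bsub>loc_ring S (cech_elem S fs B)\<^esub>i\<in>B. cech_term S fs c B i)"
  unfolding cech_diff_def cech_term_def ..

lemma cech_indexD:
  assumes "A \<in> cech_index fs q"
  shows "finite A" "A \<subseteq> {..<length fs}" "card A = q" "\<And>i. i \<in> A \<Longrightarrow> i < length fs"
  using assms finite_subset by (auto simp: cech_index_def)

lemma cech_index_Diff:
  assumes "B \<in> cech_index fs (Suc q)" "i \<in> B"
  shows "B - {i} \<in> cech_index fs q"
  using assms cech_indexD(1)[OF assms(1)] by (auto simp: cech_index_def)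

lemma cech_index_0: "cech_index fs 0 = {{}}"
  by (auto simp: cech_index_def card_eq_0_iff dest: finite_subset)

context graded_ring
begin

lemma gr_closed:
  "x \<in> gr n \<Longrightarrow> x \<in> carrier S" "\<zero> \<in> gr n"
  "x \<in> gr n \<Longrightarrow> y \<in> gr n \<Longrightarrow> x \<oplus> y \<in> gr n" "x \<in> gr n \<Longrightarrow> \<ominus> x \<in> gr n"
proof -
  interpret additive_subgroup "gr n" S by (rule gr_subgroup)
  show "x \<in> gr n \<Longrightarrow> x \<in> carrier S" "\<zero> \<in> gr n"
    "x \<in> gr n \<Longrightarrow> y \<in> gr n \<Longrightarrow> x \<oplus> y \<in> gr n" "x \<in> gr n \<Longrightarrow> \<ominus> x \<in> gr n"
    by auto
qed

lemma gr_pow: "x \<in> gr (int d) \<Longrightarrow> x [^] (k::nat) \<in> gr (int (d * k))"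
proof (induction k)
  case (Suc k)
  then show ?case using gr_mult[of "x [^] k" "int (d * k)" x "int d"] by (simp add: algebra_simps)
qed (simp add: gr_one)

lemma loc_component_subgroup:
  assumes fd: "f \<in> gr (int d)"
  shows "loc_component S gr f d n \<subseteq> carrier (loc_ring S f)"
    and "\<zero>\<^bsub>loc_ring S f\<^esub> \<in> loc_component S gr f d n"
    and "x \<in> loc_component S gr f d n \<Longrightarrow> y \<in> loc_component S gr f d n \<Longrightarrow>
      x \<oplus>\<^bsub>loc_ring S f\<^esub> y \<in> loc_component S gr f d n"
    and "x \<in> loc_component S gr f d n \<Longrightarrow> \<ominus>\<^bsub>loc_ring S f\<^esub> x \<in> loc_component S gr f d n"
    and "g \<in> gr m \<Longrightarrow> x \<in> loc_component S gr f d n \<Longrightarrow> loc_act S f g x \<in> loc_component S gr f d (n + m)"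
proof -
  interpret localization S f by unfold_locales (use fd gr_closed in auto)
  show "loc_component S gr f d n \<subseteq> carrier (loc_ring S f)"
    using gr_closed(1) by (auto simp: loc_component_def)
  show "\<zero>\<^bsub>loc_ring S f\<^esub> \<in> loc_component S gr f d n"
    using gr_closed(2) zero_Loc[of 0] by (auto simp: loc_component_def)
  show "x \<oplus>\<^bsub>loc_ring S f\<^esub> y \<in> loc_component S gr f d n"
    if x: "x \<in> loc_component S gr f d n" and y: "y \<in> loc_component S gr f d n"
  proof -
    obtain s k where s: "s \<in> gr (n + int (d * k))" "x = fr s k" using x by (auto simp: loc_component_def)
    obtain t l where t: "t \<in> gr (n + int (d * l))" "y = fr t l" using y by (auto simp: loc_component_def)
    have "f [^] l \<otimes> s \<in> gr (n + int (d * (k + l)))" "f [^] k \<otimes> t \<in> gr (n + int (d * (k + l)))"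
      using gr_mult[OF gr_pow[OF fd] s(1), of l] gr_mult[OF gr_pow[OF fd] t(1), of k]
      by (simp_all add: algebra_simps)
    then have "f [^] l \<otimes> s \<oplus> f [^] k \<otimes> t \<in> gr (n + int (d * (k + l)))" by (rule gr_closed(3))
    moreover have "x \<oplus>\<^bsub>loc_ring S f\<^esub> y = fr (f [^] l \<otimes> s \<oplus> f [^] k \<otimes> t) (k + l)"
      using loc_add_frac[of s t k l] s t gr_closed(1) by (simp add: loc_ring_def)
    ultimately show ?thesis unfolding loc_component_def by blast
  qed
  show "\<ominus>\<^bsub>loc_ring S f\<^esub> x \<in> loc_component S gr f d n" if x: "x \<in> loc_component S gr f d n"
  proof -
    obtain s k where s: "s \<in> gr (n + int (d * k))" "x = fr s k" using x by (auto simp: loc_component_def)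
    then have "\<ominus>\<^bsub>loc_ring S f\<^esub> x = fr (\<ominus> s) k" using minus_frac gr_closed(1) by simp
    then show ?thesis using gr_closed(4)[OF s(1)] unfolding loc_component_def by blast
  qed
  show "loc_act S f g x \<in> loc_component S gr f d (n + m)"
    if g: "g \<in> gr m" and x: "x \<in> loc_component S gr f d n"
  proof -
    obtain s k where s: "s \<in> gr (n + int (d * k))" "x = fr s k" using x by (auto simp: loc_component_def)
    then have "loc_act S f g x = fr (g \<otimes> s) k" using loc_act_frac g gr_closed(1) by simp
    moreover have "g \<otimes> s \<in> gr (n + m + int (d * k))"
      using gr_mult[OF g s(1)] by (simp add: algebra_simps)
    ultimately show ?thesis unfolding loc_component_def by blast
  qed
qed

end

context cech_complex
begin

abbreviation "E A \<equiv> cech_elem S fs A"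
abbreviation "LA A \<equiv> loc_ring S (E A)"
abbreviation "L q \<equiv> cech_total S fs q"
abbreviation "D q \<equiv> cech_diff S fs q"

lemma fs_gr: "i < length fs \<Longrightarrow> fs ! i \<in> gr 1"
  using fs by auto

lemma fs_carrier: "i < length fs \<Longrightarrow> fs ! i \<in> carrier S"
  using fs_gr gr_closed(1) by blast

lemma cech_elem_insert:
  assumes "finite A" "i \<notin> A" "insert i A \<subseteq> {..<length fs}"
  shows "E (insert i A) = fs ! i \<otimes> E A"
  unfolding cech_elem_def using assms fs_carrier by (intro finprod_insert) auto

lemma cech_elem_gr:
  assumes "finite A" "A \<subseteq> {..<length fs}"
  shows "E A \<in> gr (int (card A))"
  using assms
proof (induction A)
  case empty
  show ?case by (simp add: cech_elem_def gr_one)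
next
  case (insert i A)
  then show ?case using gr_mult[OF fs_gr, of i "E A" "int (card A)"] by (simp add: cech_elem_insert)
qed

lemma cech_elem_index: "A \<in> cech_index fs q \<Longrightarrow> E A \<in> gr (int q)"
  using cech_elem_gr cech_indexD by metis

lemma loc: "A \<in> cech_index fs q \<Longrightarrow> localization S (E A)"
  by unfold_locales (use cech_elem_index gr_closed(1) in blast)

lemma LA_group: "A \<in> cech_index fs q \<Longrightarrow> abelian_group (LA A)"
  by (rule localization.Loc_group[OF loc])

lemma cech_elem_Diff:
  assumes "B \<in> cech_index fs (Suc q)" "i \<in> B"
  shows "E B = fs ! i \<otimes> E (B - {i})"
  using cech_elem_insert[of "B - {i}" i] cech_indexD[OF assms(1)] assms(2) by (simp add: insert_absorb)

lemma L_simps: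
  "carrier (L q) = (\<Pi>\<^sub>E A\<in>cech_index fs q. carrier (LA A))"
  "\<zero>\<^bsub>L q\<^esub> = (\<lambda>A\<in>cech_index fs q. \<zero>\<^bsub>LA A\<^esub>)"
  "c \<oplus>\<^bsub>L q\<^esub> c' = (\<lambda>A\<in>cech_index fs q. c A \<oplus>\<^bsub>LA A\<^esub> c' A)"
  by (simp_all add: cech_total_def)

lemma L_mem: "x \<in> carrier (L q) \<Longrightarrow> A \<in> cech_index fs q \<Longrightarrow> x A \<in> carrier (LA A)"
  by (auto simp: L_simps)

lemma L_group: "abelian_group (L q)"
proof (rule abelian_groupI)
  fix x y assume x: "x \<in> carrier (L q)" and y: "y \<in> carrier (L q)"
  show "x \<oplus>\<^bsub>L q\<^esub> y \<in> carrier (L q)"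
    using x y by (auto simp: L_simps intro!: abelian_groupE(1)[OF LA_group])
  show "x \<oplus>\<^bsub>L q\<^esub> y = y \<oplus>\<^bsub>L q\<^esub> x"
    unfolding L_simps(3)
    by (rule restrict_ext) (rule abelian_groupE(4)[OF LA_group L_mem[OF x] L_mem[OF y]])
next
  fix x y z assume x: "x \<in> carrier (L q)" and y: "y \<in> carrier (L q)" and z: "z \<in> carrier (L q)"
  show "x \<oplus>\<^bsub>L q\<^esub> y \<oplus>\<^bsub>L q\<^esub> z = x \<oplus>\<^bsub>L q\<^esub> (y \<oplus>\<^bsub>L q\<^esub> z)"
    unfolding L_simps(3)
  proof (rule restrict_ext)
    fix A assume A: "A \<in> cech_index fs q"
    show "(\<lambda>A\<in>cech_index fs q. x A \<oplus>\<^bsub>LA A\<^esub> y A) A \<oplus>\<^bsub>LA A\<^esub> z A =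
        x A \<oplus>\<^bsub>LA A\<^esub> (\<lambda>A\<in>cech_index fs q. y A \<oplus>\<^bsub>LA A\<^esub> z A) A"
      using abelian_groupE(3)[OF LA_group[OF A] L_mem[OF x A] L_mem[OF y A] L_mem[OF z A]] A by simp
  qed
next
  show "\<zero>\<^bsub>L q\<^esub> \<in> carrier (L q)" by (auto simp: L_simps intro!: abelian_groupE(2)[OF LA_group])
  fix x assume x: "x \<in> carrier (L q)"
  show "\<zero>\<^bsub>L q\<^esub> \<oplus>\<^bsub>L q\<^esub> x = x"
  proof
    fix A
    show "(\<zero>\<^bsub>L q\<^esub> \<oplus>\<^bsub>L q\<^esub> x) A = x A"
    proof (cases "A \<in> cech_index fs q")
      case True
      then show ?thesis
        using abelian_groupE(5)[OF LA_group[OF True] L_mem[OF x True]] by (simp add: L_simps(2,3))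
    next
      case False
      then show ?thesis using PiE_arb[OF x[unfolded L_simps(1)] False] by (simp add: L_simps(3))
    qed
  qed
  show "\<exists>y\<in>carrier (L q). y \<oplus>\<^bsub>L q\<^esub> x = \<zero>\<^bsub>L q\<^esub>"
  proof (rule bexI)
    show "(\<lambda>A\<in>cech_index fs q. \<ominus>\<^bsub>LA A\<^esub> x A) \<in> carrier (L q)"
      using x by (auto simp: L_simps intro!: abelian_group.a_inv_closed[OF LA_group])
    show "(\<lambda>A\<in>cech_index fs q. \<ominus>\<^bsub>LA A\<^esub> x A) \<oplus>\<^bsub>L q\<^esub> x = \<zero>\<^bsub>L q\<^esub>"
      unfolding L_simps(2,3)
      by (rule restrict_ext) (simp add: abelian_group.l_neg[OF LA_group L_mem[OF x]])
  qed
qed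

lemma eval_hom: "A \<in> cech_index fs q \<Longrightarrow> abelian_group_hom (L q) (LA A) (\<lambda>c. c A)"
  by (rule abelian_group_hom_intro[OF L_group LA_group]) (auto simp: L_simps)

lemma cech_act_hom:
  assumes g: "g \<in> carrier S" shows "abelian_group_hom (L q) (L q) (cech_act S fs q g)"
proof (rule abelian_group_hom_intro[OF L_group L_group])
  note act = localization.loc_act_hom[OF loc g]
  show "cech_act S fs q g x \<in> carrier (L q)" if "x \<in> carrier (L q)" for x
    using that by (auto simp: L_simps cech_act_def intro!: abelian_group_hom.hom_closed[OF act])
  show "cech_act S fs q g (x \<oplus>\<^bsub>L q\<^esub> y) = cech_act S fs q g x \<oplus>\<^bsub>L q\<^esub> cech_act S fs q g y"
    if "x \<in> carrier (L q)" "y \<in> carrier (L q)" for x y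
    unfolding cech_act_def L_simps(3)
  proof (rule restrict_ext)
    fix A assume A: "A \<in> cech_index fs q"
    show "loc_act S (E A) g ((\<lambda>A\<in>cech_index fs q. x A \<oplus>\<^bsub>LA A\<^esub> y A) A) =
        (\<lambda>A\<in>cech_index fs q. loc_act S (E A) g (x A)) A \<oplus>\<^bsub>LA A\<^esub>
        (\<lambda>A\<in>cech_index fs q. loc_act S (E A) g (y A)) A"
      using abelian_group_hom.hom_add[OF act[OF A] L_mem[OF that(1) A] L_mem[OF that(2) A]] A by simp
  qed
qed

lemma L_operators:
  assumes "finite K" "\<And>k. g k \<in> carrier S"
  shows "group_with_operators (L q) K (\<lambda>k. cech_act S fs q (g k))"
proof (intro group_with_operators.intro[OF L_group] group_with_operators_axioms.intro)
  show "finite K" by fact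
  show "abelian_group_hom (L q) (L q) (cech_act S fs q (g k))" for k by (rule cech_act_hom) fact
  show "cech_act S fs q (g j) (cech_act S fs q (g k) x) = cech_act S fs q (g k) (cech_act S fs q (g j) x)"
    if "x \<in> carrier (L q)" for x j k
    unfolding cech_act_def
    by (rule restrict_ext) (simp add: localization.loc_act_commute[OF loc assms(2) assms(2) L_mem[OF that]])
qed

lemma LA_operators:
  assumes "finite K" "\<And>k. g k \<in> carrier S" "A \<in> cech_index fs q"
  shows "group_with_operators (LA A) K (\<lambda>k. loc_act S (E A) (g k))"
  using assms localization.loc_act_hom[OF loc[OF assms(3)]] localization.loc_act_commute[OF loc[OF assms(3)]]
  by (intro group_with_operators.intro[OF LA_group] group_with_operators_axioms.intro) auto

lemma cech_term_hom:
  assumes B: "B \<in> cech_index fs (Suc q)" and i: "i \<in> B"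
  shows "abelian_group_hom (L q) (LA B) (\<lambda>c. cech_term S fs c B i)"
proof -
  note A = cech_index_Diff[OF B i] and BE = cech_elem_Diff[OF B i]
  have fi: "fs ! i \<in> carrier S" using cech_indexD(4)[OF B i] fs_carrier by blast
  interpret LB: abelian_group "LA B" by (rule LA_group[OF B])
  interpret m: abelian_group_hom "LA (B - {i})" "LA B" "loc_map S (fs ! i) (E B)"
    by (rule localization.loc_map_hom[OF loc[OF A] fi BE])
  have c: "c (B - {i}) \<in> carrier (LA (B - {i}))" if "c \<in> carrier (L q)" for c
    using that A by (auto simp: L_simps)
  show ?thesis
  proof (rule abelian_group_hom_intro[OF L_group LA_group[OF B]])
    show "cech_term S fs x B i \<in> carrier (LA B)" if "x \<in> carrier (L q)" for x
      using c[OF that] by (simp add: cech_term_def Let_def)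
    show "cech_term S fs (x \<oplus>\<^bsub>L q\<^esub> y) B i = cech_term S fs x B i \<oplus>\<^bsub>LA B\<^esub> cech_term S fs y B i"
      if "x \<in> carrier (L q)" "y \<in> carrier (L q)" for x y
      using c[OF that(1)] c[OF that(2)] A
      by (simp add: cech_term_def Let_def L_simps(3) LB.minus_add)
  qed
qed

lemma cech_term_act:
  assumes B: "B \<in> cech_index fs (Suc q)" and i: "i \<in> B" and g: "g \<in> carrier S"
    and c: "c \<in> carrier (L q)"
  shows "cech_term S fs (cech_act S fs q g c) B i = loc_act S (E B) g (cech_term S fs c B i)"
proof -
  note A = cech_index_Diff[OF B i] and BE = cech_elem_Diff[OF B i]
  have fi: "fs ! i \<in> carrier S" using cech_indexD(4)[OF B i] fs_carrier by blast
  interpret m: abelian_group_hom "LA (B - {i})" "LA B" "loc_map S (fs ! i) (E B)"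
    by (rule localization.loc_map_hom[OF loc[OF A] fi BE])
  interpret a: abelian_group_hom "LA B" "LA B" "loc_act S (E B) g"
    by (rule localization.loc_act_hom[OF loc[OF B] g])
  have c': "c (B - {i}) \<in> carrier (LA (B - {i}))" using c A by (auto simp: L_simps)
  show ?thesis
    using localization.loc_map_act[OF loc[OF A] fi BE g c'] A c'
    by (simp add: cech_term_def Let_def cech_act_def)
qed

lemma cech_diff_hom: "abelian_group_hom (L q) (L (Suc q)) (D q)"
proof (rule abelian_group_hom_intro[OF L_group L_group])
  have t: "cech_term S fs x B i \<in> carrier (LA B)"
    if "x \<in> carrier (L q)" "B \<in> cech_index fs (Suc q)" "i \<in> B" for x B i
    using abelian_group_hom.hom_closed[OF cech_term_hom[OF that(2,3)] that(1)] .
  show "D q x \<in> carrier (L (Suc q))" if x: "x \<in> carrier (L q)" for x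
    using t[OF x]
    by (auto simp: cech_diff_eq L_simps(1)
        intro!: abelian_monoid.finsum_closed[OF abelian_group.axioms(1)[OF LA_group]])
  show "D q (x \<oplus>\<^bsub>L q\<^esub> y) = D q x \<oplus>\<^bsub>L (Suc q)\<^esub> D q y"
    if x: "x \<in> carrier (L q)" and y: "y \<in> carrier (L q)" for x y
    unfolding cech_diff_eq L_simps(3)[where q = "Suc q"]
  proof (rule restrict_ext)
    fix B assume B: "B \<in> cech_index fs (Suc q)"
    interpret LB: abelian_group "LA B" by (rule LA_group[OF B])
    have "(\<Oplus>\<^bsub>LA B\<^esub>i\<in>B. cech_term S fs (x \<oplus>\<^bsub>L q\<^esub> y) B i) =
        (\<Oplus>\<^bsub>LA B\<^esub>i\<in>B. cech_term S fs x B i \<oplus>\<^bsub>LA B\<^esub> cech_term S fs y B i)"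
      using abelian_group_hom.hom_add[OF cech_term_hom[OF B] x y] t[OF x B] t[OF y B]
      by (intro LB.finsum_cong') auto
    also have "\<dots> = (\<Oplus>\<^bsub>LA B\<^esub>i\<in>B. cech_term S fs x B i) \<oplus>\<^bsub>LA B\<^esub> (\<Oplus>\<^bsub>LA B\<^esub>i\<in>B. cech_term S fs y B i)"
      using t[OF x B] t[OF y B] by (intro LB.finsum_addf) auto
    finally show "(\<Oplus>\<^bsub>LA B\<^esub>i\<in>B. cech_term S fs (x \<oplus>\<^bsub>L q\<^esub> y) B i) =
        (\<lambda>B\<in>cech_index fs (Suc q). \<Oplus>\<^bsub>LA B\<^esub>i\<in>B. cech_term S fs x B i) B \<oplus>\<^bsub>LA B\<^esub>
        (\<lambda>B\<in>cech_index fs (Suc q). \<Oplus>\<^bsub>LA B\<^esub>i\<in>B. cech_term S fs y B i) B"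
      using B by simp
  qed
qed

lemma cech_diff_act:
  assumes g: "g \<in> carrier S" and c: "c \<in> carrier (L q)"
  shows "D q (cech_act S fs q g c) = cech_act S fs (Suc q) g (D q c)"
  unfolding cech_diff_eq cech_act_def[of S fs "Suc q"]
proof (rule restrict_ext)
  fix B assume B: "B \<in> cech_index fs (Suc q)"
  interpret LB: abelian_group "LA B" by (rule LA_group[OF B])
  interpret a: abelian_group_hom "LA B" "LA B" "loc_act S (E B) g"
    by (rule localization.loc_act_hom[OF loc[OF B] g])
  have t: "cech_term S fs c B i \<in> carrier (LA B)" if "i \<in> B" for i
    using abelian_group_hom.hom_closed[OF cech_term_hom[OF B that] c] .
  have "(\<Oplus>\<^bsub>LA B\<^esub>i\<in>B. cech_term S fs (cech_act S fs q g c) B i) =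
      (\<Oplus>\<^bsub>LA B\<^esub>i\<in>B. loc_act S (E B) g (cech_term S fs c B i))"
    using cech_term_act[OF B _ g c] t by (intro LB.finsum_cong') auto
  also have "\<dots> = loc_act S (E B) g (\<Oplus>\<^bsub>LA B\<^esub>i\<in>B. cech_term S fs c B i)"
    using t cech_indexD(1)[OF B] by (intro a.hom_finsum[symmetric]) auto
  finally show "(\<Oplus>\<^bsub>LA B\<^esub>i\<in>B. cech_term S fs (cech_act S fs q g c) B i) =
      loc_act S (E B) g ((\<lambda>B\<in>cech_index fs (Suc q). \<Oplus>\<^bsub>LA B\<^esub>i\<in>B. cech_term S fs c B i) B)"
    using B by simp
qed

abbreviation "C q d \<equiv> carrier (cech_group S gr fs q d)"

lemma C_eq: "C q d = (\<Pi>\<^sub>E A\<in>cech_index fs q. loc_component S gr (E A) q d)"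
  by (simp add: cech_group_def)

lemma C_subgroup: "additive_subgroup (C q d) (L q)"
proof -
  interpret L: abelian_group "L q" by (rule L_group)
  note comp = loc_component_subgroup[OF cech_elem_index]
  have sub: "C q d \<subseteq> carrier (L q)" using comp(1) by (force simp: C_eq L_simps)
  show ?thesis
  proof (rule additive_subgroup.intro, rule L.add.subgroupI)
    show "C q d \<subseteq> carrier (L q)" by (rule sub)
    have "\<zero>\<^bsub>L q\<^esub> \<in> C q d" using comp(2) by (auto simp: C_eq L_simps)
    then show "C q d \<noteq> {}" by blast
    show "x \<oplus>\<^bsub>L q\<^esub> y \<in> C q d" if "x \<in> C q d" "y \<in> C q d" for x y
      using that comp(3) by (auto simp: C_eq L_simps PiE_iff)
    show "\<ominus>\<^bsub>L q\<^esub> x \<in> C q d" if x: "x \<in> C q d" for x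
    proof -
      have "(\<ominus>\<^bsub>L q\<^esub> x) A = \<ominus>\<^bsub>LA A\<^esub> x A" if "A \<in> cech_index fs q" for A
        using abelian_group_hom.hom_a_inv[OF eval_hom[OF that]] x sub by blast
      moreover have "\<ominus>\<^bsub>L q\<^esub> x \<in> extensional (cech_index fs q)"
        using L.a_inv_closed[of x] x sub by (auto simp: L_simps PiE_def)
      ultimately show ?thesis using x comp(4) by (auto simp: C_eq PiE_iff)
    qed
  qed
qed

lemma C_act: "g \<in> gr m \<Longrightarrow> x \<in> C q d \<Longrightarrow> cech_act S fs q g x \<in> C q (d + m)"
  using loc_component_subgroup(5)[OF cech_elem_index] by (auto simp: C_eq cech_act_def PiE_iff)

text \<open>In the trivial quotient the coset of \<open>z\<close> is the set of coboundaries itself;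
  it contains \<open>0 + z\<close> because zero is a coboundary.\<close>

lemma cocycle_is_coboundary:
  assumes H: "carrier (local_cohomology S gr fs q d) = {\<one>\<^bsub>local_cohomology S gr fs q d\<^esub>}"
    and z: "z \<in> C q d" "D q z = \<zero>\<^bsub>L (Suc q)\<^esub>"
  shows "z \<in> cech_coboundaries S gr fs q d"
proof -
  let ?G = "(cech_group S gr fs q d)\<lparr>carrier := cech_cocycles S gr fs q d\<rparr>"
  let ?B = "cech_coboundaries S gr fs q d"
  have one: "\<one>\<^bsub>cech_group S gr fs q e\<^esub> = \<zero>\<^bsub>L q\<^esub>" for q e
    by (simp add: cech_group_def L_simps)
  have zero: "\<zero>\<^bsub>L q\<^esub> \<in> ?B"
  proof (cases q)
    case 0
    then show ?thesis by (simp add: cech_coboundaries_def one)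
  next
    case (Suc p)
    interpret d: abelian_group_hom "L p" "L (Suc p)" "D p" by (rule cech_diff_hom)
    have "D p \<zero>\<^bsub>L p\<^esub> = \<zero>\<^bsub>L (Suc p)\<^esub>" by (rule d.hom_zero)
    moreover have "\<zero>\<^bsub>L p\<^esub> \<in> C p d" by (rule additive_subgroup.zero_closed[OF C_subgroup])
    ultimately show ?thesis unfolding Suc cech_coboundaries_def by (auto intro!: image_eqI)
  qed
  have "z \<in> cech_cocycles S gr fs q d"
    using z by (simp add: cech_cocycles_def kernel_def one)
  then have "?B #>\<^bsub>?G\<^esub> z \<in> carrier (local_cohomology S gr fs q d)"
    unfolding local_cohomology_def FactGroup_def RCOSETS_def by auto
  then have "?B #>\<^bsub>?G\<^esub> z = ?B"
    unfolding H by (simp add: local_cohomology_def FactGroup_def)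
  moreover have "\<zero>\<^bsub>L q\<^esub> \<oplus>\<^bsub>L q\<^esub> z \<in> ?B #>\<^bsub>?G\<^esub> z"
  proof -
    have "\<zero>\<^bsub>L q\<^esub> \<otimes>\<^bsub>?G\<^esub> z = \<zero>\<^bsub>L q\<^esub> \<oplus>\<^bsub>L q\<^esub> z" by (simp add: cech_group_def L_simps(3))
    then show ?thesis using zero unfolding r_coset_def by blast
  qed
  moreover have "\<zero>\<^bsub>L q\<^esub> \<oplus>\<^bsub>L q\<^esub> z = z"
    using abelian_groupE(5)[OF L_group] additive_subgroup.a_subset[OF C_subgroup] z(1) by blast
  ultimately show ?thesis by simp
qed

end

text \<open>This is the coefficient at the word \<open>ks\<close> of the tensor product, over the
  indices in the list, of the vectors with coordinates \<open>v i k\<close>, multiplied by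
  \<open>a\<close>. The values at lists of unequal length merely stay inside the carrier.\<close>

primrec koszul_word ::
    "('s, 'x) ring_scheme \<Rightarrow> 's \<Rightarrow> (nat \<Rightarrow> 'k \<Rightarrow> 's) \<Rightarrow> nat list \<Rightarrow> 'k list \<Rightarrow> 's" where
  "koszul_word S a v [] ks = a"
| "koszul_word S a v (i # is) ks =
     (case ks of [] \<Rightarrow> a | k # ks' \<Rightarrow> v i k \<otimes>\<^bsub>S\<^esub> koszul_word S a v is ks')"

lemma sorted_list_of_set_insert_min:
  fixes b :: "'a :: linorder"
  assumes "finite B" "\<And>x. x \<in> B \<Longrightarrow> b < x"
  shows "sorted_list_of_set (insert b B) = b # sorted_list_of_set B"
proof -
  have "b \<notin> B" using assms(2) by blast
  then have "sorted_list_of_set (insert b B) = insort b (sorted_list_of_set B)"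
    using assms(1) by simp
  also have "\<dots> = b # sorted_list_of_set B"
    by (rule insort_is_Cons) (use assms in \<open>auto intro: less_imp_le\<close>)
  finally show ?thesis .
qed

lemma (in abelian_group) finsum_neg:
  assumes "finite A" "\<And>i. i \<in> A \<Longrightarrow> f i \<in> carrier G"
  shows "\<ominus> (\<Oplus>i\<in>A. f i) = (\<Oplus>i\<in>A. \<ominus> f i)"
  using assms by (induction A) (auto simp: Pi_def minus_add minus_equality[of \<zero> \<zero>])

context cring
begin

lemma mult_hom: "c \<in> carrier R \<Longrightarrow> abelian_group_hom R R (\<lambda>x. c \<otimes> x)"
  by (rule abelian_group_hom_intro[OF abelian_group_axioms abelian_group_axioms]) (auto simp: r_distr)

lemma mult_operators:
  assumes "finite K" "\<And>k. g k \<in> carrier R"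
  shows "group_with_operators R K (\<lambda>k x. g k \<otimes> x)"
  using assms mult_hom
  by (intro group_with_operators.intro[OF abelian_group_axioms] group_with_operators_axioms.intro)
    (auto simp: m_lcomm)

lemma koszul_word_closed:
  assumes "a \<in> carrier R" "\<And>i k. v i k \<in> carrier R"
  shows "koszul_word R a v is ks \<in> carrier R"
  using assms by (induction "is" arbitrary: ks) (auto split: list.split)

text \<open>
  With \<open>F i = \<Sum>\<^sub>k g k v i k\<close>, contracting the word of \<open>B\<close> in the slot of \<open>i\<close> replaces \<open>v i\<close> by \<open>F i\<close>;
  the slot of \<open>i\<close> is the number of elements of \<open>B\<close> below \<open>i\<close>, which gives the Cech signs.
\<close>

lemma koszul_diff_word:
  fixes K :: "'k set"
  assumes K: "finite K" and g: "\<And>k. g k \<in> carrier R" and a: "a \<in> carrier R"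
    and v: "\<And>i k. v i k \<in> carrier R"
    and "finite B" "\<And>i. i \<in> B \<Longrightarrow> (\<Oplus>k\<in>K. g k \<otimes> v i k) = F i"
    and "Suc (length ks) = card B"
  shows "koszul_diff R K (\<lambda>k x. g k \<otimes> x) ks (koszul_word R a v (sorted_list_of_set B)) =
    (\<Oplus>i\<in>B. if even (card {l \<in> B. l < i}) then F i \<otimes> koszul_word R a v (sorted_list_of_set (B - {i})) ks
      else \<ominus> (F i \<otimes> koszul_word R a v (sorted_list_of_set (B - {i})) ks))"
  using assms(5-7)
proof (induction B arbitrary: ks rule: finite_linorder_min_induct)
  case empty
  then show ?case by simp
next
  case (insert b B)
  let ?w = "koszul_word R a v"
  let ?sl = sorted_list_of_set
  interpret K: group_with_operators R K "\<lambda>k x. g k \<otimes> x" by (rule mult_operators[OF K g])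
  have w [simp]: "?w is ks \<in> carrier R" for "is" ks by (rule koszul_word_closed[OF a v])
  have F: "F i \<in> carrier R" if "i \<in> insert b B" for i
    using finsum_closed[of "\<lambda>k. g k \<otimes> v i k" K] insert.prems(1)[OF that] g v by auto
  have b: "b \<notin> B" using insert.hyps(2) by blast
  have sl: "?sl (insert b B) = b # ?sl B"
    using insert.hyps(1,2) by (intro sorted_list_of_set_insert_min) auto
  have sl_B: "?sl (insert b B - {i}) = b # ?sl (B - {i})" if "i \<in> B" for i
  proof -
    have "insert b B - {i} = insert b (B - {i})" using that b by blast
    then show ?thesis
      using insert.hyps(1,2) sorted_list_of_set_insert_min[of "B - {i}" b] by simp
  qed
  have head: "(\<Oplus>k\<in>K. g k \<otimes> (v b k \<otimes> x)) = F b \<otimes> x" if x: "x \<in> carrier R" for x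
  proof -
    have "(\<Oplus>k\<in>K. g k \<otimes> (v b k \<otimes> x)) = (\<Oplus>k\<in>K. (g k \<otimes> v b k) \<otimes> x)"
      using g v x by (intro finsum_cong') (auto simp: m_assoc)
    also have "\<dots> = (\<Oplus>k\<in>K. g k \<otimes> v b k) \<otimes> x"
      using g v x K by (intro finsum_ldistr[symmetric]) auto
    finally show ?thesis using insert.prems(1)[of b] by simp
  qed
  show ?case
  proof (cases ks)
    case Nil
    then have "B = {}" using insert.prems(2) insert.hyps(1) b by simp
    moreover have c0: "card {l. l = b \<and> l < b} = 0" by (rule card_eq_0_iff[THEN iffD2]) auto
    ultimately show ?thesis using Nil sl head[OF a] a F by (simp add: Pi_def c0)
  next
    case (Cons j ks')
    have len: "Suc (length ks') = card B" using insert.prems(2) insert.hyps(1) b Cons by simp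
    define t where "t i = (if even (card {l \<in> B. l < i}) then F i \<otimes> ?w (?sl (B - {i})) ks'
      else \<ominus> (F i \<otimes> ?w (?sl (B - {i})) ks'))" for i
    have t: "t i \<in> carrier R" if "i \<in> B" for i using F that by (simp add: t_def)
    have "K.kd ks (?w (?sl (insert b B))) = F b \<otimes> ?w (?sl B) ks \<ominus> K.kd ks' (\<lambda>ls. v b j \<otimes> ?w (?sl B) ls)"
      unfolding Cons sl by (simp add: head)
    also have "K.kd ks' (\<lambda>ls. v b j \<otimes> ?w (?sl B) ls) = v b j \<otimes> K.kd ks' (?w (?sl B))"
      by (rule K.koszul_hom[symmetric, OF K.group_with_operators_axioms mult_hom])
        (use v g in \<open>simp_all add: m_lcomm\<close>)
    also have "K.kd ks' (?w (?sl B)) = (\<Oplus>i\<in>B. t i)"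
      unfolding t_def by (rule insert.IH[OF _ len]) (simp add: insert.prems(1))
    also have "v b j \<otimes> (\<Oplus>i\<in>B. t i) = (\<Oplus>i\<in>B. v b j \<otimes> t i)"
      using t v insert.hyps(1) by (intro finsum_rdistr) auto
    finally have lhs: "K.kd ks (?w (?sl (insert b B))) =
        F b \<otimes> ?w (?sl B) ks \<oplus> (\<Oplus>i\<in>B. \<ominus> (v b j \<otimes> t i))"
      using t v insert.hyps(1) by (simp add: minus_eq finsum_neg)
    define u where "u i = (if even (card {l \<in> insert b B. l < i})
      then F i \<otimes> ?w (?sl (insert b B - {i})) ks
      else \<ominus> (F i \<otimes> ?w (?sl (insert b B - {i})) ks))" for i
    have u: "u i \<in> carrier R" if "i \<in> insert b B" for i using F[OF that] by (simp add: u_def)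
    have c0: "card {l. (l = b \<or> l \<in> B) \<and> l < b} = 0"
      using insert.hyps(2) by (intro card_eq_0_iff[THEN iffD2]) fastforce
    have u_b: "u b = F b \<otimes> ?w (?sl B) ks" unfolding u_def using b by (simp add: c0)
    have u_B: "u i = \<ominus> (v b j \<otimes> t i)" if i: "i \<in> B" for i
    proof -
      \<comment> \<open>The minimal \<open>b\<close> precedes every other index, so all slots move
        up by one; this is the sign in the recursion of \<open>koszul_diff\<close>.\<close>
      have "{l \<in> insert b B. l < i} = insert b {l \<in> B. l < i}" using insert.hyps(2) i by auto
      then have "card {l \<in> insert b B. l < i} = Suc (card {l \<in> B. l < i})"
        using insert.hyps(1) b by simp
      then show ?thesis
        using F[of i] i v by (simp add: u_def t_def sl_B Cons m_lcomm r_minus)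
    qed
    have "(\<Oplus>i\<in>insert b B. u i) = u b \<oplus> (\<Oplus>i\<in>B. u i)"
      using u insert.hyps(1) b by (intro finsum_insert) auto
    also have "(\<Oplus>i\<in>B. u i) = (\<Oplus>i\<in>B. \<ominus> (v b j \<otimes> t i))"
      using u_B t v by (intro finsum_cong') auto
    finally show ?thesis using lhs u_b unfolding u_def by simp
  qed
qed

end

section \<open>Comparison of the Cech and Koszul differentials\<close>

context cech_complex
begin

abbreviation "sl \<equiv> sorted_list_of_set :: nat set \<Rightarrow> nat list"

text \<open>On \<open>A\<close> this is \<open>a\<close> times the tensor product of the vectors
  \<open>v i / f_i^e\<close> for \<open>i\<close> in \<open>A\<close>. When \<open>f_i^e\<close> is
  the combination of the \<open>g k\<close> with coefficients \<open>v i k\<close>, each such vector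
  contracts to 1.\<close>

definition word_cochain :: "'a \<Rightarrow> (nat \<Rightarrow> 'k \<Rightarrow> 'a) \<Rightarrow> nat \<Rightarrow> nat \<Rightarrow> 'k list \<Rightarrow> nat set \<Rightarrow> ('a \<times> nat) set" where
  "word_cochain a v e q ks =
     (\<lambda>A\<in>cech_index fs q. loc_frac S (E A) (koszul_word S a v (sl A) ks) e)"

lemma word_cochain_closed:
  assumes a: "a \<in> carrier S" and v: "\<And>i k. v i k \<in> carrier S"
  shows "word_cochain a v e q ks \<in> carrier (L q)"
  using localization.frac_closed[OF loc koszul_word_closed[OF a v]]
  by (auto simp: word_cochain_def L_simps)

lemma koszul_word_gr:
  assumes "a \<in> gr n" "\<And>i k. v i k \<in> gr (int r)" "length ks = length is"
  shows "koszul_word S a v is ks \<in> gr (n + int (r * length is))"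
  using assms(3)
proof (induction "is" arbitrary: ks)
  case Nil
  then show ?case by (simp add: assms(1))
next
  case (Cons i "is")
  then obtain k ks' where ks: "ks = k # ks'" "length ks' = length is" by (cases ks) auto
  then show ?case
    using gr_mult[OF assms(2)[of i k] Cons.IH[OF ks(2)]] by (simp add: algebra_simps)
qed

text \<open>The numerator has degree \<open>n + r q\<close> and the denominator
  \<open>q (r + 1)\<close>, hence the degree \<open>n - q\<close>.\<close>

lemma word_cochain_gr:
  assumes "a \<in> gr n" "\<And>i k. v i k \<in> gr (int r)" "length ks = q"
  shows "word_cochain a v (Suc r) q ks \<in> C q (n - int q)"
proof -
  have "loc_frac S (E A) (koszul_word S a v (sl A) ks) (Suc r) \<in> loc_component S gr (E A) q (n - int q)"
    if A: "A \<in> cech_index fs q" for A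
  proof -
    have "length (sl A) = q" using cech_indexD[OF A] by simp
    then have "koszul_word S a v (sl A) ks \<in> gr ((n - int q) + int (q * Suc r))"
      using koszul_word_gr[of a n v r ks "sl A"] assms by (simp add: algebra_simps)
    then show ?thesis unfolding loc_component_def by blast
  qed
  then show ?thesis by (auto simp: C_eq word_cochain_def)
qed

text \<open>Contracting the slot of \<open>i\<close> in the word of \<open>B\<close> replaces
  \<open>v i\<close> by \<open>f_i^e\<close>, and \<open>f_i^e w / E_B^e\<close> is the image of the
  fraction for \<open>B - {i}\<close>. So both differentials have the same terms, with the same
  signs.\<close>

lemma cech_diff_word_cochain:
  fixes K :: "'k set"
  assumes K: "finite K" and g: "\<And>k. g k \<in> carrier S" and a: "a \<in> carrier S"
    and v: "\<And>i k. v i k \<in> carrier S"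
    and F: "\<And>i. i < length fs \<Longrightarrow> (\<Oplus>k\<in>K. g k \<otimes> v i k) = fs ! i [^] e"
    and ks: "length ks = q"
  shows "D q (word_cochain a v e q ks) =
    koszul_diff (L (Suc q)) K (\<lambda>k. cech_act S fs (Suc q) (g k)) ks (word_cochain a v e (Suc q))"
    (is "_ = ?R")
proof (rule PiE_ext)
  note b = word_cochain_closed[OF a v]
  interpret LK: group_with_operators "L (Suc q)" K "\<lambda>k. cech_act S fs (Suc q) (g k)"
    by (rule L_operators[OF K g])
  show "D q (word_cochain a v e q ks) \<in> (\<Pi>\<^sub>E A\<in>cech_index fs (Suc q). carrier (LA A))"
    using abelian_group_hom.hom_closed[OF cech_diff_hom b] by (simp add: L_simps)
  show "?R \<in> (\<Pi>\<^sub>E A\<in>cech_index fs (Suc q). carrier (LA A))"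
    using LK.koszul_closed[OF b] by (simp add: L_simps)
  fix B assume B: "B \<in> cech_index fs (Suc q)"
  note BD = cech_indexD[OF B]
  interpret B: localization S "E B" by (rule loc[OF B])
  interpret LB: abelian_group "LA B" by (rule LA_group[OF B])
  let ?w = "koszul_word S a v"
  have w: "?w is ks \<in> carrier S" for "is" ks by (rule koszul_word_closed[OF a v])
  define u where "u i = (if even (card {l \<in> B. l < i}) then fs ! i [^] e \<otimes> ?w (sl (B - {i})) ks
      else \<ominus> (fs ! i [^] e \<otimes> ?w (sl (B - {i})) ks))" for i
  have fsc: "fs ! i [^] e \<in> carrier S" if "i \<in> B" for i using BD(4)[OF that] fs_carrier by simp
  have u: "u i \<in> carrier S" if "i \<in> B" for i using fsc[OF that] w by (simp add: u_def)
  have term_eq: "cech_term S fs (word_cochain a v e q ks) B i = B.fr (u i) e" if i: "i \<in> B" for i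
  proof -
    note A = cech_index_Diff[OF B i]
    have fi: "fs ! i \<in> carrier S" using BD(4)[OF i] fs_carrier by simp
    have "loc_map S (fs ! i) (E B) (word_cochain a v e q ks (B - {i})) =
        B.fr (fs ! i [^] e \<otimes> ?w (sl (B - {i})) ks) e"
      using localization.loc_map_frac[OF loc[OF A] fi w cech_elem_Diff[OF B i]] A
      by (simp add: word_cochain_def)
    then show ?thesis
      using fsc[OF i] w by (simp add: cech_term_def Let_def u_def B.minus_frac)
  qed
  have "D q (word_cochain a v e q ks) B = (\<Oplus>\<^bsub>LA B\<^esub>i\<in>B. B.fr (u i) e)"
    unfolding cech_diff_eq using B term_eq u
    by (simp, intro LB.finsum_cong') auto
  also have "\<dots> = B.fr (\<Oplus>i\<in>B. u i) e"
    using u BD(1) by (intro B.finsum_frac)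
  also have "(\<Oplus>i\<in>B. u i) = koszul_diff S K (\<lambda>k x. g k \<otimes> x) ks (?w (sl B))"
    unfolding u_def
    by (rule koszul_diff_word[symmetric, OF K g a v BD(1)]) (use F BD ks in auto)
  also have "B.fr \<dots> e = koszul_diff (LA B) K (\<lambda>k. loc_act S (E B) (g k)) ks (\<lambda>ls. B.fr (?w (sl B) ls) e)"
  proof (rule group_with_operators.koszul_hom[OF mult_operators[OF K g] LA_operators[OF K g B]])
    show "abelian_group_hom S (LA B) (\<lambda>s. B.fr s e)"
      by (rule abelian_group_hom_intro[OF abelian_group_axioms LA_group[OF B]])
        (simp_all add: B.loc_add_frac_same)
    show "B.fr (g k \<otimes> x) e = loc_act S (E B) (g k) (B.fr x e)" if "x \<in> carrier S" for k x
      using that g by (simp add: B.loc_act_frac)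
  qed (rule w)
  also have "\<dots> = koszul_diff (LA B) K (\<lambda>k. loc_act S (E B) (g k)) ks (\<lambda>ls. word_cochain a v e (Suc q) ls B)"
    using B by (simp add: word_cochain_def)
  also have "\<dots> = ?R B"
  proof (rule LK.koszul_hom[symmetric, OF LA_operators[OF K g B] eval_hom[OF B] _ b])
    show "cech_act S fs (Suc q) (g k) x B = loc_act S (E B) (g k) (x B)" for k x
      using B by (simp add: cech_act_def)
  qed
  finally show "D q (word_cochain a v e q ks) B = ?R B" .
qed

lemma E_empty: "E {} = \<one>"
  by (simp add: cech_elem_def)

text \<open>The chain of word cochains begins with \<open>a\<close> itself, at the empty index set
  and the empty word. The chase exhibits it as a Koszul boundary, that is, as a combination of the
  \<open>g k\<close>.\<close>

theorem generated_in_degree: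
  fixes K :: "'k set"
  assumes K: "finite K" and g: "\<And>k. g k \<in> gr 1" and v: "\<And>i k. v i k \<in> gr (int r)"
    and F: "\<And>i. i < length fs \<Longrightarrow> (\<Oplus>k\<in>K. g k \<otimes> v i k) = fs ! i [^] Suc r"
    and H: "\<And>j. carrier (local_cohomology S gr fs j (n - int j)) = {\<one>\<^bsub>local_cohomology S gr fs j (n - int j)\<^esub>}"
    and a: "a \<in> gr n"
  shows "\<exists>s. (\<forall>k. s k \<in> gr (n - 1)) \<and> a = (\<Oplus>k\<in>K. g k \<otimes> s k)"
proof -
  let ?b = "word_cochain a v (Suc r)"
  have gc: "g k \<in> carrier S" for k using g gr_closed(1) by blast
  have ac: "a \<in> carrier S" using a gr_closed(1) by blast
  have vc: "v i k \<in> carrier S" for i k using v gr_closed(1) by blast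
  have "\<exists>e. (\<forall>k. e k \<in> C 0 (n - 1)) \<and> ?b 0 [] = (\<Oplus>\<^bsub>L 0\<^esub>k\<in>K. cech_act S fs 0 (g k) (e k))"
  proof (rule double_complex_chase[where D = "cech_diff S fs" and C = "\<lambda>q d. C q d" and b = ?b
        and N = "length fs" and \<gamma> = "\<lambda>q k. cech_act S fs q (g k)" and K = K])
    show "group_with_operators (L q) K (\<lambda>k. cech_act S fs q (g k))" for q by (rule L_operators[OF K gc])
    show "abelian_group_hom (L q) (L (Suc q)) (D q)" for q by (rule cech_diff_hom)
    show "D q (cech_act S fs q (g k) x) = cech_act S fs (Suc q) (g k) (D q x)"
      if "x \<in> carrier (L q)" for q k x by (rule cech_diff_act[OF gc that])
    show "additive_subgroup (C q d) (L q)" for q d by (rule C_subgroup)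
    show "cech_act S fs q (g k) x \<in> C q (d + 1)" if "x \<in> C q d" for q d k x by (rule C_act[OF g that])
    show "z = \<zero>\<^bsub>L 0\<^esub>" if "z \<in> C 0 n" "D 0 z = \<zero>\<^bsub>L 1\<^esub>" for z
    proof -
      have "z \<in> cech_coboundaries S gr fs 0 n"
        using cocycle_is_coboundary[of 0 n z] H[of 0] that by simp
      then show ?thesis by (simp add: cech_coboundaries_def cech_group_def L_simps)
    qed
    show "\<exists>y\<in>C p (n - int (Suc p)). D p y = z"
      if "z \<in> C (Suc p) (n - int (Suc p))" "D (Suc p) z = \<zero>\<^bsub>L (Suc (Suc p))\<^esub>" for p z
      using cocycle_is_coboundary[OF H that] by (auto simp: cech_coboundaries_def)
    show "?b q ks \<in> carrier (L q)" for q ks by (rule word_cochain_closed[OF ac vc])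
    show "?b q ks \<in> C q (n - int q)" if "length ks = q" for q and ks :: "'k list"
      by (rule word_cochain_gr[OF a v that])
    show "D q (?b q ks) = koszul_diff (L (Suc q)) K (\<lambda>k. cech_act S fs (Suc q) (g k)) ks (?b (Suc q))"
      if "length ks = q" for q ks
      by (rule cech_diff_word_cochain[OF K gc ac vc F that])
    \<comment> \<open>No index set has more than \<open>length fs\<close> elements, which fixes
      where the chase may begin.\<close>
    have "cech_index fs (Suc (length fs)) = {}"
    proof (rule equals0I)
      fix A assume A: "A \<in> cech_index fs (Suc (length fs))"
      have "card A \<le> card {..<length fs}"
        by (rule card_mono[OF finite_lessThan cech_indexD(2)[OF A]])
      then show False using cech_indexD(3)[OF A] by simp
    qed
    then show "carrier (L (Suc (length fs))) \<subseteq> {\<zero>\<^bsub>L (Suc (length fs))\<^esub>}"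
      by (simp add: L_simps restrict_def)
  qed
  then obtain e where e: "\<And>k. e k \<in> C 0 (n - 1)"
    and be: "?b 0 [] = (\<Oplus>\<^bsub>L 0\<^esub>k\<in>K. cech_act S fs 0 (g k) (e k))" by blast
  have i0: "{} \<in> cech_index fs 0" by (simp add: cech_index_0)
  interpret A: localization S "E {}" by (rule loc[OF i0])
  interpret ev: abelian_group_hom "L 0" "LA {}" "\<lambda>c. c {}" by (rule eval_hom[OF i0])
  \<comment> \<open>At the empty index set the denominator is 1, so any exponent may be written;
    \<open>Suc r\<close> matches the word cochain.\<close>
  have one: "E {} [^] (j::nat) = \<one>" for j by (simp add: E_empty)
  have "\<exists>s. s \<in> gr (n - 1) \<and> e k {} = A.fr s (Suc r)" for k
  proof -
    have "e k {} \<in> loc_component S gr (E {}) 0 (n - 1)" using e[of k] i0 by (auto simp: C_eq)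
    then obtain s j where s: "s \<in> gr (n - 1)" "e k {} = A.fr s j" by (auto simp: loc_component_def)
    then have "e k {} = A.fr s (Suc r)"
      unfolding s(2) A.frac_eq_iff[OF gr_closed(1)[OF s(1)] gr_closed(1)[OF s(1)]] one by blast
    then show ?thesis using s by blast
  qed
  then obtain s where s: "\<And>k. s k \<in> gr (n - 1)" "\<And>k. e k {} = A.fr (s k) (Suc r)" by metis
  have sc: "s k \<in> carrier S" for k using s(1) gr_closed(1) by blast
  have sum_c: "(\<Oplus>k\<in>K. g k \<otimes> s k) \<in> carrier S" by (rule finsum_closed) (simp add: gc sc)
  have ec: "e k \<in> carrier (L 0)" for k using e additive_subgroup.a_Hcarr[OF C_subgroup] by blast
  have "A.fr a (Suc r) = ?b 0 [] {}" using i0 by (simp add: word_cochain_def)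
  also have "\<dots> = (\<Oplus>\<^bsub>LA {}\<^esub>k\<in>K. cech_act S fs 0 (g k) (e k) {})"
    unfolding be by (rule ev.hom_finsum[OF K abelian_group_hom.hom_closed[OF cech_act_hom[OF gc] ec]])
  also have "(\<lambda>k. cech_act S fs 0 (g k) (e k) {}) = (\<lambda>k. A.fr (g k \<otimes> s k) (Suc r))"
    using i0 by (simp add: cech_act_def s(2) A.loc_act_frac[OF gc sc])
  also have "(\<Oplus>\<^bsub>LA {}\<^esub>k\<in>K. A.fr (g k \<otimes> s k) (Suc r)) = A.fr (\<Oplus>k\<in>K. g k \<otimes> s k) (Suc r)"
    by (rule A.finsum_frac[OF K m_closed[OF gc sc]])
  finally have "a = (\<Oplus>k\<in>K. g k \<otimes> s k)"
    using A.frac_eq_iff_same[OF ac sum_c] ac sum_c by (simp add: one)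
  then show ?thesis using s(1) by blast
qed

text \<open>The fractions \<open>y i / f_i\<close> agree on overlaps and thus form a 1-cocycle. As a
  coboundary it comes from one element of \<open>gr n\<close>, up to the powers of
  \<open>f_i\<close> inherent in equality of fractions.\<close>

theorem glue_compatible_family:
  assumes H: "carrier (local_cohomology S gr fs 1 n) = {\<one>\<^bsub>local_cohomology S gr fs 1 n\<^esub>}"
    and y: "\<And>i. i < length fs \<Longrightarrow> y i \<in> gr (n + 1)"
    and compat: "\<And>i j. i < length fs \<Longrightarrow> j < length fs \<Longrightarrow> fs ! j \<otimes> y i = fs ! i \<otimes> y j"
  shows "\<exists>a\<in>gr n. \<forall>i<length fs. \<exists>l::nat. fs ! i [^] l \<otimes> (fs ! i \<otimes> a) = fs ! i [^] l \<otimes> y i"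
proof -
  have yc: "y i \<in> carrier S" if "i < length fs" for i using y[OF that] gr_closed(1) by blast
  have ind1: "{i} \<in> cech_index fs 1" if "i < length fs" for i using that by (simp add: cech_index_def)
  have ind1E: "\<exists>i<length fs. A = {i}" if "A \<in> cech_index fs 1" for A
    using that by (auto simp: cech_index_def card_1_singleton_iff)
  have E1: "E {i} = fs ! i" if "i < length fs" for i
    using that cech_elem_insert[of "{}" i] fs_carrier by (simp add: E_empty)
  define z where "z = (\<lambda>A\<in>cech_index fs 1. loc_frac S (E A) (y (the_elem A)) 1)"
  have "z \<in> C 1 n"
    using y ind1E by (fastforce simp: C_eq z_def loc_component_def)
  moreover have "D 1 z = \<zero>\<^bsub>L (Suc 1)\<^esub>"
    unfolding cech_diff_eq L_simps
  proof (rule restrict_ext)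
    fix B assume B: "B \<in> cech_index fs (Suc 1)"
    interpret B: localization S "E B" by (rule loc[OF B])
    interpret LB: abelian_group "LA B" by (rule LA_group[OF B])
    have "card B = 2" using cech_indexD(3)[OF B] by simp
    \<comment> \<open>Ordering \<open>i\<close> and \<open>j\<close> fixes the signs: removing
      \<open>i\<close> counts positively and removing \<open>j\<close> negatively, so the two equal
      terms cancel.\<close>
    then obtain i j where ij: "B = {i, j}" "i < j"
      by (metis card_2_iff doubleton_eq_iff linorder_neqE_nat)
    have lt: "i < length fs" "j < length fs" using cech_indexD(4)[OF B] ij by auto
    have tm: "loc_map S (fs ! k) (E B) (z (B - {k})) = B.fr (fs ! k \<otimes> y l) 1"
      if k: "k \<in> B" and l: "B - {k} = {l}" "l < length fs" for k l
      using localization.loc_map_frac[OF loc[OF cech_index_Diff[OF B k]] _ yc[OF l(2)] cech_elem_Diff[OF B k], of 1]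
        fs_carrier[OF cech_indexD(4)[OF B k]] ind1[OF l(2)]
      unfolding l(1) by (simp add: z_def)
    have ti: "loc_map S (fs ! i) (E B) (z (B - {i})) = B.fr (fs ! i \<otimes> y j) 1"
    proof (rule tm)
      show "i \<in> B" "B - {i} = {j}" "j < length fs" using ij lt by auto
    qed
    have tj: "loc_map S (fs ! j) (E B) (z (B - {j})) = B.fr (fs ! i \<otimes> y j) 1"
    proof -
      have "j \<in> B" "B - {j} = {i}" using ij by auto
      then show ?thesis using tm[of j i] lt(1) compat[OF lt] by simp
    qed
    have "{l \<in> B. l < i} = {}" "{l \<in> B. l < j} = {i}" using ij by auto
    then have c: "card {l \<in> B. l < i} = 0" "card {l \<in> B. l < j} = 1" by (simp_all only: card.empty is_singletonI is_singleton_altdef[symmetric])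
    have "cech_term S fs z B i = B.fr (fs ! i \<otimes> y j) 1"
      "cech_term S fs z B j = \<ominus>\<^bsub>LA B\<^esub> B.fr (fs ! i \<otimes> y j) 1"
      by (simp_all add: cech_term_def Let_def ti tj c)
    moreover have "B.fr (fs ! i \<otimes> y j) 1 \<in> carrier (LA B)"
      using fs_carrier[OF lt(1)] yc[OF lt(2)] by simp
    ultimately have "(\<Oplus>\<^bsub>LA B\<^esub>l\<in>{i, j}. cech_term S fs z B l) = \<zero>\<^bsub>LA B\<^esub>"
      using ij(2) by (simp add: LB.r_neg Pi_def)
    then show "(\<Oplus>\<^bsub>LA B\<^esub>l\<in>B. cech_term S fs z B l) = \<zero>\<^bsub>LA B\<^esub>"
      using arg_cong[where f = "finsum (LA B) (cech_term S fs z B)", OF ij(1)] by simp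
  qed
  ultimately have "z \<in> cech_coboundaries S gr fs 1 n" by (intro cocycle_is_coboundary[OF H])
  then obtain c where c: "c \<in> C 0 n" "z = D 0 c" by (auto simp: cech_coboundaries_def)
  have i0: "{} \<in> cech_index fs 0" by (simp add: cech_index_0)
  obtain a k where a: "a \<in> gr n" "c {} = loc_frac S (E {}) a k"
    using c(1) i0 by (fastforce simp: C_eq loc_component_def)
  have ac: "a \<in> carrier S" using a(1) gr_closed(1) by blast
  have "\<exists>l::nat. fs ! i [^] l \<otimes> (fs ! i \<otimes> a) = fs ! i [^] l \<otimes> y i" if i: "i < length fs" for i
  proof -
    have fi: "fs ! i \<in> carrier S" using fs_carrier[OF i] .
    interpret I: localization S "fs ! i" by unfold_locales (rule fi)
    interpret LI: abelian_group I.Loc by (rule I.Loc_group)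
    have ind: "{i} \<in> cech_index fs (Suc 0)" using ind1[OF i] by simp
    have c0: "card {l. l = i \<and> l < i} = 0" by (rule card_eq_0_iff[THEN iffD2]) auto
    have "cech_term S fs c {i} i = I.fr (fs ! i [^] k \<otimes> a) k"
      using localization.loc_map_frac[OF loc[OF i0] fi ac, of "fs ! i" k] fi
      by (simp add: cech_term_def Let_def a(2) E1[OF i] E_empty c0)
    then have "D 0 c {i} = I.fr (fs ! i [^] k \<otimes> a) k"
      using ind fi ac by (simp add: cech_diff_eq E1[OF i])
    moreover have "z {i} = I.fr (y i) 1" using ind1[OF i] by (simp add: z_def E1[OF i])
    ultimately have "I.fr (fs ! i [^] k \<otimes> a) k = I.fr (y i) 1" using c(2) by simp
    then obtain m :: nat where "fs ! i [^] (m + 1) \<otimes> (fs ! i [^] k \<otimes> a) = fs ! i [^] (m + k) \<otimes> y i"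
      using fi ac yc[OF i] by (auto simp: I.frac_eq_iff)
    moreover have "fs ! i [^] (m + 1) \<otimes> (fs ! i [^] k \<otimes> a) = fs ! i [^] (m + k) \<otimes> (fs ! i \<otimes> a)"
      using pow_pow_mult[OF fi ac, of "m + 1" k] pow_pow_mult[OF fi ac, of "m + k" 1] fi by simp
    ultimately have "fs ! i [^] (m + k) \<otimes> (fs ! i \<otimes> a) = fs ! i [^] (m + k) \<otimes> y i" by simp
    then show ?thesis by blast
  qed
  then show ?thesis using a(1) by blast
qed

end

section \<open>The Rees algebra\<close>

lemma (in ring) ideal_finsum:
  assumes "ideal J R" "finite A" "\<And>i. i \<in> A \<Longrightarrow> h i \<in> J"
  shows "(\<Oplus>i\<in>A. h i) \<in> J"
  using assms(2,3)
proof (induction A)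
  case (insert i A)
  have "h \<in> A \<rightarrow> carrier R" "h i \<in> carrier R"
    using insert.prems ideal_closed(7)[OF assms(1)] by blast+
  then show ?case using insert ideal_closed(2)[OF assms(1)] by simp
qed (simp add: ideal_closed(1)[OF assms(1)])

text \<open>The combinations with coefficients in \<open>M\<close> form an ideal \<open>T\<close>.
  The multipliers that carry \<open>M\<close> into \<open>T\<close> again form an ideal, and it
  contains \<open>A\<close>.\<close>

lemma (in cring) ideal_prod_genideal_finite:
  assumes A: "finite A" "A \<subseteq> carrier R" and M: "ideal M R" and x: "x \<in> (Idl A) \<cdot> M"
  shows "\<exists>w. (\<forall>k. w k \<in> M) \<and> x = (\<Oplus>k\<in>A. k \<otimes> w k)"
proof -
  define T where "T = {\<Oplus>k\<in>A. k \<otimes> w k | w. \<forall>k. w k \<in> M}"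
  note Mc = ideal_closed[OF M]
  have kw: "k \<otimes> w k \<in> carrier R" if "k \<in> A" "\<forall>k. w k \<in> M" for k w
    using that A(2) Mc(7) by blast
  have T: "ideal T R"
  proof (rule ideal_of_closed)
    show "T \<subseteq> carrier R" using kw by (auto simp: T_def intro!: finsum_closed)
    have "\<zero> = (\<Oplus>k\<in>A. k \<otimes> \<zero>)" using A(2) by (intro add.finprod_one_eqI[symmetric]) auto
    then show "\<zero> \<in> T" using Mc(1) unfolding T_def by (intro CollectI exI[of _ "\<lambda>_. \<zero>"]) simp
  next
    fix x y assume "x \<in> T" "y \<in> T"
    then obtain v w where v: "\<forall>k. v k \<in> M" "x = (\<Oplus>k\<in>A. k \<otimes> v k)"
      and w: "\<forall>k. w k \<in> M" "y = (\<Oplus>k\<in>A. k \<otimes> w k)" unfolding T_def by blast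
    have "x \<oplus> y = (\<Oplus>k\<in>A. k \<otimes> v k \<oplus> k \<otimes> w k)"
      unfolding v(2) w(2) using kw v(1) w(1) by (intro finsum_addf[symmetric]) auto
    also have "\<dots> = (\<Oplus>k\<in>A. k \<otimes> (v k \<oplus> w k))"
      using A(2) v(1) w(1) Mc(7) by (intro finsum_cong') (auto simp: r_distr subset_iff)
    finally show "x \<oplus> y \<in> T"
      unfolding T_def using v(1) w(1) Mc(2) by (intro CollectI exI[of _ "\<lambda>k. v k \<oplus> w k"]) auto
  next
    fix r x assume r: "r \<in> carrier R" and "x \<in> T"
    then obtain v where v: "\<forall>k. v k \<in> M" "x = (\<Oplus>k\<in>A. k \<otimes> v k)" unfolding T_def by blast
    have "r \<otimes> x = (\<Oplus>k\<in>A. r \<otimes> (k \<otimes> v k))"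
      unfolding v(2) using kw v(1) r A(1) by (intro finsum_rdistr) auto
    also have "\<dots> = (\<Oplus>k\<in>A. k \<otimes> (r \<otimes> v k))"
      using A(2) v(1) Mc(7) r by (intro finsum_cong') (auto simp: m_lcomm subset_iff)
    finally show "r \<otimes> x \<in> T"
      unfolding T_def using v(1) Mc(3) r by (intro CollectI exI[of _ "\<lambda>k. r \<otimes> v k"]) auto
  qed
  note Tc = ideal_closed[OF T]
  have "ideal {i \<in> carrier R. \<forall>j\<in>M. i \<otimes> j \<in> T} R"
    by (rule ideal_of_closed) (use Tc(1-3) Mc(7) in \<open>auto simp: l_distr m_assoc\<close>)
  moreover have "k \<otimes> j \<in> T" if k: "k \<in> A" and j: "j \<in> M" for k j
  proof -
    have "(\<Oplus>l\<in>A. l \<otimes> (if k = l then j else \<zero>)) = (\<Oplus>l\<in>A. if k = l then l \<otimes> j else \<zero>)"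
      using A(2) Mc(7)[OF j] by (intro finsum_cong') (auto simp: subset_iff)
    also have "\<dots> = k \<otimes> j"
      using A k Mc(7)[OF j] by (intro finsum_singleton) auto
    finally show ?thesis
      unfolding T_def using j Mc(1) by (intro CollectI exI[of _ "\<lambda>l. if k = l then j else \<zero>"]) auto
  qed
  then have "A \<subseteq> {i \<in> carrier R. \<forall>j\<in>M. i \<otimes> j \<in> T}" using A(2) by blast
  ultimately have "Idl A \<subseteq> {i \<in> carrier R. \<forall>j\<in>M. i \<otimes> j \<in> T}" by (rule genideal_minimal)
  then have "(Idl A) \<cdot> M \<subseteq> T" by (intro ideal_prod_le[OF T]) blast
  then show ?thesis using x unfolding T_def by blast
qed

text \<open>Multiplying by the highest power of each generator that does not kill the element turns
  annihilation by powers into annihilation by the generators themselves, and hence by every element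
  of the ideal they generate.\<close>

lemma (in cring) common_annihilated_multiple:
  assumes "set as \<subseteq> carrier R" "z \<in> carrier R" "z \<noteq> \<zero>"
    and "\<And>a. a \<in> set as \<Longrightarrow> \<exists>l::nat. a [^] l \<otimes> z = \<zero>"
  shows "\<exists>s\<in>carrier R. s \<otimes> z \<noteq> \<zero> \<and> (\<forall>a\<in>set as. a \<otimes> (s \<otimes> z) = \<zero>)"
  using assms
proof (induction as)
  case Nil
  then show ?case by (intro bexI[of _ \<one>]) auto
next
  case (Cons a as)
  then obtain s where s: "s \<in> carrier R" "s \<otimes> z \<noteq> \<zero>" "\<forall>a\<in>set as. a \<otimes> (s \<otimes> z) = \<zero>" by auto
  have a: "a \<in> carrier R" and z: "z \<in> carrier R" using Cons.prems by auto
  obtain l :: nat where "a [^] l \<otimes> z = \<zero>" using Cons.prems(4)[of a] by auto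
  then have ex: "a [^] l \<otimes> (s \<otimes> z) = \<zero>" using a z s(1) by (simp add: m_lcomm[of "a [^] l"])
  define m where "m = (LEAST l::nat. a [^] l \<otimes> (s \<otimes> z) = \<zero>)"
  have m: "a [^] m \<otimes> (s \<otimes> z) = \<zero>" unfolding m_def using ex by (rule LeastI)
  have "m \<noteq> 0" using m s z by (metis l_one m_closed nat_pow_0)
  then obtain k where k: "m = Suc k" by (cases m) auto
  have nz: "a [^] k \<otimes> (s \<otimes> z) \<noteq> \<zero>" using not_less_Least[of k "\<lambda>l::nat. a [^] l \<otimes> (s \<otimes> z) = \<zero>"] k m_def by simp
  have "b \<otimes> (a [^] k \<otimes> s \<otimes> z) = \<zero>" if b: "b \<in> set (a # as)" for b
  proof (cases "b = a")
    case True
    then show ?thesis using m a s(1) z unfolding k by (simp add: m_ac)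
  next
    case False
    then have bb: "b \<in> set as" "b \<in> carrier R" using b Cons.prems(1) by auto
    have "b \<otimes> (a [^] k \<otimes> s \<otimes> z) = a [^] k \<otimes> (b \<otimes> (s \<otimes> z))"
      using a s(1) z bb(2) by (simp add: m_assoc m_lcomm[of b "a [^] k"])
    then show ?thesis using s(3) bb(1) a by simp
  qed
  then show ?case using nz a s(1) z by (intro bexI[of _ "a [^] k \<otimes> s"]) (auto simp: m_assoc)
qed

section \<open>The Rees algebra as a graded ring\<close>

locale rees_algebra = UP_cring R P for R (structure) and P (structure) +
  fixes Q
  assumes Q: "ideal Q R"
begin

abbreviation "S \<equiv> rees R Q"
abbreviation "gr \<equiv> rees_component R Q"

lemma Q_pow: "ideal (ideal_pow R Q n) R"
  by (rule R.ideal_pow_ideal[OF Q])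

lemmas Q_pow_closed = R.ideal_closed[OF Q_pow]

lemma S_simps:
  "carrier S = {p \<in> carrier P. \<forall>i. coeff P p i \<in> ideal_pow R Q i}"
  "x \<oplus>\<^bsub>S\<^esub> y = x \<oplus>\<^bsub>P\<^esub> y" "x \<otimes>\<^bsub>S\<^esub> y = x \<otimes>\<^bsub>P\<^esub> y" "\<zero>\<^bsub>S\<^esub> = \<zero>\<^bsub>P\<^esub>" "\<one>\<^bsub>S\<^esub> = \<one>\<^bsub>P\<^esub>"
  by (simp_all add: rees_def P_def)

lemma S_cring: "cring S"
proof -
  let ?H = "{p \<in> carrier P. \<forall>i. coeff P p i \<in> ideal_pow R Q i}"
  have "subring ?H P"
  proof (rule P.subringI)
    show "?H \<subseteq> carrier P" by blast
    show "\<one>\<^bsub>P\<^esub> \<in> ?H" using Q_pow_closed(1) by (auto simp: R.ideal_pow_0 simp del: R.nat_pow_0)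
    show "\<ominus>\<^bsub>P\<^esub> h \<in> ?H" if "h \<in> ?H" for h using that Q_pow_closed(5) by auto
    show "h \<oplus>\<^bsub>P\<^esub> h' \<in> ?H" if "h \<in> ?H" "h' \<in> ?H" for h h' using that Q_pow_closed(2) by auto
    show "h \<otimes>\<^bsub>P\<^esub> h' \<in> ?H" if h: "h \<in> ?H" "h' \<in> ?H" for h h'
    proof -
      have "(\<Oplus>i\<in>{..n}. coeff P h i \<otimes> coeff P h' (n - i)) \<in> ideal_pow R Q n" for n
      proof (rule R.ideal_finsum[OF Q_pow])
        fix i assume "i \<in> {..n}"
        then show "coeff P h i \<otimes> coeff P h' (n - i) \<in> ideal_pow R Q n"
          using R.ideal_pow_mult[OF Q, of "coeff P h i" i "coeff P h' (n - i)" "n - i"] h by simp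
      qed simp
      then show ?thesis using h by simp
    qed
  qed
  then have "subcring ?H P" by (rule P.subcringI')
  then have "cring (P\<lparr>carrier := ?H\<rparr>)" using P.subcring_iff[of ?H] by blast
  then show ?thesis by (simp add: rees_def P_def)
qed

sublocale S: cring S by (rule S_cring)

lemma monom_in: "a \<in> ideal_pow R Q n \<Longrightarrow> monom P a n \<in> carrier S"
  using Q_pow_closed(1,7) by (auto simp: S_simps)

lemma gr_nat: "gr (int n) = {monom P a n | a. a \<in> ideal_pow R Q n}"
  by (simp add: rees_component_def P_def)

lemma gr_neg: "n < 0 \<Longrightarrow> gr n = {\<zero>\<^bsub>S\<^esub>}"
  by (simp add: rees_component_def P_def S_simps)

lemma grE:
  assumes "x \<in> gr n"
  obtains "n < 0" "x = \<zero>\<^bsub>S\<^esub>" | m a where "n = int m" "a \<in> ideal_pow R Q m" "x = monom P a m"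
proof (cases "n < 0")
  case True
  then show ?thesis using assms that(1) by (simp add: gr_neg)
next
  case False
  then obtain m where "n = int m" by (metis nonneg_int_cases not_le)
  then show ?thesis using assms that(2) by (auto simp: gr_nat)
qed

lemma monom_gr: "a \<in> ideal_pow R Q n \<Longrightarrow> monom P a n \<in> gr (int n)"
  by (auto simp: gr_nat)

lemma zero_gr: "\<zero>\<^bsub>S\<^esub> \<in> gr n"
proof (cases "n < 0")
  case False
  then obtain m where "n = int m" by (metis nonneg_int_cases not_le)
  then show ?thesis using monom_gr[OF Q_pow_closed(1), of m] by (simp add: S_simps)
qed (simp add: gr_neg)

lemma monom_add_S:
  "a \<in> ideal_pow R Q n \<Longrightarrow> b \<in> ideal_pow R Q n \<Longrightarrow> monom P a n \<oplus>\<^bsub>S\<^esub> monom P b n = monom P (a \<oplus> b) n"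
  using Q_pow_closed(7) by (simp add: S_simps)

lemma monom_mult_S:
  "a \<in> ideal_pow R Q m \<Longrightarrow> b \<in> ideal_pow R Q n \<Longrightarrow> monom P a m \<otimes>\<^bsub>S\<^esub> monom P b n = monom P (a \<otimes> b) (m + n)"
  using Q_pow_closed(7) by (simp add: S_simps)

lemma monom_zero_S: "monom P \<zero> n = \<zero>\<^bsub>S\<^esub>"
  by (simp add: S_simps)

lemma monom_neg_S:
  assumes a: "a \<in> ideal_pow R Q n" shows "\<ominus>\<^bsub>S\<^esub> monom P a n = monom P (\<ominus> a) n"
proof (rule S.minus_equality)
  show "monom P (\<ominus> a) n \<oplus>\<^bsub>S\<^esub> monom P a n = \<zero>\<^bsub>S\<^esub>"
    using monom_add_S[OF Q_pow_closed(5)[OF a] a] Q_pow_closed(7)[OF a]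
    by (simp add: R.l_neg S_simps(4))
qed (intro monom_in a Q_pow_closed(5)[OF a])+

lemma monom_eq_iff:
  "a \<in> ideal_pow R Q n \<Longrightarrow> b \<in> ideal_pow R Q n \<Longrightarrow> monom P a n = monom P b n \<longleftrightarrow> a = b"
  using inj_onD[OF monom_inj] Q_pow_closed(7) by blast

lemma monom_finsum_S:
  assumes "finite A" "\<And>k. k \<in> A \<Longrightarrow> c k \<in> ideal_pow R Q n"
  shows "(\<Oplus>\<^bsub>S\<^esub>k\<in>A. monom P (c k) n) = monom P (\<Oplus>k\<in>A. c k) n"
  using assms
proof (induction A)
  case (insert i A)
  have "(\<lambda>k. monom P (c k) n) \<in> A \<rightarrow> carrier S" "monom P (c i) n \<in> carrier S"
    "c \<in> A \<rightarrow> carrier R" "c i \<in> carrier R"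
    using insert.prems monom_in Q_pow_closed(7) by blast+
  moreover have "(\<Oplus>k\<in>A. c k) \<in> ideal_pow R Q n"
    using insert by (intro R.ideal_finsum[OF Q_pow]) auto
  ultimately show ?case using insert by (simp add: monom_add_S del: monom_add)
qed (simp add: S_simps(4))

lemma monom_pow_S:
  assumes "a \<in> Q"
  shows "a [^] k \<in> ideal_pow R Q k" "monom P a 1 [^]\<^bsub>S\<^esub> k = monom P (a [^] k) (k::nat)"
proof (induction k)
  case 0
  { case 1 show ?case using R.ideal_pow_0 by simp }
  { case 2 show ?case by (simp add: S_simps) }
next
  case (Suc k)
  have a1: "a \<in> ideal_pow R Q 1" using assms R.ideal_pow_1[OF Q] by simp
  { case 1 show ?case using R.ideal_pow_mult[OF Q Suc(1) a1] by simp }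
  { case 2 show ?case using monom_mult_S[OF Suc(1) a1] Suc(2) by simp }
qed

lemma S_graded: "graded_ring S gr"
proof (intro graded_ring.intro S_cring graded_ring_axioms.intro)
  show "additive_subgroup (gr n) S" for n
  proof (rule additive_subgroup.intro, rule S.add.subgroupI)
    show "gr n \<subseteq> carrier S" using monom_in by (auto elim!: grE)
    show "gr n \<noteq> {}" using zero_gr by blast
    show "\<ominus>\<^bsub>S\<^esub> x \<in> gr n" if "x \<in> gr n" for x
      using that
    proof (cases rule: grE)
      case 1
      then show ?thesis using zero_gr by simp
    next
      case (2 m a)
      then show ?thesis using monom_neg_S monom_gr Q_pow_closed(5) by metis
    qed
    show "x \<oplus>\<^bsub>S\<^esub> y \<in> gr n" if x: "x \<in> gr n" and y: "y \<in> gr n" for x y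
      using x
    proof (cases rule: grE)
      case 1
      then show ?thesis using x y by (auto simp: gr_neg)
    next
      case (2 m a)
      then obtain b where "b \<in> ideal_pow R Q m" "y = monom P b m" using y by (auto simp: gr_nat)
      then show ?thesis using 2 monom_add_S monom_gr Q_pow_closed(2) by metis
    qed
  qed
  show "x \<otimes>\<^bsub>S\<^esub> y \<in> gr (m + n)" if x: "x \<in> gr m" and y: "y \<in> gr n" for x y m n
    using x
  proof (cases rule: grE)
    case 1
    have "y \<in> carrier S" using y monom_in by (auto elim!: grE)
    then show ?thesis using 1 zero_gr by simp
  next
    case (2 m' a)
    have xS: "x \<in> carrier S" using 2 monom_in by simp
    show ?thesis using y
    proof (cases rule: grE)
      case 1
      then show ?thesis using xS zero_gr by simp
    next
      case (2 n' b)
      then show ?thesis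
        using \<open>a \<in> _\<close> \<open>m = _\<close> \<open>x = _\<close> monom_mult_S[of a m' b n'] monom_gr[of "a \<otimes> b" "m' + n'"]
          R.ideal_pow_mult[OF Q, of a m' b n'] by simp
    qed
  qed
  show "\<one>\<^bsub>S\<^esub> \<in> gr 0" using monom_gr[of \<one> 0] R.ideal_pow_0 by (simp add: S_simps)
qed

lemma gr_1: "gr 1 = {monom P a 1 | a. a \<in> Q}"
  using gr_nat[of 1] R.ideal_pow_1[OF Q] by simp

section \<open>Consequences of vanishing cohomology for the powers of \<open>Q\<close>\<close>

context
  fixes fs
  assumes gens: "degree_one_generators S gr fs"
begin

lemma fs_cech: "cech_complex S gr fs"
  using gens S_graded unfolding degree_one_generators_def
  by (intro cech_complex.intro cech_complex_axioms.intro) auto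

lemma fs_monom: "\<exists>a. \<forall>i<length fs. a i \<in> Q \<and> fs ! i = monom P (a i) 1"
proof -
  have "\<exists>a. a \<in> Q \<and> fs ! i = monom P a 1" if "i < length fs" for i
    using gens nth_mem[OF that] unfolding degree_one_generators_def gr_1 by blast
  then show ?thesis by metis
qed

text \<open>The annihilator of \<open>p\<close> is an ideal of \<open>S\<close>, so with
  \<open>fs\<close> it contains the whole irrelevant ideal, in particular
  \<open>y t\<close>.\<close>

lemma annihilator_of_fs:
  assumes p: "p \<in> carrier S" and fs: "\<And>i. i < length fs \<Longrightarrow> (fs ! i) \<otimes>\<^bsub>S\<^esub> p = \<zero>\<^bsub>S\<^esub>" and y: "y \<in> Q"
  shows "monom P y 1 \<otimes>\<^bsub>S\<^esub> p = \<zero>\<^bsub>S\<^esub>"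
proof -
  have sub: "set fs \<subseteq> carrier S"
    using gens monom_in[of _ 1] R.ideal_pow_1[OF Q] unfolding degree_one_generators_def gr_1 by auto
  have "ideal {q \<in> carrier S. q \<otimes>\<^bsub>S\<^esub> p = \<zero>\<^bsub>S\<^esub>} S"
    by (rule S.ideal_of_closed) (use p in \<open>auto simp: S.l_distr S.m_assoc\<close>)
  moreover have "set fs \<subseteq> {q \<in> carrier S. q \<otimes>\<^bsub>S\<^esub> p = \<zero>\<^bsub>S\<^esub>}"
    using fs sub by (auto simp: in_set_conv_nth)
  ultimately have "Idl\<^bsub>S\<^esub> (set fs) \<subseteq> {q \<in> carrier S. q \<otimes>\<^bsub>S\<^esub> p = \<zero>\<^bsub>S\<^esub>}"
    by (rule S.genideal_minimal)
  moreover have "monom P y 1 \<in> irrelevant_ideal S gr"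
  proof -
    have yg: "monom P y 1 \<in> gr 1" using y gr_1 by blast
    have "(\<Oplus>\<^bsub>S\<^esub>i\<in>{1..1::int}. monom P y 1) = monom P y 1"
      using monom_in[of y 1] y R.ideal_pow_1[OF Q] by simp
    then show ?thesis
      unfolding irrelevant_ideal_def using yg
      by (intro CollectI exI[of _ "\<lambda>_. monom P y 1"] exI[of _ 1]) auto
  qed
  ultimately show ?thesis using gens unfolding degree_one_generators_def by blast
qed

text \<open>The elements \<open>r f_i\<close> all lie in degree \<open>n + 1\<close> by assumption
  and are compatible; gluing yields some \<open>c\<close> in \<open>Q^n\<close>, and regularity of
  \<open>y\<close> forces \<open>c = r\<close>.\<close>

lemma colon_if_cohomology_vanishes:
  assumes H: "carrier (local_cohomology S gr fs 1 (int n)) = {\<one>\<^bsub>local_cohomology S gr fs 1 (int n)\<^esub>}"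
    and nzd: "y \<in> Q" "\<And>z. z \<in> carrier R \<Longrightarrow> y \<otimes> z = \<zero> \<Longrightarrow> z = \<zero>"
    and r: "r \<in> carrier R" "\<And>b. b \<in> Q \<Longrightarrow> r \<otimes> b \<in> ideal_pow R Q (Suc n)"
  shows "r \<in> ideal_pow R Q n"
proof -
  interpret cech_complex S gr fs by (rule fs_cech)
  obtain a where a: "\<And>i. i < length fs \<Longrightarrow> a i \<in> Q" "\<And>i. i < length fs \<Longrightarrow> fs ! i = monom P (a i) 1"
    using fs_monom by blast
  have a1: "a i \<in> ideal_pow R Q 1" if "i < length fs" for i using a(1)[OF that] R.ideal_pow_1[OF Q] by simp
  have ac: "a i \<in> carrier R" if "i < length fs" for i using R.ideal_closed(7)[OF Q a(1)[OF that]] .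
  have "\<exists>p\<in>gr (int n). \<forall>i<length fs. \<exists>l::nat.
      fs ! i [^]\<^bsub>S\<^esub> l \<otimes>\<^bsub>S\<^esub> (fs ! i \<otimes>\<^bsub>S\<^esub> p) = fs ! i [^]\<^bsub>S\<^esub> l \<otimes>\<^bsub>S\<^esub> monom P (r \<otimes> a i) (Suc n)"
  proof (rule glue_compatible_family[OF H])
    show "monom P (r \<otimes> a i) (Suc n) \<in> gr (int n + 1)" if "i < length fs" for i
      using monom_gr[OF r(2)[OF a(1)[OF that]]] by (simp add: add.commute)
    show "fs ! j \<otimes>\<^bsub>S\<^esub> monom P (r \<otimes> a i) (Suc n) = fs ! i \<otimes>\<^bsub>S\<^esub> monom P (r \<otimes> a j) (Suc n)"
      if i: "i < length fs" and j: "j < length fs" for i j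
      using monom_mult_S[OF a1[OF j] r(2)[OF a(1)[OF i]]] monom_mult_S[OF a1[OF i] r(2)[OF a(1)[OF j]]]
        ac[OF i] ac[OF j] r(1) a(2)[OF i] a(2)[OF j] by (simp add: R.m_ac del: monom_mult)
  qed
  then obtain c where c: "c \<in> ideal_pow R Q n"
    and eq: "\<And>i. i < length fs \<Longrightarrow> \<exists>l::nat. fs ! i [^]\<^bsub>S\<^esub> l \<otimes>\<^bsub>S\<^esub> (fs ! i \<otimes>\<^bsub>S\<^esub> monom P c n) =
      fs ! i [^]\<^bsub>S\<^esub> l \<otimes>\<^bsub>S\<^esub> monom P (r \<otimes> a i) (Suc n)"
    unfolding gr_nat by blast
  have cc: "c \<in> carrier R" using Q_pow_closed(7)[OF c] .
  \<comment> \<open>Each \<open>a i\<close> has a power that kills \<open>z\<close>. If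
    \<open>z\<close> were nonzero, some nonzero multiple, viewed in degree 0, would be killed by all
    of \<open>fs\<close>, hence by \<open>y t\<close>, against the regularity of
    \<open>y\<close>.\<close>
  define z where "z = r \<ominus> c"
  have zc: "z \<in> carrier R" using r(1) cc by (simp add: z_def)
  have ann: "\<exists>l::nat. a i [^] l \<otimes> z = \<zero>" if i: "i < length fs" for i
  proof -
    obtain l :: nat where l: "fs ! i [^]\<^bsub>S\<^esub> l \<otimes>\<^bsub>S\<^esub> (fs ! i \<otimes>\<^bsub>S\<^esub> monom P c n) =
        fs ! i [^]\<^bsub>S\<^esub> l \<otimes>\<^bsub>S\<^esub> monom P (r \<otimes> a i) (Suc n)" using eq[OF i] by blast
    note pw = monom_pow_S[OF a(1)[OF i], of l]
    have aic: "a i \<otimes> c \<in> ideal_pow R Q (Suc n)" using R.ideal_pow_mult[OF Q a1[OF i] c] by simp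
    have "monom P (a i [^] l \<otimes> (a i \<otimes> c)) (l + Suc n) = monom P (a i [^] l \<otimes> (r \<otimes> a i)) (l + Suc n)"
      using l unfolding a(2)[OF i] pw(2) monom_mult_S[OF a1[OF i] c] monom_mult_S[OF pw(1) r(2)[OF a(1)[OF i]]]
      using monom_mult_S[OF pw(1) aic] by (simp del: monom_mult)
    then have "a i [^] l \<otimes> (a i \<otimes> c) = a i [^] l \<otimes> (r \<otimes> a i)"
      using R.ideal_pow_mult[OF Q pw(1) aic] R.ideal_pow_mult[OF Q pw(1) r(2)[OF a(1)[OF i]]]
      by (subst (asm) monom_eq_iff) auto
    then have "a i [^] Suc l \<otimes> z = \<zero>"
      using ac[OF i] cc r(1)
      by (simp add: z_def R.minus_eq R.r_distr R.r_minus R.m_assoc R.m_comm[of r] R.r_neg)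
    then show ?thesis by blast
  qed
  have "z = \<zero>"
  proof (rule ccontr)
    assume nz: "z \<noteq> \<zero>"
    have "\<exists>s\<in>carrier R. s \<otimes> z \<noteq> \<zero> \<and> (\<forall>b\<in>set (map a [0..<length fs]). b \<otimes> (s \<otimes> z) = \<zero>)"
      by (rule R.common_annihilated_multiple[OF _ zc nz]) (use ac ann in auto)
    then obtain s where s: "s \<in> carrier R" "s \<otimes> z \<noteq> \<zero>"
      and kill: "\<And>i. i < length fs \<Longrightarrow> a i \<otimes> (s \<otimes> z) = \<zero>" by auto
    have s0: "s \<otimes> z \<in> ideal_pow R Q 0" using s(1) zc R.ideal_pow_0 by simp
    have y1: "y \<in> ideal_pow R Q 1" using nzd(1) R.ideal_pow_1[OF Q] by simp
    have "monom P y 1 \<otimes>\<^bsub>S\<^esub> monom P (s \<otimes> z) 0 = \<zero>\<^bsub>S\<^esub>"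
      by (rule annihilator_of_fs[OF monom_in[OF s0] _ nzd(1)])
        (simp only: a(2) monom_mult_S[OF a1 s0] kill monom_zero_S)
    then have "monom P (y \<otimes> (s \<otimes> z)) 1 = monom P \<zero> 1"
      by (simp only: monom_mult_S[OF y1 s0] monom_zero_S add_0_right)
    moreover have "y \<otimes> (s \<otimes> z) \<in> ideal_pow R Q 1"
      using R.ideal_pow_mult[OF Q y1 s0] by (simp only: add_0_right)
    ultimately have "y \<otimes> (s \<otimes> z) = \<zero>" using monom_eq_iff Q_pow_closed(1) by blast
    then show False using nzd(2) s zc by blast
  qed
  then show ?thesis using R.eq_if_minus_eq_zero[OF r(1) cc] c unfolding z_def by simp
qed

text \<open>The coefficients required by \<open>generated_in_degree\<close> come from the reduction
  equation: \<open>c i^(r+1)\<close> lies in \<open>Q^(r+1) = I Q^r\<close>.\<close>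

lemma reduction_if_cohomology_vanishes:
  assumes I: "I = Idl A" "finite A" "A \<subseteq> carrier R" "I \<subseteq> Q"
    and red: "I \<cdot> ideal_pow R Q r = ideal_pow R Q (Suc r)"
    and H: "\<And>j. carrier (local_cohomology S gr fs j (int n - int j)) =
      {\<one>\<^bsub>local_cohomology S gr fs j (int n - int j)\<^esub>}"
    and a: "a \<in> ideal_pow R Q n"
  shows "if n = 0 then a = \<zero> else a \<in> I \<cdot> ideal_pow R Q (n - 1)"
proof -
  interpret cech_complex S gr fs by (rule fs_cech)
  obtain c where c: "\<And>i. i < length fs \<Longrightarrow> c i \<in> Q" "\<And>i. i < length fs \<Longrightarrow> fs ! i = monom P (c i) 1"
    using fs_monom by blast
  have AI: "A \<subseteq> I" unfolding I(1) by (rule R.genideal_self[OF I(3)])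
  have "\<exists>w. (\<forall>k. w k \<in> ideal_pow R Q r) \<and> c i [^] Suc r = (\<Oplus>k\<in>A. k \<otimes> w k)" if i: "i < length fs" for i
    by (rule R.ideal_prod_genideal_finite[OF I(2,3) Q_pow])
      (use monom_pow_S(1)[OF c(1)[OF i], of "Suc r"] red I(1) in simp)
  then obtain w where w: "\<And>i k. i < length fs \<Longrightarrow> w i k \<in> ideal_pow R Q r"
    and cw: "\<And>i. i < length fs \<Longrightarrow> c i [^] Suc r = (\<Oplus>k\<in>A. k \<otimes> w i k)" by metis
  \<comment> \<open>Both families are continued by zero, since their degrees are demanded at all
    indices.\<close>
  define g where "g k = (if k \<in> A then monom P k 1 else \<zero>\<^bsub>S\<^esub>)" for k
  define v where "v i k = (if i < length fs then monom P (w i k) r else \<zero>\<^bsub>S\<^esub>)" for i k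
  have A1: "k \<in> ideal_pow R Q 1" if "k \<in> A" for k using that AI I(4) R.ideal_pow_1[OF Q] by auto
  have kw: "k \<otimes> t \<in> ideal_pow R Q (Suc m)" if "k \<in> A" "t \<in> ideal_pow R Q m" for k t m
    using R.ideal_pow_mult[OF Q A1[OF that(1)] that(2)] by simp
  have mk: "monom P k 1 \<otimes>\<^bsub>S\<^esub> monom P t m = monom P (k \<otimes> t) (Suc m)"
    if "k \<in> A" "t \<in> ideal_pow R Q m" for k t m
    using monom_mult_S[OF A1[OF that(1)] that(2)] by (simp del: monom_mult)
  have sum_eq: "(\<Oplus>\<^bsub>S\<^esub>k\<in>A. g k \<otimes>\<^bsub>S\<^esub> monom P (t k) m) = monom P (\<Oplus>k\<in>A. k \<otimes> t k) (Suc m)"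
    if t: "\<And>k. t k \<in> ideal_pow R Q m" for t m
  proof -
    have "(\<Oplus>\<^bsub>S\<^esub>k\<in>A. g k \<otimes>\<^bsub>S\<^esub> monom P (t k) m) = (\<Oplus>\<^bsub>S\<^esub>k\<in>A. monom P (k \<otimes> t k) (Suc m))"
    proof (rule S.finsum_cong'[OF refl])
      show "g k \<otimes>\<^bsub>S\<^esub> monom P (t k) m = monom P (k \<otimes> t k) (Suc m)" if "k \<in> A" for k
        unfolding g_def using mk[OF that t] that by (simp only: if_True)
    qed (use monom_in[OF kw[OF _ t]] in blast)
    also have "\<dots> = monom P (\<Oplus>k\<in>A. k \<otimes> t k) (Suc m)"
      by (rule monom_finsum_S[OF I(2) kw[OF _ t]])
    finally show ?thesis .
  qed
  have "\<exists>s. (\<forall>k. s k \<in> gr (int n - 1)) \<and> monom P a n = (\<Oplus>\<^bsub>S\<^esub>k\<in>A. g k \<otimes>\<^bsub>S\<^esub> s k)"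
  proof (rule generated_in_degree[OF I(2) _ _ _ H monom_gr[OF a]])
    show "g k \<in> gr 1" for k using monom_gr[OF A1, of k] zero_gr by (simp add: g_def)
    show "v i k \<in> gr (int r)" for i k using monom_gr[OF w, of i k] zero_gr by (simp add: v_def)
    show "(\<Oplus>\<^bsub>S\<^esub>k\<in>A. g k \<otimes>\<^bsub>S\<^esub> v i k) = fs ! i [^]\<^bsub>S\<^esub> Suc r" if i: "i < length fs" for i
      using sum_eq[OF w[OF i]] monom_pow_S(2)[OF c(1)[OF i], of "Suc r"] i
      by (simp only: v_def if_True c(2)[OF i] cw[OF i, symmetric])
  qed
  then obtain s where s: "\<And>k. s k \<in> gr (int n - 1)" and as: "monom P a n = (\<Oplus>\<^bsub>S\<^esub>k\<in>A. g k \<otimes>\<^bsub>S\<^esub> s k)"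
    by blast
  show ?thesis
  proof (cases n)
    case 0
    \<comment> \<open>The coefficients would have degree -1, where the Rees algebra
      vanishes.\<close>
    have "s k = \<zero>\<^bsub>S\<^esub>" for k using s[of k] 0 gr_neg[of "-1"] by simp
    moreover have "g k \<in> carrier S" if "k \<in> A" for k using monom_in[OF A1[OF that]] that by (simp add: g_def)
    ultimately have "monom P a n = \<zero>\<^bsub>S\<^esub>"
      unfolding as by (intro S.add.finprod_one_eqI) simp
    then have "monom P a n = monom P \<zero> n" by (simp only: monom_zero_S)
    then have "a = \<zero>" using monom_eq_iff[OF a Q_pow_closed(1)] by blast
    then show ?thesis using 0 by simp
  next
    case (Suc m)
    have "\<exists>t. t \<in> ideal_pow R Q m \<and> s k = monom P t m" for k
      using s[of k] Suc gr_nat[of m] by auto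
    then obtain t where t: "\<And>k. t k \<in> ideal_pow R Q m" "\<And>k. s k = monom P (t k) m" by metis
    have "monom P a n = monom P (\<Oplus>k\<in>A. k \<otimes> t k) n"
      using as by (simp only: t(2) sum_eq[OF t(1)] Suc)
    moreover have "(\<Oplus>k\<in>A. k \<otimes> t k) \<in> ideal_pow R Q n"
      unfolding Suc by (rule R.ideal_finsum[OF Q_pow I(2) kw[OF _ t(1)]])
    ultimately have "a = (\<Oplus>k\<in>A. k \<otimes> t k)" using a monom_eq_iff by blast
    also have "\<dots> \<in> I \<cdot> ideal_pow R Q m"
    proof (rule R.ideal_finsum[OF R.ideal_prod_is_ideal[OF _ Q_pow] I(2)])
      show "ideal I R" unfolding I(1) by (rule R.genideal_ideal[OF I(3)])
      show "k \<otimes> t k \<in> I \<cdot> ideal_pow R Q m" if "k \<in> A" for k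
        using AI that t(1) by (intro ideal_prod.prod) auto
    qed
    finally show ?thesis using Suc by simp
  qed
qed

end

end

section \<open>The bound by the regularity\<close>

lemma regularity_less_imp_vanishing:
  assumes reg: "regularity S gr fs < ereal (real n)" and d: "int n \<le> d + int j"
  shows "carrier (local_cohomology S gr fs j d) = {\<one>\<^bsub>local_cohomology S gr fs j d\<^esub>}"
proof (rule ccontr)
  assume "\<not> ?thesis"
  then have "ereal (real_of_int d) \<le> top_degree (local_cohomology S gr fs j)"
    unfolding top_degree_def by (intro SUP_upper) simp
  then have "ereal (real_of_int d) + ereal (real j) \<le> top_degree (local_cohomology S gr fs j) + ereal (real j)"
    by (rule add_right_mono)
  also have "\<dots> \<le> regularity S gr fs"
    unfolding regularity_def by (rule SUP_upper) simp
  finally have "ereal (real_of_int d) + ereal (real j) < ereal (real n)"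
    using reg by (rule le_less_trans)
  then have "real_of_int (d + int j) < real_of_int (int n)" by simp
  then show False using d by linarith
qed

context maxideal_reduction
begin

lemma n1_le_regularity:
  assumes gens: "degree_one_generators (rees R \<mm>) (rees_component R \<mm>) fs"
  shows "ereal (real (n\<^sub>1 R \<mm> I)) \<le> regularity (rees R \<mm>) (rees_component R \<mm>) fs"
proof (rule ccontr)
  define n where "n = n\<^sub>1 R \<mm> I"
  assume "\<not> ?thesis"
  then have "regularity (rees R \<mm>) (rees_component R \<mm>) fs < ereal (real n)" by (simp add: n_def)
  note H = regularity_less_imp_vanishing[OF this]
  interpret A: rees_algebra R "UP R" \<mm>
    by (intro rees_algebra.intro rees_algebra_axioms.intro UP_cring.intro is_cring maxideal)
  obtain y where y: "y \<in> \<mm>" "\<And>z. z \<in> carrier R \<Longrightarrow> y \<otimes> z = \<zero> \<Longrightarrow> z = \<zero>"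
    using positive_depthE[OF depth] by blast
  obtain G where G: "G \<subseteq> carrier R" "finite G" "I = Idl G" using finetely_gen[OF I_ideal] by blast
  obtain r where r: "I \<cdot> ideal_pow R \<mm> r = ideal_pow R \<mm> (Suc r)"
    using reduction unfolding reduction_of_def by auto
  \<comment> \<open>This uses vanishing in bidegrees \<open>(j, n - j)\<close>, the limiting case of
    the regularity bound; the colon statement below uses \<open>(1, n)\<close>, which has one degree
    to spare.\<close>
  have gen: "if n = 0 then a = \<zero> else a \<in> J (n - 1)" if "a \<in> ideal_pow R \<mm> n" for a
    by (rule A.reduction_if_cohomology_vanishes[OF gens G(3,2,1) I_le r _ that]) (rule H, simp)
  have colon: "z \<in> ideal_pow R \<mm> n"
    if "z \<in> carrier R" "\<And>b. b \<in> \<mm> \<Longrightarrow> z \<otimes> b \<in> ideal_pow R \<mm> (Suc n)" for z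
    by (rule A.colon_if_cohomology_vanishes[OF gens _ y that]) (rule H, simp)
  show False
  proof (cases n)
    case 0
    then have "\<one> = \<zero>" using gen[of \<one>] ideal_pow_0 by simp
    then show False using one_notin_maxideal maxideal_closed(1) by simp
  next
    case (Suc k)
    \<comment> \<open>As \<open>n = k + 1\<close>, generation by \<open>I\<close> gives
      \<open>J k = \<mm>^n\<close>, and the colon statement becomes weak fullness of
      \<open>J k\<close>.\<close>
    have Jk: "J k = ideal_pow R \<mm> n" using gen J_le[of k] Suc by auto
    have "weakly_m_full R \<mm> (J k)"
    proof (rule weakly_m_fullI[OF J_ideal])
      fix z assume z: "z \<in> carrier R" "\<And>b. b \<in> \<mm> \<Longrightarrow> z \<otimes> b \<in> J k \<cdot> \<mm>"
      then show "z \<in> J k" unfolding Jk ideal_pow_Suc[symmetric] by (rule colon)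
    qed
    then show False using n1_pred[of k] Suc n_def by simp
  qed
qed

end

theorem theorem3p10:
  fixes R :: "('a, 'b) ring_scheme" and \<mm> I :: "'a set"
  assumes "noetherian_local_ring R \<mm>"
    and "infinite (carrier (R Quot \<mm>))"
    and "positive_depth R \<mm>"
    and "reduction_of R \<mm> I"
  shows "n\<^sub>2 R \<mm> I \<le> n\<^sub>3 R \<mm> I \<and> n\<^sub>3 R \<mm> I = n\<^sub>1 R \<mm> I \<and>
    (\<forall>fs. degree_one_generators (rees R \<mm>) (rees_component R \<mm>) fs \<longrightarrow>
       ereal (real (n\<^sub>1 R \<mm> I)) \<le> regularity (rees R \<mm>) (rees_component R \<mm>) fs)"
proof -
  interpret maxideal_reduction R \<mm> I
    using assms by (intro maxideal_reduction.intro maxideal_reduction_axioms.intro)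
  show ?thesis
    using n3_eq_n1 n2_le_n1 n1_le_regularity by simp
qed

end
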